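(* Let $A,A^*$ be a Leonard pair in $\mathcal A$, let $\Phi=(A;\{E_i\}_{i=0}^d;A^*;\{E^*_i\}_{i=0}^d)$ be a Leonard system associated with $A,A^*$, and let $(\{\theta_i\}_{i=0}^d;\{\theta^*_i\}_{i=0}^d;\{\varphi_i\}_{i=1}^d;\{\phi_i\}_{i=1}^d)$ be the parameter array of $\Phi$. Assume $d\ge 1$ and set $\alpha=(\theta^*_d-\theta^*_0)(\theta_d-\theta_0)^{-1}$. For scalars $\xi,\zeta,\xi^*,\zeta^*\in\mathbb K$ with $\xi,\xi^*$ nonzero, write $P(\xi,\zeta,\xi^*,\zeta^* )$ for the Leonard pair $\xi A+\zeta I,\ \xi^*A^*+\zeta^*I$. Then the following hold, where $(\xi,\zeta,\xi^*,\zeta^* )$ ranges over all quadruples of scalars in $\mathbb K$ with $\xi,\xi^*$ nonzero. (i) Assume $\varphi_1=\varphi_d=-\phi_1=-\phi_d$. Then $A,A^*$ is isomorphic to $P(\xi,\zeta,\xi^*,\zeta^* )$ if and only if $(\xi,\zeta,\xi^*,\zeta^* )$ is one of $(1,0,1,0)$, $(1,0,-1,\theta^*_0+\theta^*_d)$, $(-1,\theta_0+\theta_d,1,0)$, $(-1,\theta_0+\theta_d,-1,\theta^*_0+\theta^*_d)$. Moreover $A^*,A$ is isomorphic to $P(\xi,\zeta,\xi^*,\zeta^* )$ if and only if $(\xi,\zeta,\xi^*,\zeta^* )$ is one of $(\alpha,\theta^*_0-\alpha\theta_0,\alpha^{-1},\theta_0-\alpha^{-1}\theta^*_0)$, $(-\alpha,\theta^*_d+\alpha\theta_0,\alpha^{-1},\theta_0-\alpha^{-1}\theta^*_0)$,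 $(\alpha,\theta^*_0-\alpha\theta_0,-\alpha^{-1},\theta_0+\alpha^{-1}\theta^*_d)$, $(-\alpha,\theta^*_d+\alpha\theta_0,-\alpha^{-1},\theta_0+\alpha^{-1}\theta^*_d)$. (ii) Assume $\varphi_1=\varphi_d$, $\phi_1=\phi_d$ and $\varphi_1\neq-\phi_1$. Then $A,A^*$ is isomorphic to $P(\xi,\zeta,\xi^*,\zeta^* )$ if and only if $(\xi,\zeta,\xi^*,\zeta^* )$ is one of $(1,0,1,0)$, $(-1,\theta_0+\theta_d,-1,\theta^*_0+\theta^*_d)$. Moreover $A^*,A$ is isomorphic to $P(\xi,\zeta,\xi^*,\zeta^* )$ if and only if $(\xi,\zeta,\xi^*,\zeta^* )$ is one of $(\alpha,\theta^*_0-\alpha\theta_0,\alpha^{-1},\theta_0-\alpha^{-1}\theta^*_0)$, $(-\alpha,\theta^*_d+\alpha\theta_0,-\alpha^{-1},\theta_0+\alpha^{-1}\theta^*_d)$. (iii) Assume $\varphi_1=\varphi_d$ and $\phi_1\neq\phi_d$. Then $A,A^*$ is isomorphic to $P(\xi,\zeta,\xi^*,\zeta^* )$ if and only if $(\xi,\zeta,\xi^*,\zeta^* )=(1,0,1,0)$. Moreover $A^*,A$ is isomorphic to $P(\xi,\zeta,\xi^*,\zeta^* )$ if and only if $(\xi,\zeta,\xi^*,\zeta^* )=(-\alpha,\theta^*_d+\alpha\theta_0,-\alpha^{-1},\theta_0+\alpha^{-1}\theta^*_d)$. (iv) Assume $\phi_1=\phi_d$ and $\varphi_1\neq\varphi_d$.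 Then $A,A^*$ is isomorphic to $P(\xi,\zeta,\xi^*,\zeta^* )$ if and only if $(\xi,\zeta,\xi^*,\zeta^* )=(1,0,1,0)$. Moreover $A^*,A$ is isomorphic to $P(\xi,\zeta,\xi^*,\zeta^* )$ if and only if $(\xi,\zeta,\xi^*,\zeta^* )=(\alpha,\theta^*_0-\alpha\theta_0,\alpha^{-1},\theta_0-\alpha^{-1}\theta^*_0)$. (v) Assume $\varphi_1=-\phi_1$, $\varphi_d=-\phi_d$ and $\varphi_1\neq\varphi_d$. Then $A,A^*$ is isomorphic to $P(\xi,\zeta,\xi^*,\zeta^* )$ if and only if $(\xi,\zeta,\xi^*,\zeta^* )$ is one of $(1,0,1,0)$, $(-1,\theta_0+\theta_d,1,0)$. Moreover $A^*,A$ is not isomorphic to $P(\xi,\zeta,\xi^*,\zeta^* )$ for any $\xi,\zeta,\xi^*,\zeta^*$. (vi) Assume $\varphi_1=-\phi_d$, $\varphi_d=-\phi_1$ and $\varphi_1\neq\varphi_d$. Then $A,A^*$ is isomorphic to $P(\xi,\zeta,\xi^*,\zeta^* )$ if and only if $(\xi,\zeta,\xi^*,\zeta^* )$ is one of $(1,0,1,0)$, $(1,0,-1,\theta^*_0+\theta^*_d)$. Moreover $A^*,A$ is not isomorphic to $P(\xi,\zeta,\xi^*,\zeta^* )$ for any $\xi,\zeta,\xi^*,\zeta^*$. (vii) Assume that none of the assumptions of (i)--(vi) holds. Then $A,A^*$ is isomorphic to $P(\xi,\zeta,\xi^*,\zeta^* )$ if and only if $(\xi,\zeta,\xi^*,\zeta^*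 )=(1,0,1,0)$. Moreover $A^*,A$ is not isomorphic to $P(\xi,\zeta,\xi^*,\zeta^* )$ for any $\xi,\zeta,\xi^*,\zeta^*$.
   Context: Let $\mathbb K$ be a field, $d\ge 0$ an integer, $\mathcal A$ a $\mathbb K$-algebra isomorphic to $\mathrm{Mat}_{d+1}(\mathbb K)$ with identity $I$, and $V$ an irreducible left $\mathcal A$-module (so $\dim V=d+1$). A square matrix is irreducible tridiagonal if its nonzero entries all lie on the diagonal, subdiagonal or superdiagonal, and every subdiagonal and superdiagonal entry is nonzero. Leonard pair: an ordered pair $A,A^*$ of elements of $\mathcal A$ is a Leonard pair in $\mathcal A$ if (i) there is a basis of $V$ with respect to which the matrix representing $A$ is irreducible tridiagonal and the matrix representing $A^*$ is diagonal, and (ii) there is a basis of $V$ with respect to which the matrix representing $A^*$ is irreducible tridiagonal and the matrix representing $A$ is diagonal. ($A^*$ is just a name; it does not denote the conjugate transpose.) If $A,A^*$ is a Leonard pair in $\mathcal A$, then so are $A^*,A$ and $\xi A+\zeta I,\ \xi^*A^*+\zeta^*I$ for all $\xi,\zeta,\xi^*,\zeta^*\in\mathbb K$ with $\xi,\xi^*$ nonzero. Leonard pairs $A,A^*$ in $\mathcal A$ and $B,B^*$ in $\mathcal A'$ are isomorphic if there is a $\mathbb K$-algebra isomorphism $\mathcal A\to\mathcal A'$ sending $A\mapsto B$ and $A^*\mapsto B^*$. Leonard system: an element $A\in\mathcal A$ is multiplicity-free if it has $d+1$ mutually distinct eigenvalues $\theta_0,\dots,\theta_d$ in $\mathbb K$;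 its primitive idempotent associated with $\theta_i$ is $E_i=\prod_{j\neq i}(A-\theta_jI)/(\theta_i-\theta_j)$. A Leonard system in $\mathcal A$ is a sequence $\Phi=(A;\{E_i\}_{i=0}^d;A^*;\{E^*_i\}_{i=0}^d)$ such that $A,A^*\in\mathcal A$ are multiplicity-free, $\{E_i\}_{i=0}^d$ (resp. $\{E_i^*\}_{i=0}^d$) is an ordering of the primitive idempotents of $A$ (resp. $A^*$), and for $0\le i,j\le d$ each of $E_iA^*E_j$ and $E^*_iAE^*_j$ is zero if $|i-j|>1$ and nonzero if $|i-j|=1$. If $\Phi$ is a Leonard system then $A,A^*$ is a Leonard pair, and $\Phi$ is said to be associated with $A,A^*$; every Leonard pair has an associated Leonard system. Parameter array: let $\theta_i$ (resp. $\theta_i^*$) be the eigenvalue of $A$ (resp. $A^*$) associated with $E_i$ (resp. $E^*_i$). For $1\le i\le d$ put $$\varphi_i=(\theta^*_0-\theta^*_i)\frac{\mathrm{tr}\bigl(E^*_0\prod_{h=0}^{i-1}(A-\theta_hI)\bigr)}{\mathrm{tr}\bigl(E^*_0\prod_{h=0}^{i-2}(A-\theta_hI)\bigr)},\qquad \phi_i=(\theta^*_0-\theta^*_i)\frac{\mathrm{tr}\bigl(E^*_0\prod_{h=0}^{i-1}(A-\theta_{d-h}I)\bigr)}{\mathrm{tr}\bigl(E^*_0\prod_{h=0}^{i-2}(A-\theta_{d-h}I)\bigr)},$$ where the empty product is $I$ and the denominators are known to be nonzero. The parameter array of $\Phi$ is $(\{\theta_i\}_{i=0}^d;\{\theta^*_i\}_{i=0}^d;\{\varphi_i\}_{i=1}^d;\{\phi_i\}_{i=1}^d)$.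 *)

theory Defs
  imports "Jordan_Normal_Form.Matrix"
begin

section \<open>Matrix algebras and their irreducible modules\<close>

locale k_algebra = vector_space scale
  for scale :: "'k::field \<Rightarrow> 'a::ring_1 \<Rightarrow> 'a" +
  assumes scale_mult_left: "scale c x * y = scale c (x * y)"
    and scale_mult_right: "x * scale c y = scale c (x * y)"

definition k_algebra_iso ::
  "('k::field \<Rightarrow> 'a::ring_1 \<Rightarrow> 'a) \<Rightarrow> ('k \<Rightarrow> 'b::ring_1 \<Rightarrow> 'b) \<Rightarrow> ('a \<Rightarrow> 'b) \<Rightarrow> bool" where
  "k_algebra_iso sA sB \<sigma> \<longleftrightarrow>
     k_algebra sA \<and> k_algebra sB \<and> bij \<sigma> \<and> Vector_Spaces.linear sA sB \<sigma> \<and>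
     \<sigma> 1 = 1 \<and> (\<forall>x y. \<sigma> (x * y) = \<sigma> x * \<sigma> y)"

text \<open>The algebra is isomorphic to the algebra of square matrices of order \<open>d + 1\<close>.  Since \<open>'k mat\<close>
  contains matrices of all shapes, the isomorphism is onto a carrier set.\<close>

definition matrix_algebra :: "nat \<Rightarrow> ('k::field \<Rightarrow> 'a::ring_1 \<Rightarrow> 'a) \<Rightarrow> bool" where
  "matrix_algebra d sA \<longleftrightarrow> k_algebra sA \<and>
     (\<exists>\<psi>. bij_betw \<psi> UNIV (carrier_mat (Suc d) (Suc d)) \<and>
        \<psi> 1 = 1\<^sub>m (Suc d) \<and>
        (\<forall>x y. \<psi> (x + y) = \<psi> x + \<psi> y) \<and>
        (\<forall>x y. \<psi> (x * y) = \<psi> x * \<psi> y) \<and>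
        (\<forall>c x. \<psi> (sA c x) = c \<cdot>\<^sub>m \<psi> x))"

locale algebra_module = alg: k_algebra sA + vs: vector_space sV
  for sA :: "'k::field \<Rightarrow> 'a::ring_1 \<Rightarrow> 'a"
    and sV :: "'k \<Rightarrow> 'v::ab_group_add \<Rightarrow> 'v" +
  fixes act :: "'a \<Rightarrow> 'v \<Rightarrow> 'v"
  assumes act_one: "act 1 v = v"
    and act_mult: "act (x * y) v = act x (act y v)"
    and act_add_left: "act (x + y) v = act x v + act y v"
    and act_add_right: "act x (v + w) = act x v + act x w"
    and act_scale: "act (sA c x) v = sV c (act x v)"

definition irreducible_module ::
  "('k::field \<Rightarrow> 'a::ring_1 \<Rightarrow> 'a) \<Rightarrow> ('k \<Rightarrow> 'v::ab_group_add \<Rightarrow> 'v) \<Rightarrow> ('a \<Rightarrow> 'v \<Rightarrow> 'v) \<Rightarrow> bool" where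
  "irreducible_module sA sV act \<longleftrightarrow> algebra_module sA sV act \<and>
     (\<exists>v::'v. v \<noteq> 0) \<and>
     (\<forall>W. module.subspace sV W \<and> (\<forall>x. \<forall>w\<in>W. act x w \<in> W) \<longrightarrow> W = {0} \<or> W = UNIV)"


section \<open>Leonard pairs\<close>

definition irred_tridiagonal_mat :: "'k::zero mat \<Rightarrow> bool" where
  "irred_tridiagonal_mat B \<longleftrightarrow> square_mat B \<and>
     (\<forall>i < dim_row B. \<forall>j < dim_row B.
        (\<bar>int i - int j\<bar> > 1 \<longrightarrow> B $$ (i, j) = 0) \<and>
        (\<bar>int i - int j\<bar> = 1 \<longrightarrow> B $$ (i, j) \<noteq> 0))"

text \<open>Only the values \<open>v 0, \<dots>, v d\<close> of the family matter; the same applies to all sequences below.\<close>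

definition is_ordered_basis ::
  "('k::field \<Rightarrow> 'v::ab_group_add \<Rightarrow> 'v) \<Rightarrow> nat \<Rightarrow> (nat \<Rightarrow> 'v) \<Rightarrow> bool" where
  "is_ordered_basis sV d v \<longleftrightarrow>
     inj_on v {..d} \<and> \<not> module.dependent sV (v ` {..d}) \<and> module.span sV (v ` {..d}) = UNIV"

text \<open>Column \<open>j\<close> holds the coordinates of \<open>X . v j\<close>.\<close>

definition matrix_rep ::
  "('k::field \<Rightarrow> 'v::ab_group_add \<Rightarrow> 'v) \<Rightarrow> ('a \<Rightarrow> 'v \<Rightarrow> 'v) \<Rightarrow> nat \<Rightarrow> (nat \<Rightarrow> 'v) \<Rightarrow> 'a \<Rightarrow> 'k mat" where
  "matrix_rep sV act d v X =
     mat (Suc d) (Suc d) (\<lambda>(i, j). module.representation sV (v ` {..d}) (act X (v j)) (v i))"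

definition leonard_pair ::
  "('k::field \<Rightarrow> 'v::ab_group_add \<Rightarrow> 'v) \<Rightarrow> ('a \<Rightarrow> 'v \<Rightarrow> 'v) \<Rightarrow> nat \<Rightarrow> 'a \<times> 'a \<Rightarrow> bool" where
  "leonard_pair sV act d = (\<lambda>(A, As).
     (\<exists>v. is_ordered_basis sV d v \<and>
        irred_tridiagonal_mat (matrix_rep sV act d v A) \<and>
        diagonal_mat (matrix_rep sV act d v As)) \<and>
     (\<exists>v. is_ordered_basis sV d v \<and>
        irred_tridiagonal_mat (matrix_rep sV act d v As) \<and>
        diagonal_mat (matrix_rep sV act d v A)))"

definition leonard_pair_isomorphic ::
  "('k::field \<Rightarrow> 'a::ring_1 \<Rightarrow> 'a) \<Rightarrow> 'a \<times> 'a \<Rightarrow> ('k \<Rightarrow> 'b::ring_1 \<Rightarrow> 'b) \<Rightarrow> 'b \<times> 'b \<Rightarrow> bool" where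
  "leonard_pair_isomorphic sA p sB q \<longleftrightarrow>
     (\<exists>\<sigma>. k_algebra_iso sA sB \<sigma> \<and> \<sigma> (fst p) = fst q \<and> \<sigma> (snd p) = snd q)"

definition affine_pair ::
  "('k::field \<Rightarrow> 'a::ring_1 \<Rightarrow> 'a) \<Rightarrow> 'a \<times> 'a \<Rightarrow> 'k \<times> 'k \<times> 'k \<times> 'k \<Rightarrow> 'a \<times> 'a" where
  "affine_pair sA = (\<lambda>(A, As) (\<xi>, \<zeta>, \<xi>s, \<zeta>s). (sA \<xi> A + sA \<zeta> 1, sA \<xi>s As + sA \<zeta>s 1))"

definition affine_params :: "('k::field \<times> 'k \<times> 'k \<times> 'k) set" where
  "affine_params = {(\<xi>, \<zeta>, \<xi>s, \<zeta>s). \<xi> \<noteq> 0 \<and> \<xi>s \<noteq> 0}"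


section \<open>Leonard systems and their parameter arrays\<close>

definition is_eigenvalue ::
  "('k::field \<Rightarrow> 'v::ab_group_add \<Rightarrow> 'v) \<Rightarrow> ('a \<Rightarrow> 'v \<Rightarrow> 'v) \<Rightarrow> 'a \<Rightarrow> 'k \<Rightarrow> bool" where
  "is_eigenvalue sV act X t \<longleftrightarrow> (\<exists>v. v \<noteq> 0 \<and> act X v = sV t v)"

definition multiplicity_free ::
  "('k::field \<Rightarrow> 'v::ab_group_add \<Rightarrow> 'v) \<Rightarrow> ('a \<Rightarrow> 'v \<Rightarrow> 'v) \<Rightarrow> nat \<Rightarrow> 'a \<Rightarrow> bool" where
  "multiplicity_free sV act d X \<longleftrightarrow> card {t. is_eigenvalue sV act X t} = d + 1"

definition eigenvalue_ordering ::
  "('k::field \<Rightarrow> 'v::ab_group_add \<Rightarrow> 'v) \<Rightarrow> ('a \<Rightarrow> 'v \<Rightarrow> 'v) \<Rightarrow> nat \<Rightarrow> 'a \<Rightarrow> (nat \<Rightarrow> 'k) \<Rightarrow> bool" where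
  "eigenvalue_ordering sV act d X \<theta> \<longleftrightarrow> bij_betw \<theta> {..d} {t. is_eigenvalue sV act X t}"

text \<open>The factors commute, so the order of the list products does not matter.\<close>

definition primitive_idempotent ::
  "('k::field \<Rightarrow> 'a::ring_1 \<Rightarrow> 'a) \<Rightarrow> nat \<Rightarrow> 'a \<Rightarrow> (nat \<Rightarrow> 'k) \<Rightarrow> nat \<Rightarrow> 'a" where
  "primitive_idempotent sA d X \<theta> i =
     (\<Prod>j \<leftarrow> filter (\<lambda>j. j \<noteq> i) [0..<Suc d]. sA (1 / (\<theta> i - \<theta> j)) (X - sA (\<theta> j) 1))"

text \<open>\<open>E i\<close> is the primitive idempotent of \<open>X\<close> associated with the eigenvalue \<open>\<theta> i\<close>, for \<open>i \<le> d\<close>.\<close>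

definition idempotents_for ::
  "('k::field \<Rightarrow> 'a::ring_1 \<Rightarrow> 'a) \<Rightarrow> ('k \<Rightarrow> 'v::ab_group_add \<Rightarrow> 'v) \<Rightarrow> ('a \<Rightarrow> 'v \<Rightarrow> 'v) \<Rightarrow>
     nat \<Rightarrow> 'a \<Rightarrow> (nat \<Rightarrow> 'a) \<Rightarrow> (nat \<Rightarrow> 'k) \<Rightarrow> bool" where
  "idempotents_for sA sV act d X E \<theta> \<longleftrightarrow>
     eigenvalue_ordering sV act d X \<theta> \<and> (\<forall>i\<le>d. E i = primitive_idempotent sA d X \<theta> i)"

definition leonard_system ::
  "('k::field \<Rightarrow> 'a::ring_1 \<Rightarrow> 'a) \<Rightarrow> ('k \<Rightarrow> 'v::ab_group_add \<Rightarrow> 'v) \<Rightarrow> ('a \<Rightarrow> 'v \<Rightarrow> 'v) \<Rightarrow>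
     nat \<Rightarrow> 'a \<times> (nat \<Rightarrow> 'a) \<times> 'a \<times> (nat \<Rightarrow> 'a) \<Rightarrow> bool" where
  "leonard_system sA sV act d = (\<lambda>(A, E, As, Es).
     multiplicity_free sV act d A \<and> multiplicity_free sV act d As \<and>
     (\<exists>\<theta>. idempotents_for sA sV act d A E \<theta>) \<and>
     (\<exists>\<theta>s. idempotents_for sA sV act d As Es \<theta>s) \<and>
     (\<forall>i\<le>d. \<forall>j\<le>d.
        (\<bar>int i - int j\<bar> > 1 \<longrightarrow> E i * As * E j = 0 \<and> Es i * A * Es j = 0) \<and>
        (\<bar>int i - int j\<bar> = 1 \<longrightarrow> E i * As * E j \<noteq> 0 \<and> Es i * A * Es j \<noteq> 0)))"

text \<open>The trace of an algebra element is the trace of any matrix representing it on the irreducible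
  module.\<close>

definition alg_trace ::
  "('k::field \<Rightarrow> 'v::ab_group_add \<Rightarrow> 'v) \<Rightarrow> ('a \<Rightarrow> 'v \<Rightarrow> 'v) \<Rightarrow> nat \<Rightarrow> 'a \<Rightarrow> 'k" where
  "alg_trace sV act d X =
     (\<Sum>i\<le>d. matrix_rep sV act d (SOME v. is_ordered_basis sV d v) X $$ (i, i))"

text \<open>\<open>split_product sA A \<theta> n\<close> is \<open>(A - \<theta> 0 I) \<dots> (A - \<theta> (n-1) I)\<close>.\<close>

definition split_product ::
  "('k::field \<Rightarrow> 'a::ring_1 \<Rightarrow> 'a) \<Rightarrow> 'a \<Rightarrow> (nat \<Rightarrow> 'k) \<Rightarrow> nat \<Rightarrow> 'a" where
  "split_product sA A \<theta> n = (\<Prod>h \<leftarrow> [0..<n]. A - sA (\<theta> h) 1)"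

definition parameter_array ::
  "('k::field \<Rightarrow> 'a::ring_1 \<Rightarrow> 'a) \<Rightarrow> ('k \<Rightarrow> 'v::ab_group_add \<Rightarrow> 'v) \<Rightarrow> ('a \<Rightarrow> 'v \<Rightarrow> 'v) \<Rightarrow>
     nat \<Rightarrow> 'a \<times> (nat \<Rightarrow> 'a) \<times> 'a \<times> (nat \<Rightarrow> 'a) \<Rightarrow>
     (nat \<Rightarrow> 'k) \<times> (nat \<Rightarrow> 'k) \<times> (nat \<Rightarrow> 'k) \<times> (nat \<Rightarrow> 'k) \<Rightarrow> bool" where
  "parameter_array sA sV act d = (\<lambda>(A, E, As, Es) (\<theta>, \<theta>s, varphi, phi).
     idempotents_for sA sV act d A E \<theta> \<and>
     idempotents_for sA sV act d As Es \<theta>s \<and>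
     (\<forall>i\<in>{1..d}.
        varphi i = (\<theta>s 0 - \<theta>s i) *
          (alg_trace sV act d (Es 0 * split_product sA A \<theta> i) /
           alg_trace sV act d (Es 0 * split_product sA A \<theta> (i - 1))) \<and>
        phi i = (\<theta>s 0 - \<theta>s i) *
          (alg_trace sV act d (Es 0 * split_product sA A (\<lambda>h. \<theta> (d - h)) i) /
           alg_trace sV act d (Es 0 * split_product sA A (\<lambda>h. \<theta> (d - h)) (i - 1)))))"

end

theory Submission
  imports Defs
begin

text \<open>
  The theorem says when two Leonard pairs that arise from one another by simple operations are
  isomorphic, so the proof rests on a complete invariant. Let \<open>e\<close> and \<open>f\<close> be eigenbases of \<open>A\<close> and
  \<open>As\<close>, ordered as in the Leonard system, and let \<open>s i\<close> be the \<open>i\<close>-th diagonal entry of \<open>As\<close> in the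
  basis \<open>e\<close>, so that \<open>E i * As * E i\<close> is \<open>s i\<close> times \<open>E i\<close>. The two eigenvalue sequences and the
  single scalar \<open>s d\<close> determine the pair: in the split basis
  \<open>(A - \<theta> (i - 1)) \<dots> (A - \<theta> 0) (f 0)\<close> the element \<open>A\<close> is lower bidiagonal and \<open>As\<close> is upper
  bidiagonal (\<open>Y_split\<close>), and the superdiagonal entries of \<open>As\<close> can be read off from the last
  \<open>e\<close>-coordinate, which brings in only \<open>\<theta>\<close>, \<open>\<theta>s\<close> and \<open>s d\<close>. In the other direction an isomorphism
  carries primitive idempotents to primitive idempotents and keeps the tridiagonal shape, so it
  permutes the path \<open>0, \<dots>, d\<close> by the identity or by the reversal. Hence two pairs are isomorphic
  iff their invariants agree up to reversing either ordering (\<open>isomorphic_iff\<close>).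

  For an affine image of \<open>(A, As)\<close>, compared with \<open>(A, As)\<close> or with \<open>(As, A)\<close>, this leaves four
  choices of reversals. Each of them fixes the quadruple of scalars through the indices \<open>0\<close> and
  \<open>d\<close>, and what remains is to decide when the eigenvalue sequences match at all indices. Two
  facts settle this.

  The first is that both eigenvalue sequences satisfy the recurrence
  \<open>x (i + 1) - x (i + 2) = a * (x i - x (i + 3))\<close> with the same nonzero \<open>a\<close> (\<open>recurrences\<close>), and a
  solution that vanishes at \<open>0\<close>, \<open>1\<close> and \<open>d\<close> is zero as soon as some solution takes distinct
  values (\<open>recurrent_unique\<close>). So a symmetry \<open>\<theta> i + \<theta> (d - i) = \<theta> 0 + \<theta> d\<close> or an affine relation
  between \<open>\<theta>\<close> and \<open>\<theta>s\<close> needs to be checked only next to the ends.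

  The second is that the first and last entries of the parameter array are products such as
  \<open>(\<theta> 0 - \<theta> 1) * (s 0 - \<theta>s 0)\<close>, and that each of them has a second expression with the roles of
  \<open>A\<close> and \<open>As\<close> exchanged. This is one identity (\<open>corner_identity\<close>) applied to the four reversals.
  Comparing the two expressions turns equalities between the end entries into precisely the
  conditions next to the ends that the recurrence requires.
\<close>

section \<open>Coordinates with respect to an ordered basis\<close>

definition coord ::
  "('k::field \<Rightarrow> 'v::ab_group_add \<Rightarrow> 'v) \<Rightarrow> nat \<Rightarrow> (nat \<Rightarrow> 'v) \<Rightarrow> nat \<Rightarrow> 'v \<Rightarrow> 'k" where
  "coord sV d v i w = module.representation sV (v ` {..d}) w (v i)"

context vector_space
begin

lemma coord_add:
  assumes "is_ordered_basis scale d v"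
  shows "coord scale d v i (x + y) = coord scale d v i x + coord scale d v i y"
  using assms unfolding is_ordered_basis_def coord_def by (simp add: representation_add)

lemma coord_scale:
  assumes "is_ordered_basis scale d v"
  shows "coord scale d v i (c *s x) = c * coord scale d v i x"
  using assms unfolding is_ordered_basis_def coord_def by (simp add: representation_scale)

lemma coord_zero: "coord scale d v i 0 = 0"
  unfolding coord_def by (simp add: representation_zero)

lemma coord_diff:
  assumes "is_ordered_basis scale d v"
  shows "coord scale d v i (x - y) = coord scale d v i x - coord scale d v i y"
  using assms unfolding is_ordered_basis_def coord_def by (simp add: representation_diff)

lemma coord_sum:
  assumes "is_ordered_basis scale d v"
  shows "coord scale d v i (\<Sum>a\<in>S. g a) = (\<Sum>a\<in>S. coord scale d v i (g a))"
  using coord_add[OF assms] by (induction S rule: infinite_finite_induct) (auto simp: coord_zero)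

lemma coord_basis:
  assumes "is_ordered_basis scale d v" "i \<le> d" "j \<le> d"
  shows "coord scale d v i (v j) = (if i = j then 1 else 0)"
  using assms unfolding is_ordered_basis_def coord_def
  by (subst representation_basis) (auto dest: inj_onD)

lemma coord_expand:
  assumes "is_ordered_basis scale d v"
  shows "w = (\<Sum>i\<le>d. coord scale d v i w *s v i)"
proof -
  have ind: "independent (v ` {..d})" and sp: "w \<in> span (v ` {..d})" and inj: "inj_on v {..d}"
    using assms unfolding is_ordered_basis_def by auto
  have "w = (\<Sum>b\<in>v ` {..d}. representation (v ` {..d}) w b *s b)"
    using sum_representation_eq[OF ind sp] by auto
  also have "\<dots> = (\<Sum>i\<le>d. coord scale d v i w *s v i)"
    unfolding coord_def by (subst sum.reindex[OF inj]) simp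
  finally show ?thesis .
qed

lemma coord_eqI:
  assumes "is_ordered_basis scale d v" "\<And>i. i \<le> d \<Longrightarrow> coord scale d v i x = coord scale d v i y"
  shows "x = y"
  by (subst (1 2) coord_expand[OF assms(1)]) (simp add: assms(2))

lemma independent_family:
  assumes ind: "\<And>c. (\<Sum>i\<le>d. c i *s v i) = 0 \<Longrightarrow> \<forall>i\<le>d::nat. c i = 0"
  shows "inj_on v {..d}" "independent (v ` {..d})"
proof -
  show inj: "inj_on v {..d}"
  proof (rule inj_onI, rule ccontr)
    fix i j assume ij: "i \<in> {..d}" "j \<in> {..d}" "v i = v j" "i \<noteq> j"
    define c where "c k = (if k = i then 1 else if k = j then -1 else (0::'a))" for k
    have "(\<Sum>k\<le>d. c k *s v k) = (\<Sum>k\<in>{i,j}. c k *s v k)"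
      by (rule sum.mono_neutral_right) (use ij in \<open>auto simp: c_def\<close>)
    also have "\<dots> = 0" using ij by (simp add: c_def)
    finally have "c i = 0" using ind ij by blast
    thus False by (simp add: c_def)
  qed
  show "independent (v ` {..d})"
  proof
    assume "dependent (v ` {..d})"
    then obtain u where u: "\<exists>w\<in>v ` {..d}. u w \<noteq> 0" "(\<Sum>w\<in>v ` {..d}. u w *s w) = 0"
      using dependent_finite[of "v ` {..d}"] by auto
    have "(\<Sum>i\<le>d. u (v i) *s v i) = 0"
      using u(2) by (simp add: sum.reindex[OF inj])
    from ind[OF this] u(1) show False by auto
  qed
qed

text \<open>The reference basis \<open>b\<close> supplies the dimension: \<open>d + 1\<close> independent vectors then span, since a
  vector outside their span would extend them to an independent family that is too large.\<close>

lemma ordered_basisI: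
  assumes b: "is_ordered_basis scale d b"
    and ind: "\<And>c. (\<Sum>i\<le>d. c i *s v i) = 0 \<Longrightarrow> \<forall>i\<le>d. c i = 0"
  shows "is_ordered_basis scale d v"
proof -
  note inj = independent_family(1)[OF ind] and indep = independent_family(2)[OF ind]
  have "w \<in> span (v ` {..d})" for w
  proof (rule ccontr)
    assume w: "w \<notin> span (v ` {..d})"
    hence "independent (insert w (v ` {..d}))" using indep by (simp add: independent_insert)
    moreover have "insert w (v ` {..d}) \<subseteq> span (b ` {..d})"
      using b unfolding is_ordered_basis_def by auto
    ultimately have "card (insert w (v ` {..d})) \<le> card (b ` {..d})"
      using independent_span_bound by blast
    moreover have "card (insert w (v ` {..d})) = Suc (card (v ` {..d}))"
      using w span_base by (intro card_insert_disjoint) auto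
    moreover have "card (v ` {..d}) = card (b ` {..d})"
      using inj b unfolding is_ordered_basis_def by (simp add: card_image)
    ultimately show False by simp
  qed
  hence "span (v ` {..d}) = UNIV" by auto
  thus ?thesis using inj indep unfolding is_ordered_basis_def by auto
qed

lemma linear_eq_on_ordered_basis:
  assumes "Vector_Spaces.linear scale scale F" "Vector_Spaces.linear scale scale G"
    "is_ordered_basis scale d v" "\<And>i. i \<le> d \<Longrightarrow> F (v i) = G (v i)"
  shows "F = G"
proof
  fix w
  interpret F: Vector_Spaces.linear scale scale F by fact
  interpret G: Vector_Spaces.linear scale scale G by fact
  show "F w = G w"
    by (subst (1 2) coord_expand[OF assms(3)]) (simp add: F.sum F.scale G.sum G.scale assms(4))
qed

lemma linear_extend:
  assumes "is_ordered_basis scale d v"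
  obtains G where "Vector_Spaces.linear scale scale G" "\<And>i. i \<le> d \<Longrightarrow> G (v i) = w i"
proof
  let ?G = "\<lambda>x. \<Sum>i\<le>d. coord scale d v i x *s w i"
  show "Vector_Spaces.linear scale scale ?G"
    unfolding Vector_Spaces.linear_iff
    by (auto simp: vector_space_axioms coord_add[OF assms] coord_scale[OF assms]
        scale_left_distrib sum.distrib scale_sum_right)
  fix j assume j: "j \<le> d"
  have "?G (v j) = (\<Sum>i\<le>d. if i = j then w j else 0)"
    by (rule sum.cong) (auto simp: coord_basis[OF assms] j)
  thus "?G (v j) = w j" using j by simp
qed

lemma image_rev_atMost: "(\<lambda>j. v (d - j)) ` {..d} = v ` {..d::nat}"
proof -
  have "(\<lambda>j. d - j) ` {..d} = {..d}"
    by (auto simp: image_iff) (metis atMost_iff diff_diff_cancel diff_le_self)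
  thus ?thesis by (metis image_image)
qed

lemma coord_rev:
  "coord scale d (\<lambda>j. v (d - j)) i w = coord scale d v (d - i) w"
  unfolding coord_def image_rev_atMost by simp

lemma ordered_basis_rev:
  assumes "is_ordered_basis scale d v"
  shows "is_ordered_basis scale d (\<lambda>j. v (d - j))"
proof -
  have "inj_on (\<lambda>j. v (d - j)) {..d}"
    using assms unfolding is_ordered_basis_def inj_on_def
    by (metis atMost_iff diff_diff_cancel diff_le_self)
  thus ?thesis using assms unfolding is_ordered_basis_def image_rev_atMost by auto
qed

end

section \<open>Leonard systems as pairs of operators with eigenbases\<close>

definition irred_tridiagonal :: "nat \<Rightarrow> (nat \<Rightarrow> nat \<Rightarrow> 'k::zero) \<Rightarrow> bool" where
  "irred_tridiagonal d B \<longleftrightarrow> (\<forall>i\<le>d. \<forall>j\<le>d.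
     (\<bar>int i - int j\<bar> > 1 \<longrightarrow> B i j = 0) \<and> (\<bar>int i - int j\<bar> = 1 \<longrightarrow> B i j \<noteq> 0))"

lemma irred_tridiagonal_zero:
  "irred_tridiagonal d B \<Longrightarrow> i \<le> d \<Longrightarrow> j \<le> d \<Longrightarrow> Suc i < j \<or> Suc j < i \<Longrightarrow> B i j = 0"
  unfolding irred_tridiagonal_def by (elim allE[of _ i] impE allE[of _ j]) auto

lemma irred_tridiagonal_nonzero:
  "irred_tridiagonal d B \<Longrightarrow> i \<le> d \<Longrightarrow> j \<le> d \<Longrightarrow> j = Suc i \<or> i = Suc j \<Longrightarrow> B i j \<noteq> 0"
  unfolding irred_tridiagonal_def by (elim allE[of _ i] impE allE[of _ j]) auto

lemma irred_tridiagonal_rev: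
  assumes "irred_tridiagonal d B"
  shows "irred_tridiagonal d (\<lambda>i j. B (d - i) (d - j))"
  unfolding irred_tridiagonal_def
proof (intro allI impI)
  fix i j assume ij: "i \<le> d" "j \<le> d"
  hence "\<bar>int (d - i) - int (d - j)\<bar> = \<bar>int i - int j\<bar>" by (simp add: of_nat_diff)
  thus "(\<bar>int i - int j\<bar> > 1 \<longrightarrow> B (d - i) (d - j) = 0) \<and>
        (\<bar>int i - int j\<bar> = 1 \<longrightarrow> B (d - i) (d - j) \<noteq> 0)"
    using assms unfolding irred_tridiagonal_def by (metis diff_le_self)
qed

text \<open>A Leonard system with the idempotents replaced by eigenvectors. The two operators play symmetric
  roles, and reversing either basis gives a frame again; these relatives turn every statement about
  one corner of the pair into four.\<close>

locale leonard_frame = vector_space scale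
  for scale :: "'k::field \<Rightarrow> 'v::ab_group_add \<Rightarrow> 'v" (infixr "*s" 75) +
  fixes d :: nat and X Y :: "'v \<Rightarrow> 'v" and e f :: "nat \<Rightarrow> 'v" and \<theta> \<theta>s :: "nat \<Rightarrow> 'k"
  assumes d_pos: "d \<ge> 1"
    and linX: "Vector_Spaces.linear scale scale X"
    and linY: "Vector_Spaces.linear scale scale Y"
    and be: "is_ordered_basis scale d e"
    and bf: "is_ordered_basis scale d f"
    and X_e: "i \<le> d \<Longrightarrow> X (e i) = \<theta> i *s e i"
    and Y_f: "i \<le> d \<Longrightarrow> Y (f i) = \<theta>s i *s f i"
    and inj_\<theta>: "inj_on \<theta> {..d}"
    and inj_\<theta>s: "inj_on \<theta>s {..d}"
    and tri_e: "irred_tridiagonal d (\<lambda>i j. coord scale d e i (Y (e j)))"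
    and tri_f: "irred_tridiagonal d (\<lambda>i j. coord scale d f i (X (f j)))"
begin

abbreviation "ce \<equiv> coord scale d e"
abbreviation "cf \<equiv> coord scale d f"
abbreviation "B i j \<equiv> ce i (Y (e j))"
abbreviation "C i j \<equiv> cf i (X (f j))"

lemmas ce_simps = coord_add[OF be] coord_scale[OF be] coord_diff[OF be] coord_zero
lemmas cf_simps = coord_add[OF bf] coord_scale[OF bf] coord_diff[OF bf] coord_zero
lemmas B_zero = irred_tridiagonal_zero[OF tri_e]
lemmas B_nonzero = irred_tridiagonal_nonzero[OF tri_e]
lemmas C_zero = irred_tridiagonal_zero[OF tri_f]
lemmas C_nonzero = irred_tridiagonal_nonzero[OF tri_f]

lemma \<theta>_neq: "i \<le> d \<Longrightarrow> j \<le> d \<Longrightarrow> i \<noteq> j \<Longrightarrow> \<theta> i \<noteq> \<theta> j"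
  using inj_\<theta> by (auto dest: inj_onD)

lemma \<theta>s_neq: "i \<le> d \<Longrightarrow> j \<le> d \<Longrightarrow> i \<noteq> j \<Longrightarrow> \<theta>s i \<noteq> \<theta>s j"
  using inj_\<theta>s by (auto dest: inj_onD)

lemma coord_linear:
  assumes "Vector_Spaces.linear scale scale F" "is_ordered_basis scale d b"
  shows "coord scale d b i (F v) = (\<Sum>j\<le>d. coord scale d b i (F (b j)) * coord scale d b j v)"
proof -
  interpret F: Vector_Spaces.linear scale scale F by fact
  have "F v = (\<Sum>j\<le>d. coord scale d b j v *s F (b j))"
    by (subst coord_expand[OF assms(2), of v]) (simp add: F.sum F.scale)
  thus ?thesis by (simp add: coord_sum[OF assms(2)] coord_scale[OF assms(2)] mult.commute)
qed

lemma ce_Y: "ce i (Y v) = (\<Sum>j\<le>d. B i j * ce j v)"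
  by (rule coord_linear[OF linY be])

lemma cf_X: "cf i (X v) = (\<Sum>j\<le>d. C i j * cf j v)"
  by (rule coord_linear[OF linX bf])

lemma ce_X: "i \<le> d \<Longrightarrow> ce i (X v) = \<theta> i * ce i v"
proof -
  assume i: "i \<le> d"
  have "ce i (X v) = (\<Sum>j\<le>d. if j = i then \<theta> i * ce i v else 0)"
    unfolding coord_linear[OF linX be, of i v]
    by (rule sum.cong) (auto simp: X_e ce_simps coord_basis[OF be] i)
  thus ?thesis using i by simp
qed

lemma cf_Y: "i \<le> d \<Longrightarrow> cf i (Y v) = \<theta>s i * cf i v"
proof -
  assume i: "i \<le> d"
  have "cf i (Y v) = (\<Sum>j\<le>d. if j = i then \<theta>s i * cf i v else 0)"
    unfolding coord_linear[OF linY bf, of i v]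
    by (rule sum.cong) (auto simp: Y_f cf_simps coord_basis[OF bf] i)
  thus ?thesis using i by simp
qed

lemma swap: "leonard_frame scale d Y X f e \<theta>s \<theta>"
  by (intro leonard_frame.intro leonard_frame_axioms.intro vector_space_axioms)
     (rule d_pos linX linY be bf X_e Y_f inj_\<theta> inj_\<theta>s tri_e tri_f | assumption)+

lemma rev_fst: "leonard_frame scale d X Y (\<lambda>i. e (d - i)) f (\<lambda>i. \<theta> (d - i)) \<theta>s"
proof (intro leonard_frame.intro leonard_frame_axioms.intro vector_space_axioms)
  show "inj_on (\<lambda>i. \<theta> (d - i)) {..d}" using inj_\<theta> unfolding inj_on_def
    by (metis atMost_iff diff_diff_cancel diff_le_self)
  show "irred_tridiagonal d (\<lambda>i j. coord scale d (\<lambda>i. e (d - i)) i (Y (e (d - j))))"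
    unfolding coord_rev by (rule irred_tridiagonal_rev[OF tri_e])
  show "is_ordered_basis scale d (\<lambda>i. e (d - i))" by (rule ordered_basis_rev[OF be])
  show "X (e (d - i)) = \<theta> (d - i) *s e (d - i)" for i by (rule X_e) simp
qed (rule d_pos linX linY bf Y_f inj_\<theta>s tri_f | assumption)+

lemma rev_snd: "leonard_frame scale d X Y e (\<lambda>i. f (d - i)) \<theta> (\<lambda>i. \<theta>s (d - i))"
proof -
  interpret S: leonard_frame scale d Y X f e \<theta>s \<theta> by (rule swap)
  interpret T: leonard_frame scale d Y X "\<lambda>i. f (d - i)" e "\<lambda>i. \<theta>s (d - i)" \<theta> by (rule S.rev_fst)
  show ?thesis by (rule T.swap)
qed

text \<open>Affine maps with nonzero leading coefficient keep the eigenbases, so the invariants of an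
  affine image are the affine images of the invariants.\<close>

lemma affine_fst:
  assumes "\<xi> \<noteq> 0"
  shows "leonard_frame scale d (\<lambda>v. \<xi> *s X v + \<zeta> *s v) Y e f (\<lambda>i. \<xi> * \<theta> i + \<zeta>) \<theta>s"
proof (intro leonard_frame.intro leonard_frame_axioms.intro vector_space_axioms)
  interpret X: Vector_Spaces.linear scale scale X by (rule linX)
  show "Vector_Spaces.linear scale scale (\<lambda>v. \<xi> *s X v + \<zeta> *s v)"
    unfolding Vector_Spaces.linear_iff
    by (intro conjI allI vector_space_axioms)
      (simp_all only: X.add X.scale scale_right_distrib scale_left_commute[of \<xi>] scale_left_commute[of \<zeta>] add_ac)
  show "i \<le> d \<Longrightarrow> \<xi> *s X (e i) + \<zeta> *s e i = (\<xi> * \<theta> i + \<zeta>) *s e i" for i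
    by (simp add: X_e scale_left_distrib)
  show "inj_on (\<lambda>i. \<xi> * \<theta> i + \<zeta>) {..d}" using inj_\<theta> assms by (auto simp: inj_on_def)
  show "irred_tridiagonal d (\<lambda>i j. cf i (\<xi> *s X (f j) + \<zeta> *s f j))"
    unfolding irred_tridiagonal_def
  proof (intro allI impI)
    fix i j assume ij: "i \<le> d" "j \<le> d"
    have "cf i (\<xi> *s X (f j) + \<zeta> *s f j) = \<xi> * C i j + \<zeta> * (if i = j then 1 else 0)"
      using ij by (simp add: cf_simps coord_basis[OF bf])
    thus "(\<bar>int i - int j\<bar> > 1 \<longrightarrow> cf i (\<xi> *s X (f j) + \<zeta> *s f j) = 0) \<and>
      (\<bar>int i - int j\<bar> = 1 \<longrightarrow> cf i (\<xi> *s X (f j) + \<zeta> *s f j) \<noteq> 0)"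
      using tri_f assms ij unfolding irred_tridiagonal_def by (cases "i = j") simp_all
  qed
qed (rule d_pos linX linY be bf Y_f inj_\<theta>s tri_e | assumption)+

lemma affine_snd:
  assumes "\<xi> \<noteq> 0"
  shows "leonard_frame scale d X (\<lambda>v. \<xi> *s Y v + \<zeta> *s v) e f \<theta> (\<lambda>i. \<xi> * \<theta>s i + \<zeta>)"
proof -
  interpret S: leonard_frame scale d Y X f e \<theta>s \<theta> by (rule swap)
  interpret T: leonard_frame scale d "\<lambda>v. \<xi> *s Y v + \<zeta> *s v" X f e "\<lambda>i. \<xi> * \<theta>s i + \<zeta>" \<theta>
    by (rule S.affine_fst[OF assms])
  show ?thesis by (rule T.swap)
qed

text \<open>The product of the factors \<open>X - t\<close>. On the \<open>e\<close>-coordinates it is diagonal; on the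
  \<open>f\<close>-coordinates each factor moves the highest nonzero coordinate up by exactly one. Playing these
  two descriptions against each other is the source of all independence statements below.\<close>

definition shifts :: "'k list \<Rightarrow> 'v \<Rightarrow> 'v" where
  "shifts ts v = foldr (\<lambda>t w. X w - t *s w) ts v"

lemma shifts_Nil [simp]: "shifts [] v = v" and
  shifts_Cons [simp]: "shifts (t # ts) v = X (shifts ts v) - t *s shifts ts v"
  by (simp_all add: shifts_def)

lemma ce_shifts:
  "i \<le> d \<Longrightarrow> ce i (shifts ts v) = (\<Prod>t\<leftarrow>ts. \<theta> i - t) * ce i v"
  by (induction ts) (auto simp: ce_simps ce_X algebra_simps)

lemma cf_X_above:
  assumes "\<And>k. m < k \<Longrightarrow> k \<le> d \<Longrightarrow> cf k v = 0" "Suc m < k" "k \<le> d"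
  shows "cf k (X v) = 0"
  unfolding cf_X[of k v]
proof (rule sum.neutral, rule ballI)
  fix j assume j: "j \<in> {..d}"
  show "C k j * cf j v = 0"
    using assms(1)[of j] C_zero[of k j] assms(2,3) j by (cases "j \<le> m") auto
qed

lemma cf_X_top:
  assumes "\<And>k. m < k \<Longrightarrow> k \<le> d \<Longrightarrow> cf k v = 0" "Suc m \<le> d"
  shows "cf (Suc m) (X v) = C (Suc m) m * cf m v"
proof -
  have "cf (Suc m) (X v) = (\<Sum>j\<le>d. if j = m then C (Suc m) m * cf m v else 0)"
    unfolding cf_X[of "Suc m" v]
  proof (rule sum.cong)
    fix j assume j: "j \<in> {..d}"
    show "C (Suc m) j * cf j v = (if j = m then C (Suc m) m * cf m v else 0)"
      using assms(1)[of j] C_zero[of "Suc m" j] assms(2) j by (cases j m rule: linorder_cases) auto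
  qed simp
  thus ?thesis using assms(2) by simp
qed

lemma cf_shifts:
  assumes "\<And>k. m < k \<Longrightarrow> k \<le> d \<Longrightarrow> cf k v = 0" "cf m v \<noteq> 0" "m + length ts \<le> d"
  shows "cf (m + length ts) (shifts ts v) \<noteq> 0 \<and>
    (\<forall>k. m + length ts < k \<and> k \<le> d \<longrightarrow> cf k (shifts ts v) = 0)"
  using assms(3)
proof (induction ts)
  case Nil
  thus ?case using assms by simp
next
  case (Cons t ts)
  let ?w = "shifts ts v" and ?n = "m + length ts"
  have IH: "cf ?n ?w \<noteq> 0" "\<And>k. ?n < k \<Longrightarrow> k \<le> d \<Longrightarrow> cf k ?w = 0"
    using Cons by auto
  have "cf (Suc ?n) (X ?w) = C (Suc ?n) ?n * cf ?n ?w"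
    using Cons.prems by (intro cf_X_top IH(2)) auto
  moreover have "C (Suc ?n) ?n \<noteq> 0" using Cons.prems by (intro C_nonzero) auto
  moreover have "cf k (X ?w) = 0" if "Suc ?n < k" "k \<le> d" for k
    using that by (intro cf_X_above[of ?n] IH(2)) auto
  ultimately show ?case using IH Cons.prems by (auto simp: cf_simps)
qed

text \<open>The factors \<open>X - \<theta> j\<close> for the \<open>j\<close> in the \<open>e\<close>-support annihilate \<open>v\<close>. If there were at most
  \<open>d - m\<close> of them, they would move the top \<open>f\<close>-coordinate from \<open>m\<close> to an index within range, where it
  stays nonzero.\<close>

lemma support_card:
  assumes "\<And>k. m < k \<Longrightarrow> k \<le> d \<Longrightarrow> cf k v = 0" "cf m v \<noteq> 0" "m \<le> d"
  shows "d < m + card {j. j \<le> d \<and> ce j v \<noteq> 0}"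
proof (rule ccontr)
  assume neg: "\<not> ?thesis"
  define S where "S = {j. j \<le> d \<and> ce j v \<noteq> 0}"
  have fin: "finite S" unfolding S_def by simp
  define ts where "ts = map \<theta> (sorted_list_of_set S)"
  have len: "length ts = card S" unfolding ts_def by simp
  have "shifts ts v = 0"
  proof (rule coord_eqI[OF be])
    fix i assume i: "i \<le> d"
    have "(\<Prod>t\<leftarrow>ts. \<theta> i - t) * ce i v = 0"
      using i fin unfolding ts_def by (auto simp: prod_list_zero_iff S_def image_iff)
    thus "ce i (shifts ts v) = ce i 0" using i by (simp add: ce_shifts ce_simps)
  qed
  moreover have "cf (m + length ts) (shifts ts v) \<noteq> 0"
    using cf_shifts[of m v ts] assms neg unfolding len S_def by auto
  ultimately show False by (simp add: cf_simps)
qed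

lemma cf_f0: "k \<le> d \<Longrightarrow> cf k (f 0) = (if k = 0 then 1 else 0)"
  by (simp add: coord_basis[OF bf])

lemma ce_f0: "j \<le> d \<Longrightarrow> ce j (f 0) \<noteq> 0"
proof -
  assume j: "j \<le> d"
  have "d < 0 + card {j. j \<le> d \<and> ce j (f 0) \<noteq> 0}"
    by (rule support_card) (auto simp: cf_f0)
  moreover have "{j. j \<le> d \<and> ce j (f 0) \<noteq> 0} \<subseteq> {..d}" by auto
  ultimately have "{j. j \<le> d \<and> ce j (f 0) \<noteq> 0} = {..d}"
    by (intro card_seteq) auto
  thus ?thesis using j by auto
qed

text \<open>The flag spanned by \<open>f 0, f 1, \<dots>\<close> and the flag spanned by \<open>e d, e (d - 1), \<dots>\<close> are opposite:
  a vector below index \<open>i\<close> in the one and from index \<open>i\<close> on in the other has too small an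
  \<open>e\<close>-support.\<close>

lemma opposite_flags:
  assumes "\<And>k. i \<le> k \<Longrightarrow> k \<le> d \<Longrightarrow> cf k v = 0" "\<And>k. k < i \<Longrightarrow> k \<le> d \<Longrightarrow> ce k v = 0"
  shows "v = 0"
proof (rule ccontr)
  assume "v \<noteq> 0"
  hence "\<exists>k\<le>d. cf k v \<noteq> 0" using coord_eqI[OF bf, of v 0] by (auto simp: coord_zero)
  then obtain k where k: "k \<le> d" "cf k v \<noteq> 0" by auto
  define m where "m = Max {k. k \<le> d \<and> cf k v \<noteq> 0}"
  have m: "m \<in> {k. k \<le> d \<and> cf k v \<noteq> 0}" unfolding m_def by (rule Max_in) (use k in auto)
  have top: "cf k v = 0" if "m < k" "k \<le> d" for k
    using that Max_ge[of "{k. k \<le> d \<and> cf k v \<noteq> 0}" k] unfolding m_def by fastforce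
  have mi: "m < i" using m assms(1)[of m] by (cases "m < i") auto
  have "{j. j \<le> d \<and> ce j v \<noteq> 0} \<subseteq> {i..d}" using assms(2) by (auto simp: not_less[symmetric])
  hence "card {j. j \<le> d \<and> ce j v \<noteq> 0} \<le> card {i..d}"
    by (intro card_mono) auto
  moreover have "d < m + card {j. j \<le> d \<and> ce j v \<noteq> 0}"
    by (rule support_card[OF top]) (use m in auto)
  ultimately show False using mi m by auto
qed

end

section \<open>The split basis\<close>

definition newton :: "(nat \<Rightarrow> 'k::comm_ring_1) \<Rightarrow> nat \<Rightarrow> 'k \<Rightarrow> 'k" where
  "newton \<theta> i t = (\<Prod>h<i. t - \<theta> h)"

lemma newton_0 [simp]: "newton \<theta> 0 t = 1" and
  newton_Suc: "newton \<theta> (Suc i) t = newton \<theta> i t * (t - \<theta> i)"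
  by (simp_all add: newton_def)

lemma newton_eq_0: "j < i \<Longrightarrow> newton \<theta> i (\<theta> j) = 0"
  unfolding newton_def by (rule prod_zero) auto

text \<open>The superdiagonal entry of \<open>Y\<close> in the split basis, expressed through the invariants. For the
  frame of a Leonard system, \<open>b\<close> is the last diagonal entry of \<open>Y\<close> in the eigenbasis of \<open>X\<close>, and the
  value is the \<open>i\<close>-th entry of the first split sequence if \<open>1 \<le> i \<le> d\<close>.\<close>

definition split_coeff ::
  "nat \<Rightarrow> (nat \<Rightarrow> 'k::field) \<Rightarrow> (nat \<Rightarrow> 'k) \<Rightarrow> 'k \<Rightarrow> nat \<Rightarrow> 'k" where
  "split_coeff d \<theta> \<theta>s b i =
     ((b - \<theta>s i) * newton \<theta> i (\<theta> d) + (\<theta>s 0 - b) * newton \<theta> i (\<theta> (d - 1)))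
       / newton \<theta> (i - 1) (\<theta> d)"

context leonard_frame
begin

text \<open>Listing the factors in reverse makes the recursion \<open>split_Suc\<close> the unfolding of one factor. The
  vector \<open>split i\<close> lies in the span of \<open>f 0, \<dots>, f i\<close> and in the span of \<open>e i, \<dots>, e d\<close>.\<close>

definition split :: "nat \<Rightarrow> 'v" where
  "split i = shifts (map \<theta> (rev [0..<i])) (f 0)"

lemma split_0 [simp]: "split 0 = f 0" and
  split_Suc: "split (Suc i) = X (split i) - \<theta> i *s split i"
  by (simp_all add: split_def)

lemma newton_nonzero: "i \<le> j \<Longrightarrow> j \<le> d \<Longrightarrow> newton \<theta> i (\<theta> j) \<noteq> 0"
  unfolding newton_def using \<theta>_neq by (subst prod_zero_iff) auto

lemma ce_split: "j \<le> d \<Longrightarrow> ce j (split i) = newton \<theta> i (\<theta> j) * ce j (f 0)"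
  by (induction i) (auto simp: split_Suc ce_simps ce_X newton_Suc algebra_simps)

lemma ce_split_below: "j < i \<Longrightarrow> j \<le> d \<Longrightarrow> ce j (split i) = 0"
  by (simp add: ce_split newton_eq_0)

lemma ce_split_nonzero: "i \<le> j \<Longrightarrow> j \<le> d \<Longrightarrow> ce j (split i) \<noteq> 0"
  by (simp add: ce_split newton_nonzero ce_f0)

lemma cf_split_top: "i \<le> d \<Longrightarrow> cf i (split i) \<noteq> 0"
  and cf_split_above: "i < k \<Longrightarrow> k \<le> d \<Longrightarrow> cf k (split i) = 0"
  using cf_shifts[of 0 "f 0" "map \<theta> (rev [0..<i])"] by (auto simp: split_def cf_f0)

lemma split_after_end: "split (Suc d) = 0"
  by (rule coord_eqI[OF be]) (auto simp: ce_split_below coord_zero)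

lemma X_split: "X (split i) = \<theta> i *s split i + split (Suc i)"
  by (simp add: split_Suc)

lemma split_basis: "is_ordered_basis scale d split"
proof (rule ordered_basisI[OF be])
  fix c assume z: "(\<Sum>i\<le>d. c i *s split i) = 0"
  have "k \<le> d \<longrightarrow> c k = 0" for k
  proof (induction k rule: less_induct)
    case (less k)
    show ?case
    proof
      assume k: "k \<le> d"
      have "0 = ce k (\<Sum>i\<le>d. c i *s split i)" by (simp add: z coord_zero)
      also have "\<dots> = (\<Sum>i\<le>d. c i * ce k (split i))"
        by (simp add: coord_sum[OF be] ce_simps)
      also have "\<dots> = (\<Sum>i\<le>d. if i = k then c k * ce k (split k) else 0)"
      proof (rule sum.cong)
        fix i assume "i \<in> {..d}"
        thus "c i * ce k (split i) = (if i = k then c k * ce k (split k) else 0)"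
          using less k ce_split_below[of k i] by (cases i k rule: linorder_cases) auto
      qed simp
      also have "\<dots> = c k * ce k (split k)" using k by simp
      finally show "c k = 0" using ce_split_nonzero[of k k] k by simp
    qed
  qed
  thus "\<forall>i\<le>d. c i = 0" by blast
qed

lemma ce_last_Y: "ce d (Y v) = B d d * ce d v + B d (d - 1) * ce (d - 1) v"
proof -
  have "ce d (Y v) = (\<Sum>j\<in>{d - 1, d}. B d j * ce j v)"
    unfolding ce_Y[of d v]
  proof (rule sum.mono_neutral_right)
    show "\<forall>j\<in>{..d} - {d - 1, d}. B d j * ce j v = 0"
    proof
      fix j assume "j \<in> {..d} - {d - 1, d}"
      hence "B d j = 0" by (intro B_zero) auto
      thus "B d j * ce j v = 0" by simp
    qed
  qed auto
  thus ?thesis using d_pos by (simp add: add.commute)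
qed

lemma B_last: "B d (d - 1) * ce (d - 1) (f 0) = (\<theta>s 0 - B d d) * ce d (f 0)"
  using ce_last_Y[of "f 0"] by (simp add: Y_f ce_simps algebra_simps)

abbreviation "vp \<equiv> split_coeff d \<theta> \<theta>s (B d d)"

text \<open>The vector \<open>Y (split (i + 1)) - \<theta>s (i + 1) *s split (i + 1)\<close> has lost its top \<open>f\<close>-coordinate and
  has gained at most one \<open>e\<close>-coordinate at the bottom, so by opposition of the flags it is a multiple
  of \<open>split i\<close>. The factor is found in the last \<open>e\<close>-coordinate, where the tridiagonal row of \<open>Y\<close> has
  only two entries and the second one is eliminated by \<open>B_last\<close>.\<close>

lemma Y_split:
  assumes i: "i < d"
  shows "Y (split (Suc i)) = \<theta>s (Suc i) *s split (Suc i) + vp (Suc i) *s split i"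
proof -
  let ?u = "split (Suc i)"
  define z where "z = Y ?u - \<theta>s (Suc i) *s ?u"
  define c where "c = ce i z / ce i (split i)"
  have "z - c *s split i = 0"
  proof (rule opposite_flags[of "Suc i"])
    fix k assume k: "Suc i \<le> k" "k \<le> d"
    show "cf k (z - c *s split i) = 0"
      using k cf_split_above[of "Suc i" k] cf_split_above[of i k]
      by (cases "k = Suc i") (auto simp: z_def cf_simps cf_Y)
  next
    fix k assume k: "k < Suc i" "k \<le> d"
    show "ce k (z - c *s split i) = 0"
    proof (cases "k = i")
      case True
      thus ?thesis using ce_split_nonzero[of i i] i by (simp add: ce_simps c_def)
    next
      case False
      have "ce k (Y ?u) = (\<Sum>j\<le>d. B k j * ce j ?u)" by (rule ce_Y)
      also have "\<dots> = 0"
      proof (rule sum.neutral, rule ballI)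
        fix j assume "j \<in> {..d}"
        thus "B k j * ce j ?u = 0"
          using ce_split_below[of j "Suc i"] B_zero[of k j] k False by (cases "j \<le> i") auto
      qed
      finally show ?thesis
        using k False by (simp add: z_def ce_simps ce_split_below)
    qed
  qed
  hence Yu: "Y ?u = \<theta>s (Suc i) *s ?u + c *s split i" by (simp add: z_def algebra_simps)
  let ?F = "ce d (f 0)" and ?b = "B d d"
  let ?n = "newton \<theta> (Suc i) (\<theta> d)" and ?n' = "newton \<theta> (Suc i) (\<theta> (d - 1))"
    and ?m = "newton \<theta> i (\<theta> d)"
  have "\<theta>s (Suc i) * (?n * ?F) + c * (?m * ?F) = ce d (Y ?u)"
    unfolding Yu by (simp add: ce_simps ce_split)
  also have "\<dots> = ?b * (?n * ?F) + B d (d - 1) * (?n' * ce (d - 1) (f 0))"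
    unfolding ce_last_Y[of ?u] by (simp add: ce_split)
  also have "\<dots> = ?b * (?n * ?F) + ?n' * ((\<theta>s 0 - ?b) * ?F)"
    unfolding B_last[symmetric] by (simp add: algebra_simps)
  finally have "(c * ?m) * ?F = ((?b - \<theta>s (Suc i)) * ?n + (\<theta>s 0 - ?b) * ?n') * ?F"
    by (simp add: algebra_simps)
  hence "c * ?m = (?b - \<theta>s (Suc i)) * ?n + (\<theta>s 0 - ?b) * ?n'"
    using ce_f0[of d] by simp
  moreover have "?m \<noteq> 0" using i by (intro newton_nonzero) auto
  ultimately have "c = vp (Suc i)" unfolding split_coeff_def by (simp add: field_simps)
  thus ?thesis using Yu by simp
qed

text \<open>The rows of an irreducible tridiagonal matrix determine an eigenvector from its first coordinate.\<close>

lemma Y_eigenvector_first_coord: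
  assumes "Y v = t *s v" "ce 0 v = 0"
  shows "v = 0"
proof -
  have "\<forall>j\<le>k. j \<le> d \<longrightarrow> ce j v = 0" for k
  proof (induction k)
    case 0 thus ?case using assms(2) by simp
  next
    case (Suc k)
    have "ce (Suc k) v = 0" if k: "Suc k \<le> d"
    proof -
      have "0 = ce k (Y v)" using Suc k by (simp add: assms(1) ce_simps)
      also have "\<dots> = (\<Sum>j\<le>d. if j = Suc k then B k (Suc k) * ce (Suc k) v else 0)"
        unfolding ce_Y[of k v]
      proof (rule sum.cong)
        fix j assume "j \<in> {..d}"
        thus "B k j * ce j v = (if j = Suc k then B k (Suc k) * ce (Suc k) v else 0)"
          using Suc B_zero[of k j] k by (cases j "Suc k" rule: linorder_cases) auto
      qed simp
      also have "\<dots> = B k (Suc k) * ce (Suc k) v" using k by simp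
      finally show ?thesis using B_nonzero[of k "Suc k"] k by simp
    qed
    thus ?case using Suc by (auto simp: le_Suc_eq)
  qed
  thus ?thesis by (intro coord_eqI[OF be]) (auto simp: coord_zero)
qed

lemma cf0_split_recurrence:
  assumes "i < d"
  shows "(\<theta>s 0 - \<theta>s (Suc i)) * cf 0 (split (Suc i)) = vp (Suc i) * cf 0 (split i)"
proof -
  have "\<theta>s 0 * cf 0 (split (Suc i)) = cf 0 (Y (split (Suc i)))" by (simp add: cf_Y)
  also have "\<dots> = \<theta>s (Suc i) * cf 0 (split (Suc i)) + vp (Suc i) * cf 0 (split i)"
    unfolding Y_split[OF assms] by (simp add: cf_simps)
  finally show ?thesis by (simp add: algebra_simps)
qed

lemma vp_nonzero:
  assumes "i < d"
  shows "vp (Suc i) \<noteq> 0"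
proof
  assume "vp (Suc i) = 0"
  hence "Y (split (Suc i)) = \<theta>s (Suc i) *s split (Suc i)" using Y_split[OF assms] by simp
  hence "split (Suc i) = 0"
    by (rule Y_eigenvector_first_coord) (simp add: ce_split_below)
  thus False using cf_split_top[of "Suc i"] assms by (simp add: coord_zero)
qed

lemma cf0_split_nonzero: "i \<le> d \<Longrightarrow> cf 0 (split i) \<noteq> 0"
proof (induction i)
  case 0 thus ?case by (simp add: cf_f0)
next
  case (Suc i)
  thus ?case using cf0_split_recurrence[of i] vp_nonzero[of i] by auto
qed

text \<open>The ratio formula that defines the parameter array: \<open>cf 0\<close> of a split vector is the trace in that
  definition, and \<open>cf0_split_nonzero\<close> shows that no denominator vanishes.\<close>

lemma vp_ratio:
  assumes "1 \<le> i" "i \<le> d"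
  shows "vp i = (\<theta>s 0 - \<theta>s i) * (cf 0 (split i) / cf 0 (split (i - 1)))"
proof -
  obtain j where j: "i = Suc j" "j < d" using assms by (cases i) auto
  show ?thesis using cf0_split_recurrence[OF j(2)] cf0_split_nonzero[of j] j
    by (simp add: field_simps)
qed

lemma vp_first: "vp 1 = (\<theta>s 0 - \<theta>s 1) * (C 0 0 - \<theta> 0)"
  using vp_ratio[of 1] d_pos by (simp add: split_Suc cf_simps cf_f0)

lemma vp_last: "vp d = (\<theta> d - \<theta> (d - 1)) * (B d d - \<theta>s d)"
proof -
  obtain c where c: "d = Suc c" using d_pos by (cases d) auto
  have "newton \<theta> c (\<theta> d) \<noteq> 0" using c by (intro newton_nonzero) auto
  thus ?thesis unfolding split_coeff_def c by (simp add: newton_Suc newton_eq_0)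
qed

text \<open>Equates the value of the first split parameter given by the ratio formula with its value in terms of
  the invariants. It relates the ends \<open>d\<close> of \<open>\<theta>\<close> and \<open>0\<close> of \<open>\<theta>s\<close>; the other three corners follow by
  reversal.\<close>

lemma corner_identity: "(\<theta>s 0 - \<theta>s 1) * (C 0 0 - \<theta> d) = (\<theta> d - \<theta> (d - 1)) * (B d d - \<theta>s 0)"
  using vp_first by (simp add: split_coeff_def newton_Suc algebra_simps)

text \<open>The matrices of \<open>X\<close> and \<open>Y\<close> in the split basis depend only on the two eigenvalue sequences and on
  \<open>B d d\<close>, so the linear map between the split bases of two frames with the same data intertwines
  them.\<close>

lemma intertwiner:
  assumes "leonard_frame scale d X' Y' e' f' \<theta> \<theta>s"
    and "coord scale d e' d (Y' (e' d)) = B d d"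
  obtains G where "Vector_Spaces.linear scale scale G" "bij G"
    "\<And>v. G (X v) = X' (G v)" "\<And>v. G (Y v) = Y' (G v)"
proof -
  interpret N: leonard_frame scale d X' Y' e' f' \<theta> \<theta>s by fact
  obtain G where G: "Vector_Spaces.linear scale scale G" "\<And>i. i \<le> d \<Longrightarrow> G (split i) = N.split i"
    using linear_extend[OF split_basis] by metis
  obtain H where H: "Vector_Spaces.linear scale scale H" "\<And>i. i \<le> d \<Longrightarrow> H (N.split i) = split i"
    using linear_extend[OF N.split_basis] by metis
  interpret G: Vector_Spaces.linear scale scale G by (rule G)
  have GH: "G \<circ> H = id"
    by (rule linear_eq_on_ordered_basis[OF _ _ N.split_basis])
       (auto intro: Vector_Spaces.linear_compose G H simp: linear_id G H)
  have HG: "H \<circ> G = id"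
    by (rule linear_eq_on_ordered_basis[OF _ _ split_basis])
       (auto intro: Vector_Spaces.linear_compose G H simp: linear_id G H)
  have "bij G" by (rule o_bij[OF HG GH])
  moreover have "G \<circ> X = X' \<circ> G"
  proof (rule linear_eq_on_ordered_basis[OF _ _ split_basis])
    fix i assume i: "i \<le> d"
    show "(G \<circ> X) (split i) = (X' \<circ> G) (split i)"
      using i by (cases "i = d")
        (simp_all add: X_split N.X_split G.add G.scale G split_after_end N.split_after_end G.zero)
  qed (auto intro: Vector_Spaces.linear_compose G linX N.linX)
  moreover have "G \<circ> Y = Y' \<circ> G"
  proof (rule linear_eq_on_ordered_basis[OF _ _ split_basis])
    fix i assume i: "i \<le> d"
    show "(G \<circ> Y) (split i) = (Y' \<circ> G) (split i)"
    proof (cases i)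
      case 0
      thus ?thesis using G(2)[of 0] by (simp add: Y_f N.Y_f G.scale)
    next
      case (Suc j)
      thus ?thesis using i
        by (simp add: Y_split N.Y_split G.add G.scale G assms(2))
    qed
  qed (auto intro: Vector_Spaces.linear_compose G linY N.linY)
  ultimately show ?thesis using that G(1) by (metis comp_apply)
qed

end

section \<open>The recurrence of the eigenvalue sequences\<close>

definition recurrent :: "nat \<Rightarrow> 'k::field \<Rightarrow> (nat \<Rightarrow> 'k) \<Rightarrow> bool" where
  "recurrent d a x \<longleftrightarrow> (\<forall>i. i + 3 \<le> d \<longrightarrow> x (i + 1) - x (i + 2) = a * (x i - x (i + 3)))"

lemma recurrent_rev:
  assumes "recurrent d a x"
  shows "recurrent d a (\<lambda>i. x (d - i))"
  unfolding recurrent_def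
proof (intro allI impI)
  fix i assume i: "i + 3 \<le> d"
  define j where "j = d - (i + 3)"
  have "x (j + 1) - x (j + 2) = a * (x j - x (j + 3))"
    using assms i unfolding recurrent_def j_def by auto
  moreover have "d - (i + 1) = j + 2" "d - (i + 2) = j + 1" "d - i = j + 3" "d - (i + 3) = j"
    using i unfolding j_def by auto
  ultimately show "x (d - (i + 1)) - x (d - (i + 2)) = a * (x (d - i) - x (d - (i + 3)))"
    by (simp add: algebra_simps)
qed

lemma recurrent_lincomb:
  assumes "recurrent d a x" "recurrent d a y"
  shows "recurrent d a (\<lambda>i. r * x i + s * y i + t)"
  unfolding recurrent_def
proof (intro allI impI)
  fix i assume i: "i + 3 \<le> d"
  have "x (i + 1) - x (i + 2) = a * (x i - x (i + 3))" "y (i + 1) - y (i + 2) = a * (y i - y (i + 3))"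
    using assms i unfolding recurrent_def by auto
  hence "r * (x (i + 1) - x (i + 2)) + s * (y (i + 1) - y (i + 2))
    = r * (a * (x i - x (i + 3))) + s * (a * (y i - y (i + 3)))" by simp
  thus "r * x (i + 1) + s * y (i + 1) + t - (r * x (i + 2) + s * y (i + 2) + t)
    = a * (r * x i + s * y i + t - (r * x (i + 3) + s * y (i + 3) + t))"
    by (simp add: algebra_simps)
qed

text \<open>The solution of the recurrence with \<open>inverse a = b + 1\<close> that starts with \<open>0, 0, 1\<close>.\<close>

fun wave :: "'k::field \<Rightarrow> nat \<Rightarrow> 'k" where
  "wave b 0 = 0"
| "wave b (Suc 0) = 0"
| "wave b (Suc (Suc n)) = b * wave b (Suc n) - wave b n + 1"

text \<open>Consecutive values lie on a fixed conic. This replaces the closed form of the solution, which would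
  need roots of a quadratic over an arbitrary field.\<close>

lemma wave_conic:
  "wave b (Suc n) ^ 2 + wave b n ^ 2 - b * wave b (Suc n) * wave b n
     - wave b (Suc n) - wave b n = 0"
proof (induction n)
  case (Suc n)
  have "wave b (Suc (Suc n)) ^ 2 + wave b (Suc n) ^ 2 - b * wave b (Suc (Suc n)) * wave b (Suc n)
     - wave b (Suc (Suc n)) - wave b (Suc n)
     = wave b (Suc n) ^ 2 + wave b n ^ 2 - b * wave b (Suc n) * wave b n
     - wave b (Suc n) - wave b n"
    by (simp add: power2_eq_square algebra_simps)
  thus ?case using Suc by simp
qed simp

lemma recurrent_step:
  fixes x :: "nat \<Rightarrow> 'k::field"
  assumes "recurrent d a x" "a \<noteq> 0" "n + 3 \<le> d"
  shows "x (n + 3) = x n - inverse a * (x (n + 1) - x (n + 2))"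
  using assms unfolding recurrent_def by (auto simp: field_simps)

lemma recurrent_solution:
  fixes x :: "nat \<Rightarrow> 'k::field"
  assumes "recurrent d a x" "a \<noteq> 0" "Suc n \<le> d"
  defines "b \<equiv> inverse a - 1"
  shows "x (Suc n) = x 1 + (x 2 - x 1) * wave b (Suc n) - (x 1 - x 0) * wave b n"
  using assms(3)
proof (induction n rule: less_induct)
  case (less n)
  consider "n = 0" | "n = 1" | m where "n = m + 2"
    by (metis One_nat_def add_2_eq_Suc' not0_implies_Suc)
  thus ?case
  proof cases
    case 3
    have "x (m + 3) = x m - (b + 1) * (x (m + 1) - x (m + 2))"
      using recurrent_step[OF assms(1,2), of m] less.prems 3 by (simp add: b_def)
    moreover have "x (m + 2) = x 1 + (x 2 - x 1) * wave b (m + 2) - (x 1 - x 0) * wave b (m + 1)"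
      using less.IH[of "m + 1"] less.prems 3 by (simp add: eval_nat_numeral)
    moreover have "x (m + 1) = x 1 + (x 2 - x 1) * wave b (m + 1) - (x 1 - x 0) * wave b m"
      using less.IH[of m] less.prems 3 by simp
    moreover have "x m = x 1 + (x 2 - x 1) * wave b m - (x 1 - x 0) * (b * wave b m - wave b (m + 1) + 1)"
    proof (cases m)
      case (Suc l)
      thus ?thesis using less.IH[of l] less.prems 3 by (simp add: algebra_simps)
    qed (simp add: algebra_simps)
    moreover have "wave b (m + 3) = b * wave b (m + 2) - wave b (m + 1) + 1"
       "wave b (m + 2) = b * wave b (m + 1) - wave b m + 1"
      by (simp_all add: eval_nat_numeral)
    ultimately have "x (m + 3) = x 1 + (x 2 - x 1) * wave b (m + 3) - (x 1 - x 0) * wave b (m + 2)"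
      by (simp only:) (simp add: algebra_simps)
    thus ?thesis using 3 by (simp add: eval_nat_numeral)
  qed (simp_all add: numeral_2_eq_2)
qed

text \<open>A solution with \<open>x 0 = x 1 = 0\<close> is \<open>x 2\<close> times \<open>wave\<close>, so it suffices that \<open>wave b d\<close> is nonzero when
  \<open>d \<ge> 3\<close>. If it were zero, the conic would force the preceding value to be \<open>0\<close> or \<open>1\<close>, and then every solution would
  repeat its initial value at \<open>d - 1\<close> or at \<open>d\<close>; the injective solution \<open>\<theta>\<close> does not.\<close>

lemma recurrent_unique:
  fixes x \<theta> :: "nat \<Rightarrow> 'k::field"
  assumes "a \<noteq> 0" "recurrent d a x" "recurrent d a \<theta>" "inj_on \<theta> {..d}"
    and x: "x 0 = 0" "x 1 = 0" "x d = 0" and i: "i \<le> d"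
  shows "x i = 0"
proof (cases "d \<le> 2")
  case True
  hence "d = 0 \<or> d = 1 \<or> d = 2" "i = 0 \<or> i = 1 \<or> i = 2" using i by auto
  thus ?thesis using i x by auto
next
  case False
  define b where "b = inverse a - 1"
  define n where "n = d - 2"
  have n: "d = Suc (Suc n)" "n \<ge> 1" using False unfolding n_def by auto
  note x_eq = recurrent_solution[OF assms(2,1), folded b_def]
    and \<theta>_eq = recurrent_solution[OF assms(3,1), folded b_def]
  have "wave b (Suc (Suc n)) \<noteq> 0"
  proof
    assume S: "wave b (Suc (Suc n)) = 0"
    have "(wave b (Suc n)) ^ 2 - wave b (Suc n) = 0" using wave_conic[of b "Suc n"] S by simp
    hence "wave b (Suc n) * (wave b (Suc n) - 1) = 0" by (simp add: power2_eq_square algebra_simps)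
    hence "wave b (Suc n) = 0 \<or> wave b (Suc n) = 1" by auto
    thus False
    proof
      assume 0: "wave b (Suc n) = 0"
      have "wave b n = 1" using S 0 by simp
      hence "\<theta> (Suc n) = \<theta> 0" using \<theta>_eq[of n] n 0 by simp
      thus False using assms(4) n unfolding inj_on_def by (metis Suc_n_not_le_n atMost_iff bot_nat_0.extremum le_SucI nat.distinct(1) order_refl)
    next
      assume 1: "wave b (Suc n) = 1"
      hence "\<theta> (Suc (Suc n)) = \<theta> 0" using \<theta>_eq[of "Suc n"] n S by simp
      thus False using assms(4) n unfolding inj_on_def by (metis atMost_iff bot_nat_0.extremum nat.distinct(1) order_refl)
    qed
  qed
  moreover have "x 2 * wave b (Suc (Suc n)) = 0"
    using x_eq[of "Suc n"] n x by simp
  ultimately have "x 2 = 0" by simp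
  thus ?thesis using x_eq[of "i - 1"] x i by (cases i) auto
qed

context leonard_frame
begin

lemma flag_span:
  assumes "\<And>k. m \<le> k \<Longrightarrow> k \<le> d \<Longrightarrow> cf k v = 0" "m \<le> Suc d"
  shows "\<exists>c. v = (\<Sum>i<m. c i *s split i)"
  using assms
proof (induction m arbitrary: v)
  case 0
  hence "v = 0" by (intro coord_eqI[OF bf]) (auto simp: coord_zero)
  thus ?case by simp
next
  case (Suc m)
  define t where "t = cf m v / cf m (split m)"
  have "\<exists>c. v - t *s split m = (\<Sum>i<m. c i *s split i)"
  proof (rule Suc.IH)
    fix k assume k: "m \<le> k" "k \<le> d"
    show "cf k (v - t *s split m) = 0"
      using k Suc.prems(1)[of k] cf_split_top[of m] cf_split_above[of m k]
      by (cases "k = m") (auto simp: cf_simps t_def)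
  qed (use Suc.prems in auto)
  then obtain c where c: "v - t *s split m = (\<Sum>i<m. c i *s split i)" by blast
  have "v = (\<Sum>i<Suc m. (c(m := t)) i *s split i)"
    using c by (simp add: algebra_simps cong: sum.cong_simp)
  thus ?case by blast
qed

lemma cf_Y_above:
  assumes "\<And>k. m < k \<Longrightarrow> k \<le> d \<Longrightarrow> cf k v = 0" "m < k" "k \<le> d"
  shows "cf k (Y v) = 0"
  using assms by (simp add: cf_Y)

text \<open>Chosen so that \<open>weight i - weight j = \<theta> i * \<theta> j * (\<theta> i - \<theta> j)\<close> for neighbouring \<open>i\<close> and \<open>j\<close>. As
  \<open>Y\<close> is tridiagonal in the basis \<open>e\<close>, the operator \<open>XXYX - XYXX\<close> is then the commutator of \<open>Y\<close> with
  the operator that has the eigenvalues \<open>weight i\<close> on the \<open>e i\<close>.\<close>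

definition weight :: "nat \<Rightarrow> 'k" where
  "weight j = (\<Sum>i<j. \<theta> i * \<theta> (Suc i) * (\<theta> (Suc i) - \<theta> i))"

lemma weight_neighbour:
  assumes "j = Suc i \<or> i = Suc j \<or> i = j"
  shows "\<theta> i * \<theta> j * (\<theta> i - \<theta> j) = weight i - weight j"
  using assms by (elim disjE) (auto simp: weight_def algebra_simps)

lemma ce_cubic_commutator:
  assumes "i \<le> d"
  shows "ce i (X (X (Y (X v))) - X (Y (X (X v)))) = (\<Sum>j\<le>d. (weight i - weight j) * B i j * ce j v)"
proof -
  have "ce i (X (X (Y (X v))) - X (Y (X (X v)))) =
    \<theta> i * (\<theta> i * (\<Sum>j\<le>d. B i j * (\<theta> j * ce j v))) - \<theta> i * (\<Sum>j\<le>d. B i j * (\<theta> j * (\<theta> j * ce j v)))"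
    using assms by (simp add: ce_simps ce_X ce_Y[of i "X v"] ce_Y[of i "X (X v)"])
  also have "\<dots> = (\<Sum>j\<le>d. \<theta> i * \<theta> j * (\<theta> i - \<theta> j) * B i j * ce j v)"
    unfolding sum_distrib_left sum_subtractf[symmetric] by (simp add: algebra_simps)
  also have "\<dots> = (\<Sum>j\<le>d. (weight i - weight j) * B i j * ce j v)"
  proof (rule sum.cong)
    fix j assume j: "j \<in> {..d}"
    show "\<theta> i * \<theta> j * (\<theta> i - \<theta> j) * B i j * ce j v = (weight i - weight j) * B i j * ce j v"
    proof (cases "j = Suc i \<or> i = Suc j \<or> i = j")
      case True
      thus ?thesis by (simp only: weight_neighbour)
    next
      case False
      hence "Suc i < j \<or> Suc j < i" by linarith
      thus ?thesis using B_zero[of i j] j assms by simp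
    qed
  qed simp
  finally show ?thesis .
qed

text \<open>Apply that commutator to \<open>f 0\<close> and let \<open>w\<close> be the image of \<open>f 0\<close> under the weight operator. As
  \<open>X\<close> occurs three times, \<open>XXYX - XYXX\<close> maps \<open>f 0\<close> into the span of \<open>f 0, \<dots>, f 3\<close>, and on the
  coordinates of \<open>w\<close> the commutator acts by \<open>\<theta>s 0 - \<theta>s k\<close>, which is nonzero. Hence \<open>w\<close> lies in the
  same span, that is, \<open>w\<close> is a cubic polynomial in \<open>X\<close> applied to \<open>f 0\<close>. Comparing \<open>e\<close>-coordinates, and
  dividing by those of \<open>f 0\<close>, which are nonzero, shows that the weights are this cubic in \<open>\<theta>\<close>.\<close>

lemma weight_cubic:
  assumes "3 \<le> d"
  obtains p q r a where "\<And>j. j \<le> d \<Longrightarrow> weight j = p + q * \<theta> j + r * \<theta> j ^ 2 + a * \<theta> j ^ 3"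
proof -
  define w where "w = (\<Sum>j\<le>d. (weight j * ce j (f 0)) *s e j)"
  have ce_w: "ce j w = weight j * ce j (f 0)" if "j \<le> d" for j
  proof -
    have "ce j w = (\<Sum>i\<le>d. if i = j then weight j * ce j (f 0) else 0)"
      unfolding w_def coord_sum[OF be]
      by (rule sum.cong) (auto simp: ce_simps coord_basis[OF be] that)
    thus ?thesis using that by simp
  qed
  let ?D = "X (X (Y (X (f 0)))) - X (Y (X (X (f 0))))"
  have "?D = \<theta>s 0 *s w - Y w"
  proof (rule coord_eqI[OF be])
    fix i assume i: "i \<le> d"
    have "ce i ?D = weight i * (\<Sum>j\<le>d. B i j * ce j (f 0)) - (\<Sum>j\<le>d. B i j * (weight j * ce j (f 0)))"
      unfolding ce_cubic_commutator[OF i] sum_distrib_left sum_subtractf[symmetric]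
      by (simp add: algebra_simps)
    also have "\<dots> = weight i * ce i (Y (f 0)) - ce i (Y w)"
      unfolding ce_Y[of i w] ce_Y[of i "f 0"] by (simp add: ce_w)
    finally show "ce i ?D = ce i (\<theta>s 0 *s w - Y w)"
      using i by (simp add: ce_simps Y_f ce_w)
  qed
  hence "cf k ?D = cf k (\<theta>s 0 *s w - Y w)" for k by simp
  hence D: "(\<theta>s 0 - \<theta>s k) * cf k w = cf k ?D" if "k \<le> d" for k
    using that by (simp only: cf_simps cf_Y left_diff_distrib)
  have f0: "cf k (f 0) = 0" if "0 < k" "k \<le> d" for k using that by (simp add: cf_f0)
  have x1: "cf k (X (f 0)) = 0" if "1 < k" "k \<le> d" for k
    using that by (intro cf_X_above[of 0] f0) auto
  have x2: "cf k (X (X (f 0))) = 0" if "2 < k" "k \<le> d" for k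
    using that by (intro cf_X_above[of 1] x1) auto
  have y1: "cf k (X (Y (X (f 0)))) = 0" if "2 < k" "k \<le> d" for k
    using that by (intro cf_X_above[of 1] cf_Y_above[of 1] x1) auto
  have y2: "cf k (X (X (Y (X (f 0))))) = 0" if "3 < k" "k \<le> d" for k
    using that by (intro cf_X_above[of 2] y1) auto
  have y3: "cf k (X (Y (X (X (f 0))))) = 0" if "3 < k" "k \<le> d" for k
    using that by (intro cf_X_above[of 2] cf_Y_above[of 2] x2) auto
  have w0: "cf k w = 0" if "4 \<le> k" "k \<le> d" for k
    using D[of k] y2[of k] y3[of k] \<theta>s_neq[of 0 k] that by (simp add: cf_simps)
  have "\<exists>c. w = (\<Sum>i<4. c i *s split i)" by (rule flag_span) (use w0 assms in auto)
  then obtain c where c: "w = (\<Sum>i<4. c i *s split i)" by blast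
  have newton_form: "weight j = (\<Sum>i<4. c i * newton \<theta> i (\<theta> j))" if j: "j \<le> d" for j
  proof -
    have "weight j * ce j (f 0) = (\<Sum>i<4. c i * newton \<theta> i (\<theta> j)) * ce j (f 0)"
      unfolding ce_w[OF j, symmetric] c coord_sum[OF be] sum_distrib_right
      using j by (intro sum.cong) (auto simp: ce_simps ce_split)
    thus ?thesis using ce_f0[OF j] by simp
  qed
  have cubic_form: "(\<Sum>i<4. c i * newton \<theta> i t) = (c 0 - c 1 * \<theta> 0 + c 2 * \<theta> 0 * \<theta> 1 - c 3 * \<theta> 0 * \<theta> 1 * \<theta> 2)
     + (c 1 - c 2 * (\<theta> 0 + \<theta> 1) + c 3 * (\<theta> 0 * \<theta> 1 + \<theta> 0 * \<theta> 2 + \<theta> 1 * \<theta> 2)) * t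
     + (c 2 - c 3 * (\<theta> 0 + \<theta> 1 + \<theta> 2)) * t ^ 2 + c 3 * t ^ 3" for t
    by (simp add: eval_nat_numeral newton_Suc algebra_simps)
  show ?thesis by (rule that[OF trans[OF newton_form cubic_form]])
qed

text \<open>By \<open>weight_cubic\<close> the commutator identity reads
  \<open>XXYX - XYXX = [q X + r X\<^sup>2 + a X\<^sup>3, Y]\<close>. Its entries at neighbouring indices of the basis \<open>e\<close> give the
  recurrence for \<open>\<theta>\<close>; its entries three steps apart in the basis \<open>f\<close>, where only the cubic term
  contributes, give the one for \<open>\<theta>s\<close> with the same \<open>a\<close>.\<close>

lemma recurrences:
  obtains a where "a \<noteq> 0" "recurrent d a \<theta>" "recurrent d a \<theta>s"
proof (cases "3 \<le> d")
  case False
  \<comment> \<open>With fewer than four indices the recurrence is empty, so any nonzero constant does.\<close>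
  show ?thesis by (rule that[of 1]) (use False in \<open>auto simp: recurrent_def\<close>)
next
  case d: True
  from weight_cubic[OF d] obtain p q r a
    where W: "\<And>j. j \<le> d \<Longrightarrow> weight j = p + q * \<theta> j + r * \<theta> j ^ 2 + a * \<theta> j ^ 3" by blast
  \<comment> \<open>Two divided differences of the cubic remove first \<open>p\<close> and then \<open>q\<close>.\<close>
  have 1: "\<theta> j * \<theta> (j + 1) = q + r * (\<theta> j + \<theta> (j + 1))
      + a * (\<theta> j ^ 2 + \<theta> j * \<theta> (j + 1) + \<theta> (j + 1) ^ 2)" if j: "j + 1 \<le> d" for j
  proof -
    have "(\<theta> j - \<theta> (j + 1)) * (\<theta> j * \<theta> (j + 1)) = weight j - weight (j + 1)"
      using weight_neighbour[of "j + 1" j] by (simp add: algebra_simps)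
    also have "\<dots> = (\<theta> j - \<theta> (j + 1)) * (q + r * (\<theta> j + \<theta> (j + 1))
      + a * (\<theta> j ^ 2 + \<theta> j * \<theta> (j + 1) + \<theta> (j + 1) ^ 2))"
      using j by (simp add: W power2_eq_square power3_eq_cube algebra_simps)
    finally show ?thesis using \<theta>_neq[of j "j + 1"] j by simp
  qed
  have 2: "\<theta> (j + 1) = r + a * (\<theta> j + \<theta> (j + 1) + \<theta> (j + 2))" if j: "j + 2 \<le> d" for j
  proof -
    have "(\<theta> j - \<theta> (j + 2)) * \<theta> (j + 1) = \<theta> j * \<theta> (j + 1) - \<theta> (j + 1) * \<theta> (j + 1 + 1)"
      by (simp add: algebra_simps)
    also have "\<dots> = (q + r * (\<theta> j + \<theta> (j + 1))
        + a * (\<theta> j ^ 2 + \<theta> j * \<theta> (j + 1) + \<theta> (j + 1) ^ 2))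
      - (q + r * (\<theta> (j + 1) + \<theta> (j + 1 + 1))
        + a * (\<theta> (j + 1) ^ 2 + \<theta> (j + 1) * \<theta> (j + 1 + 1) + \<theta> (j + 1 + 1) ^ 2))"
      using j by (intro arg_cong2[where f = minus] 1) auto
    also have "\<dots> = (\<theta> j - \<theta> (j + 2)) * (r + a * (\<theta> j + \<theta> (j + 1) + \<theta> (j + 2)))"
      by (simp add: power2_eq_square algebra_simps)
    finally show ?thesis using \<theta>_neq[of j "j + 2"] j by simp
  qed
  have rec: "recurrent d a \<theta>"
    unfolding recurrent_def
  proof (intro allI impI)
    fix i assume i: "i + 3 \<le> d"
    have "\<theta> (i + 1) - \<theta> (i + 1 + 1) = (r + a * (\<theta> i + \<theta> (i + 1) + \<theta> (i + 2)))
       - (r + a * (\<theta> (i + 1) + \<theta> (i + 1 + 1) + \<theta> (i + 1 + 2)))"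
      using i by (intro arg_cong2[where f = minus] 2) auto
    thus "\<theta> (i + 1) - \<theta> (i + 2) = a * (\<theta> i - \<theta> (i + 3))"
      by (simp add: algebra_simps numeral_3_eq_3)
  qed
  hence "\<theta> 1 - \<theta> 2 = a * (\<theta> 0 - \<theta> 3)" using d unfolding recurrent_def
    by (metis add_0)
  hence "a \<noteq> 0" using \<theta>_neq[of 1 2] d by auto
  have comm: "X (X (Y (X v))) - X (Y (X (X v))) =
    q *s X (Y v) + r *s X (X (Y v)) + a *s X (X (X (Y v)))
     - (q *s Y (X v) + r *s Y (X (X v)) + a *s Y (X (X (X v))))" for v
  proof (rule coord_eqI[OF be])
    fix i assume i: "i \<le> d"
    have "ce i (X (X (Y (X v))) - X (Y (X (X v)))) = (\<Sum>j\<le>d. (weight i - weight j) * B i j * ce j v)"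
      by (rule ce_cubic_commutator[OF i])
    also have "\<dots> = (\<Sum>j\<le>d. (q * \<theta> i + r * \<theta> i ^ 2 + a * \<theta> i ^ 3) * (B i j * ce j v)
       - (q * (B i j * ce j (X v)) + r * (B i j * ce j (X (X v))) + a * (B i j * ce j (X (X (X v))))))"
      by (rule sum.cong) (auto simp: W i ce_X power2_eq_square power3_eq_cube algebra_simps)
    also have "\<dots> = (q * \<theta> i + r * \<theta> i ^ 2 + a * \<theta> i ^ 3) * ce i (Y v)
       - (q * ce i (Y (X v)) + r * ce i (Y (X (X v))) + a * ce i (Y (X (X (X v)))))"
      unfolding sum_subtractf sum.distrib sum_distrib_left[symmetric]
      by (simp only: ce_Y[of i v] ce_Y[of i "X v"] ce_Y[of i "X (X v)"] ce_Y[of i "X (X (X v))"])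
    finally show "ce i (X (X (Y (X v))) - X (Y (X (X v)))) = ce i (q *s X (Y v) + r *s X (X (Y v))
       + a *s X (X (X (Y v))) - (q *s Y (X v) + r *s Y (X (X v)) + a *s Y (X (X (X v)))))"
      using i by (simp add: ce_simps ce_X power2_eq_square power3_eq_cube algebra_simps)
  qed
  interpret X: Vector_Spaces.linear scale scale X by (rule linX)
  have "recurrent d a \<theta>s"
    unfolding recurrent_def
  proof (intro allI impI)
    fix i assume i: "i + 3 \<le> d"
    have f0: "cf k (f i) = 0" if "i < k" "k \<le> d" for k
      using that i by (simp add: coord_basis[OF bf])
    have x1: "cf k (X (f i)) = 0" if "i + 1 < k" "k \<le> d" for k
      using that i by (intro cf_X_above[of i] f0) auto
    have x2: "cf k (X (X (f i))) = 0" if "i + 2 < k" "k \<le> d" for k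
      using that i by (intro cf_X_above[of "i + 1"] x1) auto
    have y1: "cf k (Y (X (f i))) = 0" if "i + 1 < k" "k \<le> d" for k
      using that x1 by (simp add: cf_Y)
    have y2: "cf k (Y (X (X (f i)))) = 0" if "i + 2 < k" "k \<le> d" for k
      using that x2 by (simp add: cf_Y)
    have y3: "cf k (X (Y (X (f i)))) = 0" if "i + 2 < k" "k \<le> d" for k
      using that i by (intro cf_X_above[of "i + 1"] y1) auto
    \<comment> \<open>Names for the subdiagonal entries, each of which is the top coordinate produced by one \<open>X\<close>.\<close>
    define c1 c2 c3 where "c1 = C (i + 1) i" and "c2 = C (i + 2) (i + 1)" and "c3 = C (i + 3) (i + 2)"
    have X1: "cf (i + 1) (X (f i)) = c1" by (simp add: c1_def)
    have X2: "cf (i + 2) (X v) = c2 * cf (i + 1) v"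
      if "\<And>k. i + 1 < k \<Longrightarrow> k \<le> d \<Longrightarrow> cf k v = 0" for v
      using cf_X_top[of "i + 1" v] that i by (simp add: c2_def)
    have X3: "cf (i + 3) (X v) = c3 * cf (i + 2) v"
      if "\<And>k. i + 2 < k \<Longrightarrow> k \<le> d \<Longrightarrow> cf k v = 0" for v
      using cf_X_top[of "i + 2" v] that i by (simp add: c3_def eval_nat_numeral)
    have XX: "cf (i + 2) (X (X (f i))) = c2 * c1" using X2[OF x1] X1 by simp
    have XXX: "cf (i + 3) (X (X (X (f i)))) = c3 * c2 * c1" using X3[OF x2] XX by simp
    have "cf (i + 2) (X (Y (X (f i)))) = c2 * (\<theta>s (i + 1) * c1)"
      using X2[OF y1] cf_Y[of "i + 1" "X (f i)"] X1 i by simp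
    hence "cf (i + 3) (X (X (Y (X (f i))))) = \<theta>s (i + 1) * (c3 * c2 * c1)"
      using X3[OF y3] by simp
    moreover have "cf (i + 3) (X (Y (X (X (f i))))) = \<theta>s (i + 2) * (c3 * c2 * c1)"
      using X3[OF y2] cf_Y[of "i + 2" "X (X (f i))"] XX i by simp
    ultimately have "(\<theta>s (i + 1) - \<theta>s (i + 2)) * (c3 * c2 * c1)
        = cf (i + 3) (X (X (Y (X (f i)))) - X (Y (X (X (f i)))))"
      by (simp add: cf_simps left_diff_distrib)
    also have "\<dots> = a * (\<theta>s i - \<theta>s (i + 3)) * (c3 * c2 * c1)"
      unfolding comm[of "f i"] using i x1[of "i + 3"] x2[of "i + 3"] XXX
      by (simp add: Y_f X.scale cf_simps cf_Y algebra_simps)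
    finally have "(\<theta>s (i + 1) - \<theta>s (i + 2)) * (c3 * c2 * c1)
      = a * (\<theta>s i - \<theta>s (i + 3)) * (c3 * c2 * c1)" .
    moreover have "c3 * c2 * c1 \<noteq> 0" using i C_nonzero by (simp add: c1_def c2_def c3_def)
    ultimately show "\<theta>s (i + 1) - \<theta>s (i + 2) = a * (\<theta>s i - \<theta>s (i + 3))" by simp
  qed
  thus ?thesis using that \<open>a \<noteq> 0\<close> rec by blast
qed

end

section \<open>Arithmetic of the ends of the parameter array\<close>

definition palindromic :: "nat \<Rightarrow> (nat \<Rightarrow> 'k::field) \<Rightarrow> bool" where
  "palindromic d x \<longleftrightarrow> (\<forall>i\<le>d. x i + x (d - i) = x 0 + x d)"

text \<open>The relation \<open>y i = \<alpha> * x i + \<zeta>\<close> with the coefficients eliminated by means of the indices \<open>0\<close> and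
  \<open>d\<close> and the denominators cleared, which makes it symmetric in \<open>x\<close> and \<open>y\<close>.\<close>

definition affinely_related :: "nat \<Rightarrow> (nat \<Rightarrow> 'k::field) \<Rightarrow> (nat \<Rightarrow> 'k) \<Rightarrow> bool" where
  "affinely_related d x y \<longleftrightarrow> (\<forall>i\<le>d. (y i - y 0) * (x d - x 0) = (y d - y 0) * (x i - x 0))"

lemma affine_self_iff:
  fixes x :: "nat \<Rightarrow> 'k::field"
  assumes "x 0 \<noteq> x d"
  shows "(\<forall>i\<le>d. x i = \<xi> * x i + \<zeta>) \<longleftrightarrow> \<xi> = 1 \<and> \<zeta> = 0"
proof
  assume h: "\<forall>i\<le>d. x i = \<xi> * x i + \<zeta>"
  hence h0: "x 0 = \<xi> * x 0 + \<zeta>" and hd: "x d = \<xi> * x d + \<zeta>" by blast+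
  have "x 0 - x d = (\<xi> * x 0 + \<zeta>) - (\<xi> * x d + \<zeta>)" using h0 hd by metis
  hence "(\<xi> - 1) * (x 0 - x d) = 0" by (simp add: algebra_simps)
  hence "\<xi> = 1" using assms by simp
  thus "\<xi> = 1 \<and> \<zeta> = 0" using h0 by simp
qed auto

lemma affine_rev_iff:
  fixes x :: "nat \<Rightarrow> 'k::field"
  assumes "x 0 \<noteq> x d"
  shows "(\<forall>i\<le>d. x i = \<xi> * x (d - i) + \<zeta>) \<longleftrightarrow> \<xi> = -1 \<and> \<zeta> = x 0 + x d \<and> palindromic d x"
proof
  assume h: "\<forall>i\<le>d. x i = \<xi> * x (d - i) + \<zeta>"
  have h0: "x 0 = \<xi> * x d + \<zeta>" using h[rule_format, of 0] by simp
  have hd: "x d = \<xi> * x 0 + \<zeta>" using h[rule_format, of d] by simp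
  have "x 0 - x d = (\<xi> * x d + \<zeta>) - (\<xi> * x 0 + \<zeta>)" using h0 hd by metis
  hence "(\<xi> + 1) * (x 0 - x d) = 0" by (simp add: algebra_simps)
  hence \<xi>: "\<xi> = -1" using assms by (simp add: eq_neg_iff_add_eq_0)
  moreover from this have \<zeta>: "\<zeta> = x 0 + x d" using h0 by (simp add: algebra_simps)
  moreover have "palindromic d x" unfolding palindromic_def
  proof (intro allI impI)
    fix i assume "i \<le> d"
    hence "x i = \<xi> * x (d - i) + \<zeta>" using h by blast
    thus "x i + x (d - i) = x 0 + x d" unfolding \<xi> \<zeta> by (simp add: algebra_simps)
  qed
  ultimately show "\<xi> = -1 \<and> \<zeta> = x 0 + x d \<and> palindromic d x" by blast
next
  assume "\<xi> = -1 \<and> \<zeta> = x 0 + x d \<and> palindromic d x"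
  thus "\<forall>i\<le>d. x i = \<xi> * x (d - i) + \<zeta>" unfolding palindromic_def by (auto simp: eq_diff_eq)
qed

lemma affine_other_iff:
  fixes x y :: "nat \<Rightarrow> 'k::field"
  assumes "x 0 \<noteq> x d"
  defines "\<alpha> \<equiv> (y d - y 0) * inverse (x d - x 0)"
  shows "(\<forall>i\<le>d. y i = \<xi> * x i + \<zeta>) \<longleftrightarrow>
    \<xi> = \<alpha> \<and> \<zeta> = y 0 - \<alpha> * x 0 \<and> affinely_related d x y"
proof -
  have \<alpha>: "\<alpha> * (x d - x 0) = y d - y 0" using assms by (simp add: \<alpha>_def)
  have rel: "(y i - y 0) * (x d - x 0) = (y d - y 0) * (x i - x 0) \<longleftrightarrow> y i = \<alpha> * x i + (y 0 - \<alpha> * x 0)" for i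
  proof -
    have "(y d - y 0) * (x i - x 0) = \<alpha> * (x i - x 0) * (x d - x 0)" unfolding \<alpha>[symmetric] by simp
    hence "(y i - y 0) * (x d - x 0) = (y d - y 0) * (x i - x 0) \<longleftrightarrow> y i - y 0 = \<alpha> * (x i - x 0)"
      using assms(1) by auto
    also have "\<dots> \<longleftrightarrow> y i = \<alpha> * x i + (y 0 - \<alpha> * x 0)" by (auto simp: algebra_simps)
    finally show ?thesis .
  qed
  show ?thesis
  proof
    assume h: "\<forall>i\<le>d. y i = \<xi> * x i + \<zeta>"
    hence h0: "y 0 = \<xi> * x 0 + \<zeta>" and hd: "y d = \<xi> * x d + \<zeta>" by blast+
    have "y d - y 0 = \<xi> * (x d - x 0)" unfolding h0 hd by (simp add: algebra_simps)
    hence "\<xi> = \<alpha>" using \<alpha> assms(1) by (metis eq_iff_diff_eq_0 mult_right_cancel)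
    moreover from this have "\<zeta> = y 0 - \<alpha> * x 0" using h0 by simp
    ultimately show "\<xi> = \<alpha> \<and> \<zeta> = y 0 - \<alpha> * x 0 \<and> affinely_related d x y"
      using h unfolding affinely_related_def rel by blast
  next
    assume h: "\<xi> = \<alpha> \<and> \<zeta> = y 0 - \<alpha> * x 0 \<and> affinely_related d x y"
    hence e: "\<xi> = \<alpha>" "\<zeta> = y 0 - \<alpha> * x 0" by blast+
    show "\<forall>i\<le>d. y i = \<xi> * x i + \<zeta>"
      using h unfolding affinely_related_def rel e by blast
  qed
qed

lemma affine_other_rev_iff:
  fixes x y :: "nat \<Rightarrow> 'k::field"
  assumes "x 0 \<noteq> x d"
  defines "\<alpha> \<equiv> (y d - y 0) * inverse (x d - x 0)"
  shows "(\<forall>i\<le>d. y i = \<xi> * x (d - i) + \<zeta>) \<longleftrightarrow>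
    \<xi> = - \<alpha> \<and> \<zeta> = y d + \<alpha> * x 0 \<and> affinely_related d (\<lambda>i. x (d - i)) y"
proof -
  have \<alpha>: "\<alpha> * (x d - x 0) = y d - y 0" using assms by (simp add: \<alpha>_def)
  have n: "(y d - y 0) * inverse (x (d - d) - x (d - 0)) = - \<alpha>"
    unfolding \<alpha>_def using assms(1) by (simp add: field_simps)
  have z: "y 0 - - \<alpha> * x (d - 0) = y d + \<alpha> * x 0" using \<alpha> by (simp add: algebra_simps)
  show ?thesis using affine_other_iff[of "\<lambda>i. x (d - i)" d y \<xi> \<zeta>] assms(1)
    unfolding n z by (simp add: eq_commute[of "x 0"])
qed

lemma affinely_related_sym:
  assumes "x 0 \<noteq> x d" "y 0 \<noteq> y d"
  shows "affinely_related d x y \<longleftrightarrow> affinely_related d y x"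
  unfolding affinely_related_def by (auto simp: mult.commute eq_commute)

lemma affinely_related_rev:
  fixes x y :: "nat \<Rightarrow> 'k::field"
  assumes "affinely_related d (\<lambda>i. x (d - i)) y"
  shows "affinely_related d x (\<lambda>i. y (d - i))"
  unfolding affinely_related_def
proof (intro allI impI)
  fix i assume i: "i \<le> d"
  have "(y (d - i) - y 0) * (x (d - d) - x (d - 0)) = (y d - y 0) * (x (d - (d - i)) - x (d - 0))"
    using assms i unfolding affinely_related_def by (metis diff_le_self)
  hence h: "(y (d - i) - y 0) * (x 0 - x d) = (y d - y 0) * (x i - x d)" using i by simp
  have "(y (d - i) - y d) * (x d - x 0) = - ((y (d - i) - y 0) * (x 0 - x d)) + (y 0 - y d) * (x d - x 0)"
    by (simp add: algebra_simps)
  also have "\<dots> = (y 0 - y d) * (x i - x 0)" unfolding h by (simp add: algebra_simps)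
  finally show "(y (d - i) - y (d - 0)) * (x d - x 0) = (y (d - d) - y (d - 0)) * (x i - x 0)" by simp
qed

text \<open>The defect of the affine relation solves the recurrence and vanishes at \<open>0\<close> and \<open>d\<close>, so index \<open>1\<close>
  decides.\<close>

lemma recurrent_affinely_related:
  fixes x y :: "nat \<Rightarrow> 'k::field"
  assumes "a \<noteq> 0" "recurrent d a x" "recurrent d a y" "inj_on x {..d}" "d \<ge> 1"
  shows "affinely_related d x y \<longleftrightarrow> (y 1 - y 0) * (x d - x 0) = (y d - y 0) * (x 1 - x 0)"
proof
  assume "affinely_related d x y"
  thus "(y 1 - y 0) * (x d - x 0) = (y d - y 0) * (x 1 - x 0)"
    using assms(5) unfolding affinely_related_def by auto
next
  assume h: "(y 1 - y 0) * (x d - x 0) = (y d - y 0) * (x 1 - x 0)"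
  let ?z = "\<lambda>i. (x d - x 0) * y i + (- (y d - y 0)) * x i + (- (x d - x 0) * y 0 + (y d - y 0) * x 0)"
  have rec: "recurrent d a ?z" by (rule recurrent_lincomb[OF assms(3,2)])
  have z: "?z i = (y i - y 0) * (x d - x 0) - (y d - y 0) * (x i - x 0)" for i
    by (simp add: algebra_simps)
  have "?z i = 0" if "i \<le> d" for i
    by (rule recurrent_unique[OF assms(1) rec assms(2,4) _ _ _ that])
       (unfold z, use h in simp_all)
  thus "affinely_related d x y" unfolding affinely_related_def z by auto
qed

lemma recurrent_palindromic:
  fixes x :: "nat \<Rightarrow> 'k::field"
  assumes "a \<noteq> 0" "recurrent d a x" "inj_on x {..d}" "d \<ge> 1"
  shows "palindromic d x \<longleftrightarrow> x 0 - x 1 = x (d - 1) - x d"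
proof -
  have 0: "x 0 \<noteq> x d" using assms(3,4) by (auto simp: inj_on_def)
  have "affinely_related d x (\<lambda>i. x (d - i)) \<longleftrightarrow>
    (x (d - 1) - x d) * (x d - x 0) = (x 0 - x d) * (x 1 - x 0)"
    using recurrent_affinely_related[OF assms(1,2) recurrent_rev[OF assms(2)] assms(3,4)] by simp
  also have "\<dots> \<longleftrightarrow> x 0 - x 1 = x (d - 1) - x d"
  proof -
    have "(x 0 - x d) * (x 1 - x 0) = (x 0 - x 1) * (x d - x 0)" by (simp add: algebra_simps)
    thus ?thesis using 0 by auto
  qed
  finally have "affinely_related d x (\<lambda>i. x (d - i)) \<longleftrightarrow> x 0 - x 1 = x (d - 1) - x d" .
  moreover have "affinely_related d x (\<lambda>i. x (d - i)) \<longleftrightarrow> palindromic d x"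
  proof -
    have "(x (d - i) - x d) * (x d - x 0) = (x 0 - x d) * (x i - x 0) \<longleftrightarrow> x i + x (d - i) = x 0 + x d" for i
    proof -
      have "(x 0 - x d) * (x i - x 0) = (x 0 - x i) * (x d - x 0)" by (simp add: algebra_simps)
      hence "(x (d - i) - x d) * (x d - x 0) = (x 0 - x d) * (x i - x 0) \<longleftrightarrow> x (d - i) - x d = x 0 - x i"
        using 0 by auto
      thus ?thesis by (auto simp: algebra_simps)
    qed
    thus ?thesis unfolding affinely_related_def palindromic_def by simp
  qed
  ultimately show ?thesis by simp
qed

text \<open>The numerical data of a Leonard system: \<open>s0\<close> and \<open>sd\<close> are the end diagonal entries of \<open>As\<close> in the
  eigenbasis of \<open>A\<close>, and \<open>a0\<close> and \<open>ad\<close> those of \<open>A\<close> in the eigenbasis of \<open>As\<close>. Each corner identity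
  equates two expressions for one end entry of the parameter array.\<close>

locale leonard_scalars =
  fixes d :: nat and \<theta> \<theta>s :: "nat \<Rightarrow> 'k::field" and s0 sd a0 ad c :: 'k
  assumes d_pos: "d \<ge> 1" and inj: "inj_on \<theta> {..d}" and injs: "inj_on \<theta>s {..d}"
    and c: "c \<noteq> 0" and rec: "recurrent d c \<theta>" and recs: "recurrent d c \<theta>s"
    and corner_00: "(\<theta>s 0 - \<theta>s 1) * (a0 - \<theta> 0) = (\<theta> 0 - \<theta> 1) * (s0 - \<theta>s 0)"
    and corner_d0: "(\<theta>s 0 - \<theta>s 1) * (a0 - \<theta> d) = (\<theta> d - \<theta> (d - 1)) * (sd - \<theta>s 0)"
    and corner_0d: "(\<theta>s d - \<theta>s (d - 1)) * (ad - \<theta> 0) = (\<theta> 0 - \<theta> 1) * (s0 - \<theta>s d)"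
    and corner_dd: "(\<theta>s d - \<theta>s (d - 1)) * (ad - \<theta> d) = (\<theta> d - \<theta> (d - 1)) * (sd - \<theta>s d)"
begin

definition "varphi_1 = (\<theta> 0 - \<theta> 1) * (s0 - \<theta>s 0)"
definition "phi_1 = (\<theta> d - \<theta> (d - 1)) * (sd - \<theta>s 0)"
definition "phi_d = (\<theta> 0 - \<theta> 1) * (s0 - \<theta>s d)"
definition "varphi_d = (\<theta> d - \<theta> (d - 1)) * (sd - \<theta>s d)"

lemma neq: "\<theta> 0 \<noteq> \<theta> d" "\<theta> 0 \<noteq> \<theta> 1" "\<theta> d \<noteq> \<theta> (d - 1)"
  and neqs: "\<theta>s 0 \<noteq> \<theta>s d" "\<theta>s 0 \<noteq> \<theta>s 1" "\<theta>s d \<noteq> \<theta>s (d - 1)"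
  using d_pos by (auto simp: inj_on_eq_iff[OF inj] inj_on_eq_iff[OF injs])

lemma swap: "leonard_scalars d \<theta>s \<theta> a0 ad s0 sd c"
  by unfold_locales
     (rule d_pos inj injs c rec recs corner_00[symmetric] corner_0d[symmetric]
        corner_d0[symmetric] corner_dd[symmetric])+

lemma palindromic_iff: "palindromic d \<theta> \<longleftrightarrow> \<theta> 0 - \<theta> 1 = \<theta> (d - 1) - \<theta> d"
  by (rule recurrent_palindromic[OF c rec inj d_pos])

lemma palindromic_snd_iff: "palindromic d \<theta>s \<longleftrightarrow> \<theta>s 0 - \<theta>s 1 = \<theta>s (d - 1) - \<theta>s d"
  by (rule recurrent_palindromic[OF c recs injs d_pos])

lemma varphi_1_alt: "varphi_1 = (\<theta>s 0 - \<theta>s 1) * (a0 - \<theta> 0)" by (simp only: varphi_1_def corner_00)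
lemma phi_1_alt: "phi_1 = (\<theta>s 0 - \<theta>s 1) * (a0 - \<theta> d)" by (simp only: phi_1_def corner_d0)
lemma phi_d_alt: "phi_d = (\<theta>s d - \<theta>s (d - 1)) * (ad - \<theta> 0)" by (simp only: phi_d_def corner_0d)
lemma varphi_d_alt: "varphi_d = (\<theta>s d - \<theta>s (d - 1)) * (ad - \<theta> d)" by (simp only: varphi_d_def corner_dd)

text \<open>Both \<open>phi_1\<close> and \<open>phi_d\<close> differ from \<open>varphi_1\<close> by a product of eigenvalue differences, one for each
  of the two expressions of \<open>varphi_1\<close>. Equality of these products is the affine relation at index \<open>1\<close>.\<close>

lemma affinely_related_iff: "affinely_related d \<theta> \<theta>s \<longleftrightarrow> phi_1 = phi_d"
proof -
  have "phi_1 = varphi_1 + (\<theta>s 1 - \<theta>s 0) * (\<theta> d - \<theta> 0)" unfolding phi_1_alt varphi_1_alt by (simp add: algebra_simps)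
  moreover have "phi_d = varphi_1 + (\<theta>s d - \<theta>s 0) * (\<theta> 1 - \<theta> 0)" unfolding phi_d_def varphi_1_def by (simp add: algebra_simps)
  ultimately show ?thesis by (simp add: recurrent_affinely_related[OF c rec recs inj d_pos])
qed

lemma affinely_related_rev_iff: "affinely_related d (\<lambda>i. \<theta> (d - i)) \<theta>s \<longleftrightarrow> varphi_1 = varphi_d"
proof -
  have inj': "inj_on (\<lambda>i. \<theta> (d - i)) {..d}" using inj unfolding inj_on_def
    by (metis atMost_iff diff_diff_cancel diff_le_self)
  have "varphi_1 = phi_1 + (\<theta>s 1 - \<theta>s 0) * (\<theta> 0 - \<theta> d)" unfolding phi_1_alt varphi_1_alt by (simp add: algebra_simps)
  moreover have "varphi_d = phi_1 + (\<theta>s d - \<theta>s 0) * (\<theta> (d - 1) - \<theta> d)" unfolding varphi_d_def phi_1_def by (simp add: algebra_simps)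
  ultimately show ?thesis
    using recurrent_affinely_related[OF c recurrent_rev[OF rec] recs inj' d_pos] by simp
qed

text \<open>The conditions under which reversing the ordering of \<open>\<theta>\<close> can be undone by an affine map of \<open>A\<close>;
  the next two lemmas treat reversal of \<open>\<theta>s\<close> and of both. In each of them, subtracting the
  equations between the end entries eliminates the diagonal entries and leaves the symmetry at
  index \<open>1\<close>; what the equations say beyond that is the condition on \<open>sd\<close>.\<close>

lemma reversal_fst_iff: "palindromic d \<theta> \<and> sd = s0 \<longleftrightarrow> varphi_1 = - phi_1 \<and> varphi_d = - phi_d"
proof
  assume h: "palindromic d \<theta> \<and> sd = s0"
  hence e: "\<theta> d - \<theta> (d - 1) = - (\<theta> 0 - \<theta> 1)" unfolding palindromic_iff by (simp add: algebra_simps)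
  show "varphi_1 = - phi_1 \<and> varphi_d = - phi_d" unfolding varphi_1_def phi_1_def varphi_d_def phi_d_def e using h by (simp only: mult_minus_left minus_minus simp_thms)
next
  assume h: "varphi_1 = - phi_1 \<and> varphi_d = - phi_d"
  have "(\<theta> 0 - \<theta> 1) * (\<theta>s d - \<theta>s 0) = varphi_1 - phi_d" by (simp add: varphi_1_def phi_d_def algebra_simps)
  also have "\<dots> = varphi_d - phi_1" using h by simp
  also have "\<dots> = (\<theta> (d - 1) - \<theta> d) * (\<theta>s d - \<theta>s 0)" by (simp add: varphi_d_def phi_1_def algebra_simps)
  finally have pal: "palindromic d \<theta>" unfolding palindromic_iff using neqs by auto
  hence e: "\<theta> d - \<theta> (d - 1) = - (\<theta> 0 - \<theta> 1)" unfolding palindromic_iff by (simp add: algebra_simps)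
  have "(\<theta> 0 - \<theta> 1) * (s0 - \<theta>s 0) = (\<theta> 0 - \<theta> 1) * (sd - \<theta>s 0)"
    using h unfolding varphi_1_def phi_1_def e by (simp only: mult_minus_left minus_minus)
  thus "palindromic d \<theta> \<and> sd = s0" using pal neq by simp
qed

lemma reversal_snd_iff: "palindromic d \<theta>s \<and> sd = - sd + (\<theta>s 0 + \<theta>s d) \<longleftrightarrow> varphi_1 = - phi_d \<and> varphi_d = - phi_1"
proof -
  interpret S: leonard_scalars d \<theta>s \<theta> a0 ad s0 sd c by (rule swap)
  have e: "palindromic d \<theta>s \<and> ad = a0 \<longleftrightarrow> varphi_1 = - phi_d \<and> varphi_d = - phi_1"
    using S.reversal_fst_iff unfolding S.varphi_1_def S.phi_1_def S.varphi_d_def S.phi_d_def varphi_1_alt phi_1_alt varphi_d_alt phi_d_alt .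
  have "varphi_d = - phi_1 \<longleftrightarrow> (\<theta> d - \<theta> (d - 1)) * (sd - \<theta>s d) = (\<theta> d - \<theta> (d - 1)) * (\<theta>s 0 - sd)"
    by (auto simp: varphi_d_def phi_1_def algebra_simps)
  also have "\<dots> \<longleftrightarrow> sd - \<theta>s d = \<theta>s 0 - sd" using neq by simp
  also have "\<dots> \<longleftrightarrow> sd = - sd + (\<theta>s 0 + \<theta>s d)" by (auto simp: algebra_simps)
  finally have g: "varphi_d = - phi_1 \<longleftrightarrow> sd = - sd + (\<theta>s 0 + \<theta>s d)" .
  have "ad = a0" if "palindromic d \<theta>s" "varphi_d = - phi_1"
  proof -
    have e: "\<theta>s d - \<theta>s (d - 1) = - (\<theta>s 0 - \<theta>s 1)"
      using that(1) unfolding palindromic_snd_iff by (simp add: algebra_simps)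
    have "(\<theta>s 0 - \<theta>s 1) * (ad - \<theta> d) = (\<theta>s 0 - \<theta>s 1) * (a0 - \<theta> d)"
      using that(2) unfolding varphi_d_alt phi_1_alt e by (simp only: mult_minus_left neg_equal_iff_equal)
    thus ?thesis using neqs by simp
  qed
  thus ?thesis using e g by blast
qed

lemma reversal_both_iff: "palindromic d \<theta> \<and> palindromic d \<theta>s \<and> sd = - s0 + (\<theta>s 0 + \<theta>s d)
  \<longleftrightarrow> varphi_1 = varphi_d \<and> phi_1 = phi_d"
proof
  assume h: "palindromic d \<theta> \<and> palindromic d \<theta>s \<and> sd = - s0 + (\<theta>s 0 + \<theta>s d)"
  hence e: "\<theta> d - \<theta> (d - 1) = - (\<theta> 0 - \<theta> 1)" unfolding palindromic_iff by (simp add: algebra_simps)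
  have s: "sd = - s0 + (\<theta>s 0 + \<theta>s d)" using h by blast
  show "varphi_1 = varphi_d \<and> phi_1 = phi_d" unfolding varphi_1_def phi_1_def varphi_d_def phi_d_def e unfolding s by (simp add: algebra_simps)
next
  assume h: "varphi_1 = varphi_d \<and> phi_1 = phi_d"
  have "(\<theta> 0 - \<theta> 1) * (\<theta>s d - \<theta>s 0) = varphi_1 - phi_d" by (simp add: varphi_1_def phi_d_def algebra_simps)
  also have "\<dots> = varphi_d - phi_1" using h by simp
  also have "\<dots> = (\<theta> (d - 1) - \<theta> d) * (\<theta>s d - \<theta>s 0)" by (simp add: varphi_d_def phi_1_def algebra_simps)
  finally have pal: "palindromic d \<theta>" unfolding palindromic_iff using neqs by auto
  have "(\<theta>s 0 - \<theta>s 1) * (\<theta> d - \<theta> 0) = varphi_1 - phi_1" by (simp add: varphi_1_alt phi_1_alt algebra_simps)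
  also have "\<dots> = varphi_d - phi_d" using h by simp
  also have "\<dots> = (\<theta>s (d - 1) - \<theta>s d) * (\<theta> d - \<theta> 0)" by (simp add: varphi_d_alt phi_d_alt algebra_simps)
  finally have pals: "palindromic d \<theta>s" unfolding palindromic_snd_iff using neq by auto
  have e: "\<theta> d - \<theta> (d - 1) = - (\<theta> 0 - \<theta> 1)" using pal unfolding palindromic_iff by (simp add: algebra_simps)
  have "(\<theta> 0 - \<theta> 1) * (s0 - \<theta>s 0) = (\<theta> 0 - \<theta> 1) * (\<theta>s d - sd)"
    using h unfolding varphi_1_def varphi_d_def e by (simp add: algebra_simps)
  hence "s0 - \<theta>s 0 = \<theta>s d - sd" using neq by simp
  thus "palindromic d \<theta> \<and> palindromic d \<theta>s \<and> sd = - s0 + (\<theta>s 0 + \<theta>s d)"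
    using pal pals by (auto simp: algebra_simps)
qed

definition "\<alpha> = (\<theta>s d - \<theta>s 0) * inverse (\<theta> d - \<theta> 0)"

lemma \<alpha>_nonzero: "\<alpha> \<noteq> 0" using neq neqs by (simp add: \<alpha>_def)
lemma \<alpha>: "\<alpha> * (\<theta> d - \<theta> 0) = \<theta>s d - \<theta>s 0" using neq by (simp add: \<alpha>_def)

lemma inverse_\<alpha>: "inverse \<alpha> = (\<theta> d - \<theta> 0) * inverse (\<theta>s d - \<theta>s 0)"
  by (simp add: \<alpha>_def)

lemma ad_eq_iff: "ad = inverse \<alpha> * y + (\<theta> 0 - inverse \<alpha> * z) \<longleftrightarrow> \<alpha> * (ad - \<theta> 0) = y - z"
proof -
  have "ad = inverse \<alpha> * y + (\<theta> 0 - inverse \<alpha> * z) \<longleftrightarrow> ad - \<theta> 0 = inverse \<alpha> * (y - z)"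
    by (auto simp: algebra_simps)
  also have "\<dots> \<longleftrightarrow> \<alpha> * (ad - \<theta> 0) = \<alpha> * (inverse \<alpha> * (y - z))"
    by (simp only: mult_left_cancel[OF \<alpha>_nonzero])
  also have "\<alpha> * (inverse \<alpha> * (y - z)) = y - z"
    by (simp add: \<alpha>_nonzero mult.assoc[symmetric])
  finally show ?thesis .
qed

lemma ad_eq_iff': "ad = - inverse \<alpha> * y + (\<theta> 0 + inverse \<alpha> * z) \<longleftrightarrow> \<alpha> * (ad - \<theta> 0) = z - y"
  unfolding ad_eq_iff[symmetric] by (simp add: algebra_simps)

lemma aff_dd: "affinely_related d \<theta> \<theta>s \<Longrightarrow> sd - \<theta>s d = \<alpha> * (ad - \<theta> d)"
proof -
  assume "affinely_related d \<theta> \<theta>s"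
  hence h: "\<theta>s i = \<alpha> * \<theta> i + (\<theta>s 0 - \<alpha> * \<theta> 0)" if "i \<le> d" for i
    using affine_other_iff[of \<theta> d \<theta>s \<alpha> "\<theta>s 0 - \<alpha> * \<theta> 0"] neq that unfolding \<alpha>_def by blast
  have "\<theta>s d - \<theta>s (d - 1) = (\<alpha> * \<theta> d + (\<theta>s 0 - \<alpha> * \<theta> 0))
    - (\<alpha> * \<theta> (d - 1) + (\<theta>s 0 - \<alpha> * \<theta> 0))"
    by (rule arg_cong2[where f = minus]) (rule h, simp)+
  hence e: "\<theta>s d - \<theta>s (d - 1) = \<alpha> * (\<theta> d - \<theta> (d - 1))" by (simp add: algebra_simps)
  have "(\<theta> d - \<theta> (d - 1)) * (sd - \<theta>s d) = (\<theta> d - \<theta> (d - 1)) * (\<alpha> * (ad - \<theta> d))"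
    unfolding corner_dd[symmetric] e by (simp only: mult_ac)
  thus ?thesis using neq by simp
qed

lemma antiaff_0d: "affinely_related d (\<lambda>i. \<theta> (d - i)) \<theta>s \<Longrightarrow> \<alpha> * (ad - \<theta> 0) = \<theta>s d - s0"
proof -
  assume "affinely_related d (\<lambda>i. \<theta> (d - i)) \<theta>s"
  hence h: "\<theta>s i = - \<alpha> * \<theta> (d - i) + (\<theta>s d + \<alpha> * \<theta> 0)" if "i \<le> d" for i
    using affine_other_rev_iff[of \<theta> d \<theta>s "- \<alpha>" "\<theta>s d + \<alpha> * \<theta> 0"] neq that
    unfolding \<alpha>_def by blast
  have "\<theta>s d - \<theta>s (d - 1) = (- \<alpha> * \<theta> (d - d) + (\<theta>s d + \<alpha> * \<theta> 0))
    - (- \<alpha> * \<theta> (d - (d - 1)) + (\<theta>s d + \<alpha> * \<theta> 0))"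
    by (rule arg_cong2[where f = minus]) (rule h, simp)+
  hence e: "\<theta>s d - \<theta>s (d - 1) = - \<alpha> * (\<theta> 0 - \<theta> 1)" using d_pos by (simp add: algebra_simps)
  have "(\<theta> 0 - \<theta> 1) * (s0 - \<theta>s d) = (\<theta> 0 - \<theta> 1) * (- \<alpha> * (ad - \<theta> 0))"
    unfolding corner_0d[symmetric] e by (simp only: mult_ac)
  moreover have "\<theta> 0 - \<theta> 1 \<noteq> 0" using neq by simp
  ultimately have x: "s0 - \<theta>s d = - \<alpha> * (ad - \<theta> 0)" using mult_left_cancel by blast
  have "\<theta>s d - s0 = - (s0 - \<theta>s d)" by simp
  thus "\<alpha> * (ad - \<theta> 0) = \<theta>s d - s0" unfolding x by simp
qed

text \<open>The condition under which \<open>(As, A)\<close> matches the affine image of \<open>(A, As)\<close> with both orderings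
  kept; the three lemmas after it treat the cases where orderings are reversed. The condition on
  \<open>ad\<close> is a consequence of the affine relation when both or none of the orderings are reversed, and
  an extra equation \<open>varphi_1 = - phi_1\<close> otherwise.\<close>

lemma duality_iff: "affinely_related d \<theta> \<theta>s \<and> ad = inverse \<alpha> * sd + (\<theta> 0 - inverse \<alpha> * \<theta>s 0) \<longleftrightarrow> phi_1 = phi_d"
proof -
  have "ad = inverse \<alpha> * sd + (\<theta> 0 - inverse \<alpha> * \<theta>s 0)" if "affinely_related d \<theta> \<theta>s"
  proof -
    have "\<alpha> * (ad - \<theta> 0) = \<alpha> * (ad - \<theta> d) + \<alpha> * (\<theta> d - \<theta> 0)" by (simp add: algebra_simps)
    thus ?thesis unfolding ad_eq_iff aff_dd[OF that, symmetric] \<alpha> by simp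
  qed
  thus ?thesis using affinely_related_iff by blast
qed

lemma duality_reversal_both_iff: "affinely_related d (\<lambda>i. \<theta> (d - i)) \<theta>s \<and> ad = - inverse \<alpha> * s0 + (\<theta> 0 + inverse \<alpha> * \<theta>s d)
  \<longleftrightarrow> varphi_1 = varphi_d"
proof -
  have "ad = - inverse \<alpha> * s0 + (\<theta> 0 + inverse \<alpha> * \<theta>s d)" if "affinely_related d (\<lambda>i. \<theta> (d - i)) \<theta>s"
  proof -
    show ?thesis unfolding ad_eq_iff' by (rule antiaff_0d[OF that])
  qed
  thus ?thesis using affinely_related_rev_iff by blast
qed

lemma duality_reversal_fst_iff: "affinely_related d (\<lambda>i. \<theta> (d - i)) \<theta>s \<and> affinely_related d \<theta> \<theta>s
    \<and> ad = inverse \<alpha> * s0 + (\<theta> 0 - inverse \<alpha> * \<theta>s 0)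
  \<longleftrightarrow> varphi_1 = varphi_d \<and> phi_1 = phi_d \<and> varphi_1 = - phi_1"
proof -
  have "ad = inverse \<alpha> * s0 + (\<theta> 0 - inverse \<alpha> * \<theta>s 0) \<longleftrightarrow> varphi_1 = - phi_d" if "affinely_related d (\<lambda>i. \<theta> (d - i)) \<theta>s"
  proof -
    have "ad = inverse \<alpha> * s0 + (\<theta> 0 - inverse \<alpha> * \<theta>s 0) \<longleftrightarrow> s0 - \<theta>s 0 = - (s0 - \<theta>s d)"
      unfolding ad_eq_iff antiaff_0d[OF that] by (auto simp: algebra_simps)
    also have "\<dots> \<longleftrightarrow> (\<theta> 0 - \<theta> 1) * (s0 - \<theta>s 0) = (\<theta> 0 - \<theta> 1) * (- (s0 - \<theta>s d))"
      using neq by simp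
    also have "\<dots> \<longleftrightarrow> varphi_1 = - phi_d" unfolding varphi_1_def phi_d_def by (simp only: mult_minus_right)
    finally show ?thesis .
  qed
  thus ?thesis using affinely_related_rev_iff affinely_related_iff by auto
qed

lemma duality_reversal_snd_iff: "affinely_related d (\<lambda>i. \<theta> (d - i)) \<theta>s \<and> affinely_related d \<theta> \<theta>s
    \<and> ad = - inverse \<alpha> * sd + (\<theta> 0 + inverse \<alpha> * \<theta>s d)
  \<longleftrightarrow> varphi_1 = varphi_d \<and> phi_1 = phi_d \<and> varphi_1 = - phi_1"
proof -
  have "ad = - inverse \<alpha> * sd + (\<theta> 0 + inverse \<alpha> * \<theta>s d) \<longleftrightarrow> varphi_d = - phi_d"
    if "affinely_related d (\<lambda>i. \<theta> (d - i)) \<theta>s" "affinely_related d \<theta> \<theta>s"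
  proof -
    have "palindromic d \<theta>" using that reversal_both_iff affinely_related_rev_iff affinely_related_iff by auto
    hence e: "\<theta> d - \<theta> (d - 1) = - (\<theta> 0 - \<theta> 1)" unfolding palindromic_iff by (simp add: algebra_simps)
    have nz: "\<theta> 0 - \<theta> 1 \<noteq> 0" using neq by simp
    have "ad = - inverse \<alpha> * sd + (\<theta> 0 + inverse \<alpha> * \<theta>s d) \<longleftrightarrow> s0 - \<theta>s d = sd - \<theta>s d"
      unfolding ad_eq_iff' antiaff_0d[OF that(1)] by auto
    also have "\<dots> \<longleftrightarrow> - (\<theta> 0 - \<theta> 1) * (sd - \<theta>s d) = - ((\<theta> 0 - \<theta> 1) * (s0 - \<theta>s d))"
      using mult_left_cancel[OF nz] by (simp only: mult_minus_left neg_equal_iff_equal) auto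
    also have "\<dots> \<longleftrightarrow> varphi_d = - phi_d" unfolding varphi_d_def phi_d_def e ..
    finally show ?thesis .
  qed
  thus ?thesis using affinely_related_rev_iff affinely_related_iff by auto
qed

end

section \<open>The irreducible module of a matrix algebra\<close>

text \<open>The entry functions of an isomorphism onto the matrix algebra, with indices \<open>0, \<dots>, d\<close> in place of a
  carrier set.\<close>

definition matrix_entries ::
  "nat \<Rightarrow> ('k::field \<Rightarrow> 'a::ring_1 \<Rightarrow> 'a) \<Rightarrow> ('a \<Rightarrow> nat \<Rightarrow> nat \<Rightarrow> 'k) \<Rightarrow> bool" where
  "matrix_entries d sA m \<longleftrightarrow>
     (\<forall>i\<le>d. \<forall>j\<le>d. (\<forall>x y. m (x + y) i j = m x i j + m y i j) \<and>
        (\<forall>c x. m (sA c x) i j = c * m x i j) \<and>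
        (\<forall>x y. m (x * y) i j = (\<Sum>k\<le>d. m x i k * m y k j)) \<and>
        m 1 i j = (if i = j then 1 else 0)) \<and>
     (\<forall>x y. (\<forall>i\<le>d. \<forall>j\<le>d. m x i j = m y i j) \<longrightarrow> x = y) \<and>
     (\<forall>g. \<exists>x. \<forall>i\<le>d. \<forall>j\<le>d. m x i j = g i j)"

lemma matrix_algebra_entries:
  assumes "matrix_algebra d sA"
  shows "\<exists>m. matrix_entries d sA m"
proof -
  obtain \<psi> where bij: "bij_betw \<psi> UNIV (carrier_mat (Suc d) (Suc d))"
    and one: "\<psi> 1 = 1\<^sub>m (Suc d)" and add: "\<And>x y. \<psi> (x + y) = \<psi> x + \<psi> y"
    and mult: "\<And>x y. \<psi> (x * y) = \<psi> x * \<psi> y" and sc: "\<And>c x. \<psi> (sA c x) = c \<cdot>\<^sub>m \<psi> x"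
    using assms unfolding matrix_algebra_def by blast
  have car: "\<psi> x \<in> carrier_mat (Suc d) (Suc d)" for x using bij by (auto simp: bij_betw_def)
  have dims [simp]: "dim_row (\<psi> x) = Suc d" "dim_col (\<psi> x) = Suc d" for x using car[of x] by auto
  have "matrix_entries d sA (\<lambda>x i j. \<psi> x $$ (i, j))"
    unfolding matrix_entries_def
  proof (intro conjI allI impI)
    fix i j x y assume ij: "i \<le> d" "j \<le> d"
    show "\<psi> (x * y) $$ (i, j) = (\<Sum>k\<le>d. \<psi> x $$ (i, k) * \<psi> y $$ (k, j))"
      using ij unfolding mult
      by (simp add: scalar_prod_def atLeast0LessThan lessThan_Suc_atMost)
  next
    fix x y assume h: "\<forall>i\<le>d. \<forall>j\<le>d. \<psi> x $$ (i, j) = \<psi> y $$ (i, j)"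
    have "\<psi> x = \<psi> y" by (rule eq_matI) (use h in auto)
    thus "x = y" using bij by (auto simp: bij_betw_def inj_def)
  next
    fix g
    have "mat (Suc d) (Suc d) (\<lambda>(i, j). g i j) \<in> range \<psi>" using bij by (simp add: bij_betw_def)
    then obtain x where "\<psi> x = mat (Suc d) (Suc d) (\<lambda>(i, j). g i j)" by (metis imageE)
    thus "\<exists>x. \<forall>i\<le>d. \<forall>j\<le>d. \<psi> x $$ (i, j) = g i j" by (intro exI[of _ x]) auto
  qed (auto simp: add sc one)
  thus ?thesis by blast
qed

lemma prod_list_map_one: "(\<Prod>j\<leftarrow>js. 1::'a::monoid_mult) = 1"
  by (induction js) auto

context algebra_module
begin

lemma act_zero_right: "act x 0 = 0"
  using act_add_right[of x 0 0] by simp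

lemma act_zero_left: "act 0 v = 0"
  using act_add_left[of 0 0 v] by simp

lemma act_scale_right: "act x (sV c v) = sV c (act x v)"
proof -
  have "act x (sV c v) = act (x * sA c 1) v" by (simp add: act_mult act_scale act_one)
  also have "x * sA c 1 = sA c x" by (simp add: alg.scale_mult_right)
  finally show ?thesis by (simp add: act_scale)
qed

lemma act_linear: "Vector_Spaces.linear sV sV (act x)"
  unfolding Vector_Spaces.linear_iff
  by (auto simp: vs.vector_space_axioms act_add_right act_scale_right)

lemma act_sum_left: "act (\<Sum>i\<in>S. g i) v = (\<Sum>i\<in>S. act (g i) v)"
  by (induction S rule: infinite_finite_induct) (auto simp: act_add_left act_zero_left)

lemma act_sum_right: "act x (\<Sum>i\<in>S. g i) = (\<Sum>i\<in>S. act x (g i))"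
  by (induction S rule: infinite_finite_induct) (auto simp: act_add_right act_zero_right)

lemma act_diff_left: "act (x - y) v = act x v - act y v"
  using act_add_left[of "x - y" y v] by simp

lemma act_prod_list_eigen:
  assumes "\<And>j. j \<in> set js \<Longrightarrow> act (g j) v = sV (h j) v"
  shows "act (\<Prod>j\<leftarrow>js. g j) v = sV (\<Prod>j\<leftarrow>js. h j) v"
  using assms by (induction js) (auto simp: act_one act_mult act_scale_right mult.commute)

lemma act_primitive_idempotent:
  assumes "act x v = sV (\<theta> k) v" "k \<le> d" "inj_on \<theta> {..d}" "i \<le> d"
  shows "act (primitive_idempotent sA d x \<theta> i) v = (if k = i then v else 0)"
proof -
  let ?js = "filter (\<lambda>j. j \<noteq> i) [0..<Suc d]"
  have "act (primitive_idempotent sA d x \<theta> i) v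
    = sV (\<Prod>j\<leftarrow>?js. (1 / (\<theta> i - \<theta> j)) * (\<theta> k - \<theta> j)) v"
    unfolding primitive_idempotent_def
    by (rule act_prod_list_eigen)
       (simp add: act_scale act_diff_left act_one assms(1) vs.scale_left_diff_distrib[symmetric])
  also have "(\<Prod>j\<leftarrow>?js. (1 / (\<theta> i - \<theta> j)) * (\<theta> k - \<theta> j)) = (if k = i then 1 else 0)"
  proof (cases "k = i")
    case True
    have "map (\<lambda>j. (1 / (\<theta> i - \<theta> j)) * (\<theta> k - \<theta> j)) ?js = map (\<lambda>j. 1) ?js"
    proof (intro map_cong refl)
      fix j assume "j \<in> set ?js"
      hence "j \<le> d" "j \<noteq> i" by (simp_all del: upt_Suc)
      hence "\<theta> i \<noteq> \<theta> j" using assms(3,4) by (auto dest: inj_onD)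
      thus "(1 / (\<theta> i - \<theta> j)) * (\<theta> k - \<theta> j) = 1" using True by simp
    qed
    hence "(\<Prod>j\<leftarrow>?js. (1 / (\<theta> i - \<theta> j)) * (\<theta> k - \<theta> j)) = (\<Prod>j\<leftarrow>?js. 1)" by (simp only:)
    thus ?thesis using True by (simp only: prod_list_map_one if_True simp_thms)
  next
    case False
    hence "k \<in> set ?js" using assms(2) by (simp del: upt_Suc)
    thus ?thesis using False by (auto simp: prod_list_zero_iff simp del: upt_Suc)
  qed
  finally show ?thesis by simp
qed

end

text \<open>Pick \<open>w\<close> with \<open>U 0 0\<close> acting nontrivially, where \<open>U i j\<close> are the matrix units. The vectors
  \<open>U i 0 \<cdot> w\<close> span a submodule, which is everything by irreducibility, and the algebra acts on them by
  the columns of the given entry functions.\<close>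

lemma matrix_unit_basis:
  fixes sA :: "'k::field \<Rightarrow> 'a::ring_1 \<Rightarrow> 'a" and sV :: "'k \<Rightarrow> 'v::ab_group_add \<Rightarrow> 'v"
  assumes "matrix_entries d sA m" "irreducible_module sA sV act"
  shows "\<exists>b. is_ordered_basis sV d b \<and> (\<forall>x. \<forall>j\<le>d. act x (b j) = (\<Sum>i\<le>d. sV (m x i j) (b i)))"
proof -
  interpret algebra_module sA sV act using assms(2) by (simp add: irreducible_module_def)
  have m_add: "m (x + y) i j = m x i j + m y i j"
    and m_sc: "m (sA c x) i j = c * m x i j"
    and m_mult: "m (x * y) i j = (\<Sum>k\<le>d. m x i k * m y k j)"
    and m_one: "m 1 i j = (if i = j then 1 else 0)"
    if "i \<le> d" "j \<le> d" for x y c i j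
    using assms(1) that unfolding matrix_entries_def by blast+
  have m_ext: "x = y" if "\<And>i j. i \<le> d \<Longrightarrow> j \<le> d \<Longrightarrow> m x i j = m y i j" for x y
  proof -
    have "\<forall>x y. (\<forall>i\<le>d. \<forall>j\<le>d. m x i j = m y i j) \<longrightarrow> x = y"
      using assms(1) unfolding matrix_entries_def by (elim conjE)
    thus ?thesis using that by simp
  qed
  have m_surj: "\<exists>x. \<forall>i\<le>d. \<forall>j\<le>d. m x i j = g i j" for g
  proof -
    have "\<forall>g. \<exists>x. \<forall>i\<le>d. \<forall>j\<le>d. m x i j = g i j"
      using assms(1) unfolding matrix_entries_def by (elim conjE)
    thus ?thesis by (rule spec)
  qed
  have m_zero: "m 0 i j = 0" if "i \<le> d" "j \<le> d" for i j
    using m_sc[OF that, of 0 0] by simp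
  have m_sum: "m (\<Sum>k\<in>S. g k) i j = (\<Sum>k\<in>S. m (g k) i j)" if "i \<le> d" "j \<le> d" for S :: "nat set" and g i j
    by (induction S rule: infinite_finite_induct) (auto simp: m_add that m_zero)
  define U where "U k l = (SOME x. \<forall>i\<le>d. \<forall>j\<le>d. m x i j = (if i = k \<and> j = l then 1 else 0))" for k l
  have U: "m (U k l) i j = (if i = k \<and> j = l then 1 else 0)" if "i \<le> d" "j \<le> d" for k l i j
    using someI_ex[OF m_surj[of "\<lambda>i j. if i = k \<and> j = l then 1 else 0"]] that
    unfolding U_def by simp
  have col: "x * U j 0 = (\<Sum>i\<le>d. sA (m x i j) (U i 0))" if j: "j \<le> d" for x j
  proof (rule m_ext)
    fix a c assume ac: "a \<le> d" "c \<le> d"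
    have "m (x * U j 0) a c = (\<Sum>k\<le>d. if k = j then (if c = 0 then m x a j else 0) else 0)"
      unfolding m_mult[OF ac] by (rule sum.cong) (auto simp: U ac)
    also have "\<dots> = (if c = 0 then m x a j else 0)" using j by simp
    also have "\<dots> = (\<Sum>i\<le>d. if i = a then (if c = 0 then m x a j else 0) else 0)" using ac by simp
    also have "\<dots> = m (\<Sum>i\<le>d. sA (m x i j) (U i 0)) a c"
      unfolding m_sum[OF ac] by (rule sum.cong) (auto simp: U m_sc ac)
    finally show "m (x * U j 0) a c = m (\<Sum>i\<le>d. sA (m x i j) (U i 0)) a c" .
  qed
  have one: "1 = (\<Sum>i\<le>d. U i i)"
  proof (rule m_ext)
    fix a c assume ac: "a \<le> d" "c \<le> d"
    have "m (\<Sum>i\<le>d. U i i) a c = (\<Sum>i\<le>d. if i = a then (if a = c then 1 else 0) else 0)"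
      unfolding m_sum[OF ac] by (rule sum.cong) (auto simp: U ac)
    thus "m 1 a c = m (\<Sum>i\<le>d. U i i) a c" using ac by (simp add: m_one)
  qed
  have Uii: "U i i = U i 0 * (U 0 0 * U 0 i)" if i: "i \<le> d" for i
  proof (rule m_ext)
    fix a c assume ac: "a \<le> d" "c \<le> d"
    have "m (U 0 0 * U 0 i) k c = (if k = 0 \<and> c = i then 1 else 0)" if "k \<le> d" for k
    proof -
      have "m (U 0 0 * U 0 i) k c = (\<Sum>l\<le>d. if l = 0 then (if k = 0 \<and> c = i then 1 else 0) else 0)"
        unfolding m_mult[OF that ac(2)] by (rule sum.cong) (auto simp: U ac that)
      thus ?thesis by simp
    qed
    hence "m (U i 0 * (U 0 0 * U 0 i)) a c
      = (\<Sum>k\<le>d. if k = 0 then (if a = i \<and> c = i then 1 else 0) else 0)"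
      unfolding m_mult[OF ac] by (intro sum.cong) (auto simp: U ac)
    thus "m (U i i) a c = m (U i 0 * (U 0 0 * U 0 i)) a c" by (simp add: U ac)
  qed
  obtain w where w: "act (U 0 0) w \<noteq> 0"
  proof -
    obtain v :: 'v where v: "v \<noteq> 0" using assms(2) unfolding irreducible_module_def by blast
    have "\<exists>w. act (U 0 0) w \<noteq> 0"
    proof (rule ccontr)
      assume "\<not> ?thesis"
      hence "act (U i i) v = 0" if "i \<le> d" for i
        by (subst Uii[OF that]) (simp add: act_mult act_zero_right)
      hence "act (\<Sum>i\<le>d. U i i) v = 0" by (simp add: act_sum_left)
      thus False using v act_one[of v] one by simp
    qed
    thus ?thesis using that by blast
  qed
  define b where "b i = act (U i 0) w" for i
  have act_b: "act x (b j) = (\<Sum>i\<le>d. sV (m x i j) (b i))" if "j \<le> d" for x j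
    unfolding b_def act_mult[symmetric] col[OF that] by (simp add: act_sum_left act_scale)
  have ind: "\<forall>i\<le>d. c i = 0" if z: "(\<Sum>i\<le>d. sV (c i) (b i)) = 0" for c
  proof (intro allI impI)
    fix k assume k: "k \<le> d"
    have U0k: "act (U 0 k) (b i) = (if i = k then b 0 else 0)" if i: "i \<le> d" for i
    proof -
      have "act (U 0 k) (b i) = (\<Sum>a\<le>d. if a = 0 then (if i = k then b 0 else 0) else 0)"
        unfolding act_b[OF i] by (rule sum.cong) (auto simp: U i)
      thus ?thesis by simp
    qed
    have "0 = act (U 0 k) (\<Sum>i\<le>d. sV (c i) (b i))" by (simp add: z act_zero_right)
    also have "\<dots> = (\<Sum>i\<le>d. if i = k then sV (c k) (b 0) else 0)"
      unfolding act_sum_right by (rule sum.cong) (auto simp: act_scale_right U0k)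
    also have "\<dots> = sV (c k) (b 0)" using k by simp
    finally show "c k = 0" using w by (simp add: b_def)
  qed
  let ?W = "module.span sV (b ` {..d})"
  have "?W = {0} \<or> ?W = UNIV"
  proof -
    have "act x u \<in> ?W" if "u \<in> ?W" for x u
      using that
    proof (induction rule: vs.span_induct)
      case base
      show ?case
        by (auto simp: vs.subspace_def act_zero_right act_add_right act_scale_right
            intro: vs.span_zero vs.span_add vs.span_scale)
    next
      case (step u)
      then obtain j where j: "j \<le> d" "u = b j" by auto
      show ?case unfolding j(2) act_b[OF j(1)]
        by (rule vs.span_sum, rule vs.span_scale, rule vs.span_base) simp
    qed
    thus ?thesis using assms(2) vs.subspace_span unfolding irreducible_module_def by blast
  qed
  moreover have "b 0 \<in> ?W" by (rule vs.span_base) auto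
  ultimately have "?W = UNIV" using w by (auto simp: b_def)
  hence "is_ordered_basis sV d b"
    using vs.independent_family[OF ind] unfolding is_ordered_basis_def by simp
  thus ?thesis using act_b by blast
qed

text \<open>An irreducible module of a matrix algebra identifies the algebra with all linear maps.\<close>

locale full_module = algebra_module sA sV act
  for sA :: "'k::field \<Rightarrow> 'a::ring_1 \<Rightarrow> 'a" and sV :: "'k \<Rightarrow> 'v::ab_group_add \<Rightarrow> 'v"
    and act :: "'a \<Rightarrow> 'v \<Rightarrow> 'v" +
  fixes d :: nat and b :: "nat \<Rightarrow> 'v"
  assumes b: "is_ordered_basis sV d b"
    and faithful: "act x = act y \<Longrightarrow> x = y"
    and full: "Vector_Spaces.linear sV sV F \<Longrightarrow> \<exists>x. act x = F"

lemma full_module: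
  fixes sA :: "'k::field \<Rightarrow> 'a::ring_1 \<Rightarrow> 'a"
  assumes "matrix_algebra d sA" "irreducible_module sA sV act"
  obtains b where "full_module sA sV act d b"
proof -
  obtain m where m: "matrix_entries d sA m" using matrix_algebra_entries[OF assms(1)] by blast
  have m_ext: "x = y" if "\<And>i j. i \<le> d \<Longrightarrow> j \<le> d \<Longrightarrow> m x i j = m y i j" for x y
  proof -
    have "\<forall>x y. (\<forall>i\<le>d. \<forall>j\<le>d. m x i j = m y i j) \<longrightarrow> x = y"
      using m unfolding matrix_entries_def by (elim conjE)
    thus ?thesis using that by simp
  qed
  have m_surj: "\<exists>x. \<forall>i\<le>d. \<forall>j\<le>d. m x i j = g i j" for g
  proof -
    have "\<forall>g. \<exists>x. \<forall>i\<le>d. \<forall>j\<le>d. m x i j = g i j"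
      using m unfolding matrix_entries_def by (elim conjE)
    thus ?thesis by (rule spec)
  qed
  obtain b where b: "is_ordered_basis sV d b"
    and act_b: "\<And>x j. j \<le> d \<Longrightarrow> act x (b j) = (\<Sum>i\<le>d. sV (m x i j) (b i))"
    using matrix_unit_basis[OF m assms(2)] by blast
  interpret algebra_module sA sV act using assms(2) by (simp add: irreducible_module_def)
  have m_coord: "m x i j = coord sV d b i (act x (b j))" if "i \<le> d" "j \<le> d" for x i j
  proof -
    have "coord sV d b i (act x (b j)) = (\<Sum>k\<le>d. if k = i then m x i j else 0)"
      unfolding act_b[OF that(2)] vs.coord_sum[OF b]
      by (rule sum.cong) (auto simp: vs.coord_scale[OF b] vs.coord_basis[OF b] that)
    thus ?thesis using that by simp
  qed
  have "full_module sA sV act d b"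
  proof
    show "is_ordered_basis sV d b" by (rule b)
    show "x = y" if "act x = act y" for x y by (rule m_ext) (simp add: m_coord that)
    show "\<exists>x. act x = F" if F: "Vector_Spaces.linear sV sV F" for F
    proof -
      obtain x where x: "\<forall>i\<le>d. \<forall>j\<le>d. m x i j = coord sV d b i (F (b j))"
        using m_surj[of "\<lambda>i j. coord sV d b i (F (b j))"] by blast
      have "act x (b j) = F (b j)" if "j \<le> d" for j
        by (rule vs.coord_eqI[OF b]) (simp only: m_coord[OF _ that, symmetric] x that)
      hence "act x = F" by (intro vs.linear_eq_on_ordered_basis[OF act_linear F b])
      thus ?thesis by blast
    qed
  qed
  thus ?thesis by (rule that)
qed

section \<open>From Leonard systems to eigenbases and parameters\<close>

text \<open>Injectivity forbids turning back, so consecutive steps have the same sign; the range leaves room only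
  for starting at an end.\<close>

lemma path_permutation:
  assumes inj: "inj_on p {..d}" and range: "\<And>i. i \<le> d \<Longrightarrow> p i \<le> (d::nat)"
    and step: "\<And>i. i < d \<Longrightarrow> \<bar>int (p i) - int (p (Suc i))\<bar> = 1"
  shows "(\<forall>i\<le>d. p i = i) \<or> (\<forall>i\<le>d. p i = d - i)"
proof (cases "d = 0")
  case True
  thus ?thesis using range by auto
next
  case False
  define s where "s = int (p 1) - int (p 0)"
  have s: "s = 1 \<or> s = -1" using step[of 0] False unfolding s_def by auto
  have lin: "i \<le> d \<Longrightarrow> int (p i) = int (p 0) + s * int i" for i
  proof (induction i rule: less_induct)
    case (less i)
    consider "i = 0" | "i = 1" | j where "i = Suc (Suc j)"
      by (metis One_nat_def not0_implies_Suc)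
    thus ?case
    proof cases
      case 3
      have IH: "int (p j) = int (p 0) + s * int j" "int (p (Suc j)) = int (p 0) + s * int (Suc j)"
        using less.IH[of j] less.IH[of "Suc j"] less.prems 3 by simp_all
      have "p (Suc (Suc j)) \<noteq> p j" using inj less.prems 3 by (auto dest: inj_onD)
      moreover have "\<bar>int (p (Suc j)) - int (p (Suc (Suc j)))\<bar> = 1"
        using step[of "Suc j"] less.prems 3 by simp
      ultimately have "int (p (Suc (Suc j))) = int (p (Suc j)) + s"
        using IH s by (auto simp: algebra_simps)
      thus ?thesis using IH(2) 3 by (simp add: algebra_simps)
    qed (simp_all add: s_def)
  qed
  show ?thesis
  proof (cases "s = 1")
    case True
    hence "p 0 = 0" using lin[of d] range[of d] by simp
    thus ?thesis using lin True by auto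
  next
    case F: False
    hence s': "s = -1" using s by simp
    have "p 0 = d" using lin[of d] range[of 0] s' by simp
    hence "p i = d - i" if "i \<le> d" for i using lin[OF that] s' that by simp
    thus ?thesis by blast
  qed
qed

context full_module
begin

lemma act_minus_scalar: "act (x - sA t 1) v = act x v - sV t v"
  by (simp add: act_diff_left act_scale act_one)

lemma act_affine: "act (sA \<xi> x + sA \<zeta> 1) = (\<lambda>v. sV \<xi> (act x v) + sV \<zeta> v)"
  by (simp add: fun_eq_iff act_add_left act_scale act_one)

text \<open>The idempotents separate any choice of eigenvectors, which proves independence and identifies
  \<open>E i\<close> with the coordinate projection.\<close>

lemma eigenbasis:
  assumes "idempotents_for sA sV act d x E \<theta>"
  obtains e where "is_ordered_basis sV d e" "inj_on \<theta> {..d}"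
    "\<And>i. i \<le> d \<Longrightarrow> act x (e i) = sV (\<theta> i) (e i)"
    "\<And>i v. i \<le> d \<Longrightarrow> act (E i) v = sV (coord sV d e i v) (e i)"
proof -
  have inj: "inj_on \<theta> {..d}" and eig: "\<And>i. i \<le> d \<Longrightarrow> is_eigenvalue sV act x (\<theta> i)"
    and E: "\<And>i. i \<le> d \<Longrightarrow> E i = primitive_idempotent sA d x \<theta> i"
    using assms unfolding idempotents_for_def eigenvalue_ordering_def bij_betw_def by auto
  define e where "e i = (SOME v. v \<noteq> 0 \<and> act x v = sV (\<theta> i) v)" for i
  have e: "e i \<noteq> 0" "act x (e i) = sV (\<theta> i) (e i)" if "i \<le> d" for i
    using someI_ex[OF eig[OF that, unfolded is_eigenvalue_def]] unfolding e_def by auto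
  have Ee: "act (E i) (e k) = (if k = i then e k else 0)" if "i \<le> d" "k \<le> d" for i k
    unfolding E[OF that(1)] by (rule act_primitive_idempotent[where \<theta> = \<theta> and k = k]) (use e that inj in auto)
  have Esum: "act (E i) (\<Sum>k\<le>d. sV (c k) (e k)) = sV (c i) (e i)" if i: "i \<le> d" for i c
  proof -
    have "act (E i) (\<Sum>k\<le>d. sV (c k) (e k)) = (\<Sum>k\<le>d. if k = i then sV (c i) (e i) else 0)"
      unfolding act_sum_right by (rule sum.cong) (auto simp: act_scale_right Ee i)
    thus ?thesis using i by simp
  qed
  have be: "is_ordered_basis sV d e"
  proof (rule vs.ordered_basisI[OF b], intro allI impI)
    fix c i assume z: "(\<Sum>k\<le>d. sV (c k) (e k)) = 0" and i: "i \<le> d"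
    have "sV (c i) (e i) = 0" using Esum[OF i, of c] unfolding z by (simp add: act_zero_right)
    thus "c i = 0" using e[OF i] by simp
  qed
  moreover have "act (E i) v = sV (coord sV d e i v) (e i)" if "i \<le> d" for i v
    using Esum[OF that, of "\<lambda>k. coord sV d e k v"] vs.coord_expand[OF be, of v] by simp
  ultimately show ?thesis using that inj e by blast
qed

lemma sandwich_zero_iff:
  assumes e: "is_ordered_basis sV d e"
    and P: "\<And>v. act P v = sV (coord sV d e i v) (e i)"
    and Q: "\<And>v. act Q v = sV (coord sV d e j v) (e j)"
    and ij: "i \<le> d" "j \<le> d"
  shows "P * y * Q = 0 \<longleftrightarrow> coord sV d e i (act y (e j)) = 0"
proof -
  have PyQ: "act (P * y * Q) v = sV (coord sV d e j v * coord sV d e i (act y (e j))) (e i)" for v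
    by (simp add: act_mult P Q act_scale_right vs.coord_scale[OF e])
  show ?thesis
  proof
    assume "P * y * Q = 0"
    hence "sV (coord sV d e i (act y (e j))) (e i) = 0"
      using PyQ[of "e j"] ij by (simp add: vs.coord_basis[OF e] act_zero_left)
    hence "coord sV d e i (sV (coord sV d e i (act y (e j))) (e i)) = 0"
      by (simp only: vs.coord_zero)
    thus "coord sV d e i (act y (e j)) = 0"
      using ij by (simp only: vs.coord_scale[OF e] vs.coord_basis[OF e]) simp
  next
    assume "coord sV d e i (act y (e j)) = 0"
    thus "P * y * Q = 0" by (intro faithful ext) (simp add: PyQ act_zero_left)
  qed
qed

lemma leonard_system_frame:
  assumes "leonard_system sA sV act d (A, E, As, Es)" "d \<ge> 1"
    "idempotents_for sA sV act d A E \<theta>" "idempotents_for sA sV act d As Es \<theta>s"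
  obtains e f where "leonard_frame sV d (act A) (act As) e f \<theta> \<theta>s"
    "\<And>v. act (Es 0) v = sV (coord sV d f 0 v) (f 0)"
proof -
  obtain e where e: "is_ordered_basis sV d e" "inj_on \<theta> {..d}"
    "\<And>i. i \<le> d \<Longrightarrow> act A (e i) = sV (\<theta> i) (e i)"
    "\<And>i v. i \<le> d \<Longrightarrow> act (E i) v = sV (coord sV d e i v) (e i)"
    by (rule eigenbasis[OF assms(3)]) blast
  obtain f where f: "is_ordered_basis sV d f" "inj_on \<theta>s {..d}"
    "\<And>i. i \<le> d \<Longrightarrow> act As (f i) = sV (\<theta>s i) (f i)"
    "\<And>i v. i \<le> d \<Longrightarrow> act (Es i) v = sV (coord sV d f i v) (f i)"
    by (rule eigenbasis[OF assms(4)]) blast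
  have tri: "(\<bar>int i - int j\<bar> > 1 \<longrightarrow> E i * As * E j = 0 \<and> Es i * A * Es j = 0) \<and>
        (\<bar>int i - int j\<bar> = 1 \<longrightarrow> E i * As * E j \<noteq> 0 \<and> Es i * A * Es j \<noteq> 0)"
    if "i \<le> d" "j \<le> d" for i j
    using assms(1) that unfolding leonard_system_def by simp
  have "leonard_frame sV d (act A) (act As) e f \<theta> \<theta>s"
  proof (intro leonard_frame.intro leonard_frame_axioms.intro vs.vector_space_axioms)
    show "irred_tridiagonal d (\<lambda>i j. coord sV d e i (act As (e j)))"
      unfolding irred_tridiagonal_def
      using tri sandwich_zero_iff[OF e(1) e(4) e(4)] by blast
    show "irred_tridiagonal d (\<lambda>i j. coord sV d f i (act A (f j)))"
      unfolding irred_tridiagonal_def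
      using tri sandwich_zero_iff[OF f(1) f(4) f(4)] by blast
  qed (use assms(2) e f act_linear in auto)
  thus ?thesis using that f(4) by blast
qed

text \<open>The trace is taken in an unspecified basis; for a map of rank one the basis cancels.\<close>

lemma alg_trace_rank_one:
  assumes "\<And>v. act P v = sV (g v) w" "Vector_Spaces.linear sV (*) g"
  shows "alg_trace sV act d (P * z) = g (act z w)"
proof -
  define v where "v = (SOME v. is_ordered_basis sV d v)"
  have v: "is_ordered_basis sV d v" unfolding v_def by (rule someI[of _ b]) (rule b)
  interpret g: Vector_Spaces.linear sV "(*)" g by fact
  have "alg_trace sV act d (P * z) = (\<Sum>i\<le>d. coord sV d v i (act (P * z) (v i)))"
    unfolding alg_trace_def v_def[symmetric] matrix_rep_def coord_def by simp
  also have "\<dots> = (\<Sum>i\<le>d. coord sV d v i w * g (act z (v i)))"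
    by (simp add: act_mult assms(1) vs.coord_scale[OF v] mult.commute)
  also have "\<dots> = g (act z (\<Sum>i\<le>d. sV (coord sV d v i w) (v i)))"
    by (simp add: act_sum_right g.sum act_scale_right g.scale)
  finally show ?thesis using vs.coord_expand[OF v, of w] by simp
qed

lemma alg_trace_split_product:
  assumes fr: "leonard_frame sV d (act A) (act As) e f \<theta> \<theta>s"
    and P: "\<And>v. act P v = sV (coord sV d f 0 v) (f 0)"
  shows "alg_trace sV act d (P * split_product sA A \<theta> n) =
    coord sV d f 0 (leonard_frame.split sV (act A) f \<theta> n)"
proof -
  interpret leonard_frame sV d "act A" "act As" e f \<theta> \<theta>s by (rule fr)
  have lin: "Vector_Spaces.linear sV (*) (coord sV d f 0)"
    unfolding Vector_Spaces.linear_iff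
    by (auto simp: vs.vector_space_axioms cf_simps) (unfold_locales, auto simp: algebra_simps)
  have "act (\<Prod>h\<leftarrow>hs. A - sA (\<theta> h) 1) v = shifts (map \<theta> hs) v" for hs v
    by (induction hs) (auto simp: act_one act_mult act_minus_scalar)
  hence "act (split_product sA A \<theta> n) (f 0) = shifts (map \<theta> [0..<n]) (f 0)"
    unfolding split_product_def .
  also have "\<dots> = split n"
    unfolding split_def
    by (rule vs.coord_eqI[OF be])
       (simp add: ce_shifts rev_map[symmetric] prod_list.rev o_def)
  finally show ?thesis using alg_trace_rank_one[OF P lin] by simp
qed

text \<open>The sequence \<open>phi\<close> is the sequence \<open>varphi\<close> of the frame with \<open>\<theta>\<close> reversed. The end entries are
  rewritten with the corner identities so that all four involve the eigenbasis of \<open>A\<close> only.\<close>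

lemma parameter_array_scalars:
  assumes fr: "leonard_frame sV d (act A) (act As) e f \<theta> \<theta>s"
    and Es: "\<And>v. act (Es 0) v = sV (coord sV d f 0 v) (f 0)"
    and par: "parameter_array sA sV act d (A, E, As, Es) (\<theta>, \<theta>s, varphi, phi)"
  obtains c where "leonard_scalars d \<theta> \<theta>s (coord sV d e 0 (act As (e 0))) (coord sV d e d (act As (e d)))
      (coord sV d f 0 (act A (f 0))) (coord sV d f d (act A (f d))) c"
    "varphi 1 = (\<theta> 0 - \<theta> 1) * (coord sV d e 0 (act As (e 0)) - \<theta>s 0)"
    "varphi d = (\<theta> d - \<theta> (d - 1)) * (coord sV d e d (act As (e d)) - \<theta>s d)"
    "phi 1 = (\<theta> d - \<theta> (d - 1)) * (coord sV d e d (act As (e d)) - \<theta>s 0)"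
    "phi d = (\<theta> 0 - \<theta> 1) * (coord sV d e 0 (act As (e 0)) - \<theta>s d)"
proof -
  interpret F: leonard_frame sV d "act A" "act As" e f \<theta> \<theta>s by (rule fr)
  interpret R: leonard_frame sV d "act A" "act As" "\<lambda>i. e (d - i)" f "\<lambda>i. \<theta> (d - i)" \<theta>s
    by (rule F.rev_fst)
  interpret S: leonard_frame sV d "act A" "act As" e "\<lambda>i. f (d - i)" \<theta> "\<lambda>i. \<theta>s (d - i)"
    by (rule F.rev_snd)
  interpret T: leonard_frame sV d "act A" "act As" "\<lambda>i. e (d - i)" "\<lambda>i. f (d - i)" "\<lambda>i. \<theta> (d - i)" "\<lambda>i. \<theta>s (d - i)"
    by (rule R.rev_snd)
  have d: "d \<ge> 1" by (rule F.d_pos)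
  have varphi: "varphi i = F.vp i" if "1 \<le> i" "i \<le> d" for i
    using par that unfolding parameter_array_def F.vp_ratio[OF that]
    by (simp add: alg_trace_split_product[OF fr Es])
  have phi: "phi i = R.vp i" if "1 \<le> i" "i \<le> d" for i
    using par that unfolding parameter_array_def R.vp_ratio[OF that]
    by (simp add: alg_trace_split_product[OF F.rev_fst Es])
  have dd: "d - (d - 1) = 1" using d by simp
  have simps: "coord sV d (\<lambda>i. e (d - i)) d v = coord sV d e 0 v"
    "coord sV d (\<lambda>i. f (d - i)) 0 v = coord sV d f d v"
    "coord sV d (\<lambda>i. f (d - i)) d v = coord sV d f 0 v" for v
    by (simp_all add: vs.coord_rev)
  note corners = R.corner_identity F.corner_identity T.corner_identity S.corner_identity
  note corners = corners[unfolded simps dd diff_self_eq_0 diff_zero]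
  from F.recurrences obtain c where c: "c \<noteq> 0" "recurrent d c \<theta>" "recurrent d c \<theta>s" by blast
  have L: "leonard_scalars d \<theta> \<theta>s (F.B 0 0) (F.B d d) (F.C 0 0) (F.C d d) c"
    by (rule leonard_scalars.intro) (rule d F.inj_\<theta> F.inj_\<theta>s c corners)+
  have "varphi 1 = (\<theta> 0 - \<theta> 1) * (F.B 0 0 - \<theta>s 0)"
    using varphi[of 1] d F.vp_first corners(1) by simp
  moreover have "phi 1 = (\<theta> d - \<theta> (d - 1)) * (F.B d d - \<theta>s 0)"
    using phi[of 1] d R.vp_first corners(2) by simp
  moreover have "varphi d = (\<theta> d - \<theta> (d - 1)) * (F.B d d - \<theta>s d)"
    using varphi[of d] d F.vp_last by simp
  moreover have "phi d = (\<theta> 0 - \<theta> 1) * (F.B 0 0 - \<theta>s d)"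
    using phi[of d] d R.vp_last by (simp add: simps)
  ultimately show ?thesis using that L by blast
qed

end

section \<open>The isomorphism criterion\<close>

context full_module
begin

text \<open>Conjugation by an invertible linear map, transported from linear maps to the algebra.\<close>

lemma isomorphic_of_intertwiner:
  assumes G: "Vector_Spaces.linear sV sV G" "bij G"
    and "\<And>v. G (act x v) = act x' (G v)" "\<And>v. G (act y v) = act y' (G v)"
  shows "leonard_pair_isomorphic sA (x, y) sA (x', y')"
proof -
  interpret G: Vector_Spaces.linear sV sV G by (rule G)
  have GH: "G (inv_into UNIV G v) = v" and HG: "inv_into UNIV G (G v) = v" for v
    using G(2) by (simp_all add: bij_is_surj surj_f_inv_f bij_is_inj)
  have H: "Vector_Spaces.linear sV sV (inv_into UNIV G)"
    unfolding Vector_Spaces.linear_iff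
  proof (intro conjI allI vs.vector_space_axioms)
    show "inv_into UNIV G (v + w) = inv_into UNIV G v + inv_into UNIV G w" for v w
      using HG[of "inv_into UNIV G v + inv_into UNIV G w"] by (simp add: G.add GH)
    show "inv_into UNIV G (sV c v) = sV c (inv_into UNIV G v)" for c v
      using HG[of "sV c (inv_into UNIV G v)"] by (simp add: G.scale GH)
  qed
  define \<sigma> where "\<sigma> z = (SOME z'. act z' = G \<circ> act z \<circ> inv_into UNIV G)" for z
  define \<tau> where "\<tau> z = (SOME z'. act z' = inv_into UNIV G \<circ> act z \<circ> G)" for z
  have \<sigma>: "act (\<sigma> z) = G \<circ> act z \<circ> inv_into UNIV G" for z
    unfolding \<sigma>_def
    by (rule someI_ex, rule full)
       (rule Vector_Spaces.linear_compose[OF H Vector_Spaces.linear_compose[OF act_linear G(1)]])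
  have \<tau>: "act (\<tau> z) = inv_into UNIV G \<circ> act z \<circ> G" for z
    unfolding \<tau>_def
    by (rule someI_ex, rule full)
       (rule Vector_Spaces.linear_compose[OF G(1) Vector_Spaces.linear_compose[OF act_linear H]])
  have "bij \<sigma>"
    by (rule o_bij[of \<tau>]) (auto simp: fun_eq_iff \<sigma> \<tau> GH HG intro!: faithful)
  moreover have "Vector_Spaces.linear sA sA \<sigma>"
    unfolding Vector_Spaces.linear_iff
    by (intro conjI allI alg.vector_space_axioms faithful)
       (auto simp: fun_eq_iff \<sigma> act_add_left act_scale G.add G.scale)
  moreover have "\<sigma> 1 = 1" by (rule faithful) (auto simp: fun_eq_iff \<sigma> act_one GH)
  moreover have "\<sigma> (z * w) = \<sigma> z * \<sigma> w" for z w
    by (rule faithful) (auto simp: fun_eq_iff \<sigma> act_mult HG)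
  moreover have "\<sigma> x = x'" by (rule faithful) (auto simp: fun_eq_iff \<sigma> assms(3) GH)
  moreover have "\<sigma> y = y'" by (rule faithful) (auto simp: fun_eq_iff \<sigma> assms(4) GH)
  moreover have "k_algebra sA" by (rule alg.k_algebra_axioms)
  ultimately show ?thesis
    unfolding leonard_pair_isomorphic_def k_algebra_iso_def by auto
qed

lemma frame_projection:
  assumes "leonard_frame sV d (act x) Y e f \<theta> \<theta>s" "i \<le> d"
  shows "act (primitive_idempotent sA d x \<theta> i) v = sV (coord sV d e i v) (e i)"
proof -
  interpret leonard_frame sV d "act x" Y e f \<theta> \<theta>s by fact
  let ?P = "primitive_idempotent sA d x \<theta> i"
  have "act ?P v = (\<Sum>k\<le>d. act ?P (sV (ce k v) (e k)))"
    by (subst vs.coord_expand[OF be, of v]) (simp add: act_sum_right)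
  also have "\<dots> = (\<Sum>k\<le>d. if k = i then sV (ce i v) (e i) else 0)"
  proof (rule sum.cong)
    fix k assume k: "k \<in> {..d}"
    have "act ?P (e k) = (if k = i then e k else 0)"
      by (rule act_primitive_idempotent) (use k X_e inj_\<theta> assms(2) in auto)
    thus "act ?P (sV (ce k v) (e k)) = (if k = i then sV (ce i v) (e i) else 0)"
      by (simp add: act_scale_right)
  qed simp
  finally show ?thesis using assms(2) by simp
qed

lemma iso_primitive_idempotent:
  assumes "k_algebra_iso sA sA \<sigma>"
  shows "\<sigma> (primitive_idempotent sA d x \<theta> i) = primitive_idempotent sA d (\<sigma> x) \<theta> i"
proof -
  have lin: "Vector_Spaces.linear sA sA \<sigma>" and one: "\<sigma> 1 = 1" and mult: "\<And>x y. \<sigma> (x * y) = \<sigma> x * \<sigma> y"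
    using assms unfolding k_algebra_iso_def by auto
  interpret \<sigma>: Vector_Spaces.linear sA sA \<sigma> by (rule lin)
  have "\<sigma> (\<Prod>j\<leftarrow>js. sA (g j) (x - sA (\<theta> j) 1)) = (\<Prod>j\<leftarrow>js. sA (g j) (\<sigma> x - sA (\<theta> j) 1))" for js g
    by (induction js) (simp_all add: one mult \<sigma>.scale \<sigma>.diff)
  thus ?thesis unfolding primitive_idempotent_def .
qed

text \<open>The image of the idempotent of \<open>x\<close> for \<open>\<theta> i\<close> is the idempotent of \<open>x'\<close> for the same eigenvalue,
  that is, for some \<open>\<theta>' (p i)\<close>. The automorphism keeps the zero pattern of the tridiagonal matrices,
  so \<open>p\<close> moves neighbours to neighbours; and it keeps the scalars by which \<open>y\<close>, sandwiched between
  equal idempotents, acts.\<close>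

lemma isomorphic_match:
  assumes fr: "leonard_frame sV d (act x) (act y) e f \<theta> \<theta>s"
    and fr': "leonard_frame sV d (act x') (act y') e' f' \<theta>' \<theta>s'"
    and iso: "k_algebra_iso sA sA \<sigma>" "\<sigma> x = x'" "\<sigma> y = y'"
  obtains p where "p \<in> {\<lambda>i. i, \<lambda>i. d - i}" "\<And>i. i \<le> d \<Longrightarrow> \<theta> i = \<theta>' (p i)"
    "\<And>i. i \<le> d \<Longrightarrow> coord sV d e i (act y (e i)) = coord sV d e' (p i) (act y' (e' (p i)))"
proof -
  interpret F: leonard_frame sV d "act x" "act y" e f \<theta> \<theta>s by (rule fr)
  interpret N: leonard_frame sV d "act x'" "act y'" e' f' \<theta>' \<theta>s' by (rule fr')
  have lin: "Vector_Spaces.linear sA sA \<sigma>" and one: "\<sigma> 1 = 1" and mult: "\<And>x y. \<sigma> (x * y) = \<sigma> x * \<sigma> y"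
    and bij: "bij \<sigma>"
    using iso(1) unfolding k_algebra_iso_def by auto
  interpret \<sigma>: Vector_Spaces.linear sA sA \<sigma> by (rule lin)
  have \<sigma>_zero: "\<sigma> z = 0 \<longleftrightarrow> z = 0" for z using bij by (metis \<sigma>.zero bij_is_inj injD)
  define P where "P i = primitive_idempotent sA d x \<theta> i" for i
  define Q where "Q i = primitive_idempotent sA d x' \<theta> i" for i
  have \<sigma>P: "\<sigma> (P i) = Q i" for i
    unfolding P_def Q_def by (simp add: iso_primitive_idempotent[OF iso(1)] iso(2))
  have actP: "act (P i) v = sV (F.ce i v) (e i)" if "i \<le> d" for i v
    unfolding P_def by (rule frame_projection[OF fr that])
  have P_nonzero: "P i \<noteq> 0" if i: "i \<le> d" for i
  proof
    assume "P i = 0"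
    hence "e i = 0"
      using actP[OF i, of "e i"] i by (simp add: act_zero_left vs.coord_basis[OF F.be])
    thus False using vs.coord_basis[OF F.be i i] by (simp add: vs.coord_zero)
  qed
  have xP: "x * P i = sA (\<theta> i) (P i)" if i: "i \<le> d" for i
    by (rule faithful) (auto simp: fun_eq_iff act_mult actP[OF i] act_scale act_scale_right F.X_e[OF i] mult.commute)
  have xQ: "x' * Q i = sA (\<theta> i) (Q i)" if "i \<le> d" for i
    using arg_cong[OF xP[OF that], of \<sigma>] by (simp add: mult \<sigma>P iso(2) \<sigma>.scale)
  \<comment> \<open>A nonzero vector in the image of \<open>Q i\<close> is an eigenvector of \<open>x'\<close> for \<open>\<theta> i\<close>.\<close>
  have "\<exists>k\<le>d. \<theta>' k = \<theta> i" if i: "i \<le> d" for i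
  proof -
    have "Q i \<noteq> 0" using P_nonzero[OF i] \<sigma>_zero \<sigma>P by metis
    then obtain v where v: "act (Q i) v \<noteq> 0"
      using faithful[of "Q i" 0] by (auto simp: fun_eq_iff act_zero_left)
    let ?w = "act (Q i) v"
    obtain k where k: "k \<le> d" "N.ce k ?w \<noteq> 0"
      using vs.coord_eqI[OF N.be, of ?w 0] v by (auto simp: vs.coord_zero)
    have "act x' ?w = sV (\<theta> i) ?w" using xQ[OF i] by (simp add: act_mult[symmetric] act_scale)
    hence "\<theta>' k * N.ce k ?w = \<theta> i * N.ce k ?w" using N.ce_X[OF k(1), of ?w] by (simp only: N.ce_simps)
    thus ?thesis using k by auto
  qed
  hence "\<exists>p. \<forall>i\<le>d. p i \<le> d \<and> \<theta>' (p i) = \<theta> i" by metis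
  then obtain p where p: "\<And>i. i \<le> d \<Longrightarrow> p i \<le> d" "\<And>i. i \<le> d \<Longrightarrow> \<theta>' (p i) = \<theta> i" by blast
  have inj_p: "inj_on p {..d}"
    using p(2) F.inj_\<theta> unfolding inj_on_def by (metis atMost_iff)
  have surj_p: "p ` {..d} = {..d}"
    by (rule endo_inj_surj) (use inj_p p(1) in auto)
  have actQ: "act (Q i) v = sV (N.ce (p i) v) (e' (p i))" if i: "i \<le> d" for i v
  proof -
    have "act (Q i) v = (\<Sum>k\<le>d. act (Q i) (sV (N.ce k v) (e' k)))"
      by (subst vs.coord_expand[OF N.be, of v]) (simp add: act_sum_right)
    also have "\<dots> = (\<Sum>k\<le>d. if k = p i then sV (N.ce (p i) v) (e' (p i)) else 0)"
    proof (rule sum.cong)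
      fix k assume "k \<in> {..d}"
      then obtain j where j: "j \<le> d" "k = p j" using surj_p by (metis atMost_iff imageE)
      have "act (Q i) (e' (p j)) = (if j = i then e' (p j) else 0)"
        unfolding Q_def
        by (rule act_primitive_idempotent) (use j i p N.X_e F.inj_\<theta> in auto)
      moreover have "k = p i \<longleftrightarrow> j = i" using inj_p i j by (auto dest: inj_onD)
      ultimately show "act (Q i) (sV (N.ce k v) (e' k)) = (if k = p i then sV (N.ce (p i) v) (e' (p i)) else 0)"
        using j by (simp add: act_scale_right)
    qed simp
    finally show ?thesis using p(1)[OF i] by simp
  qed
  have zero_iff: "F.B i j = 0 \<longleftrightarrow> N.B (p i) (p j) = 0" if "i \<le> d" "j \<le> d" for i j
  proof -
    have "F.B i j = 0 \<longleftrightarrow> P i * y * P j = 0"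
      using sandwich_zero_iff[OF F.be actP actP] that by simp
    also have "\<dots> \<longleftrightarrow> Q i * y' * Q j = 0"
      using \<sigma>_zero[of "P i * y * P j"] by (simp add: mult \<sigma>P iso(3))
    also have "\<dots> \<longleftrightarrow> N.B (p i) (p j) = 0"
      using sandwich_zero_iff[OF N.be actQ actQ] that p(1) by simp
    finally show ?thesis .
  qed
  have "(\<forall>i\<le>d. p i = i) \<or> (\<forall>i\<le>d. p i = d - i)"
  proof (rule path_permutation[OF inj_p p(1)])
    fix i assume i: "i < d"
    have "N.B (p i) (p (Suc i)) \<noteq> 0"
      using zero_iff[of i "Suc i"] F.B_nonzero[of i "Suc i"] i by simp
    hence "\<not> (Suc (p i) < p (Suc i) \<or> Suc (p (Suc i)) < p i)"
      using N.B_zero[of "p i" "p (Suc i)"] p(1)[of i] p(1)[of "Suc i"] i by auto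
    moreover have "p i \<noteq> p (Suc i)" using inj_p i by (auto dest: inj_onD)
    ultimately show "\<bar>int (p i) - int (p (Suc i))\<bar> = 1" by linarith
  qed
  moreover have diag: "F.B i i = N.B (p i) (p i)" if i: "i \<le> d" for i
  proof -
    have "P i * y * P i = sA (F.B i i) (P i)"
      by (rule faithful)
         (auto simp: fun_eq_iff act_mult actP[OF i] act_scale act_scale_right F.ce_simps mult.commute)
    from arg_cong[OF this, of \<sigma>] have "Q i * y' * Q i = sA (F.B i i) (Q i)"
      by (simp add: mult \<sigma>P iso(3) \<sigma>.scale)
    hence "act (Q i * y' * Q i) (e' (p i)) = act (sA (F.B i i) (Q i)) (e' (p i))" by simp
    hence "N.ce (p i) (act (Q i * y' * Q i) (e' (p i))) = N.ce (p i) (act (sA (F.B i i) (Q i)) (e' (p i)))"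
      by simp
    thus ?thesis using p(1)[OF i]
      by (simp add: act_mult actQ[OF i] act_scale N.ce_simps vs.coord_basis[OF N.be])
  qed
  ultimately consider "\<And>i. i \<le> d \<Longrightarrow> p i = i" | "\<And>i. i \<le> d \<Longrightarrow> p i = d - i" by blast
  thus ?thesis
  proof cases
    case 1
    show ?thesis by (rule that[of "\<lambda>i. i"]) (use 1 p(2) diag in auto)
  next
    case 2
    show ?thesis by (rule that[of "\<lambda>i. d - i"]) (use 2 p(2) diag in auto)
  qed
qed

lemma frame_relative:
  assumes "leonard_frame sV d X Y e f \<theta> \<theta>s" "p \<in> {\<lambda>i. i, \<lambda>i. d - i}" "r \<in> {\<lambda>i. i, \<lambda>i. d - i}"
  shows "leonard_frame sV d X Y (\<lambda>i. e (p i)) (\<lambda>i. f (r i)) (\<lambda>i. \<theta> (p i)) (\<lambda>i. \<theta>s (r i))"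
proof -
  have "leonard_frame sV d X Y (\<lambda>i. e (p i)) f (\<lambda>i. \<theta> (p i)) \<theta>s"
    using assms(1,2) leonard_frame.rev_fst[OF assms(1)] by auto
  thus ?thesis using assms(3) leonard_frame.rev_snd by auto
qed

lemma leonard_frame_cong:
  assumes "leonard_frame sV d X Y e f \<theta> \<theta>s"
    "\<And>i. i \<le> d \<Longrightarrow> \<theta>' i = \<theta> i" "\<And>i. i \<le> d \<Longrightarrow> \<theta>s' i = \<theta>s i"
  shows "leonard_frame sV d X Y e f \<theta>' \<theta>s'"
proof -
  interpret leonard_frame sV d X Y e f \<theta> \<theta>s by fact
  show ?thesis
  proof (intro leonard_frame.intro leonard_frame_axioms.intro vs.vector_space_axioms)
    show "inj_on \<theta>' {..d}" using inj_\<theta> by (simp add: inj_on_def assms(2))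
    show "inj_on \<theta>s' {..d}" using inj_\<theta>s by (simp add: inj_on_def assms(3))
    show "X (e i) = sV (\<theta>' i) (e i)" if "i \<le> d" for i using X_e[OF that] assms(2)[OF that] by simp
    show "Y (f i) = sV (\<theta>s' i) (f i)" if "i \<le> d" for i using Y_f[OF that] assms(3)[OF that] by simp
  qed (rule d_pos linX linY be bf tri_e tri_f)+
qed

text \<open>The eigenvalue sequences together with the last diagonal entry form a complete invariant, up to
  reversal of either ordering.\<close>

theorem isomorphic_iff:
  assumes fr: "leonard_frame sV d (act x) (act y) e f \<theta> \<theta>s"
    and fr': "leonard_frame sV d (act x') (act y') e' f' \<theta>' \<theta>s'"
  shows "leonard_pair_isomorphic sA (x, y) sA (x', y') \<longleftrightarrow>
    (\<exists>p\<in>{\<lambda>i. i, \<lambda>i. d - i}. \<exists>r\<in>{\<lambda>i. i, \<lambda>i. d - i}.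
       (\<forall>i\<le>d. \<theta> i = \<theta>' (p i)) \<and> (\<forall>i\<le>d. \<theta>s i = \<theta>s' (r i)) \<and>
       coord sV d e d (act y (e d)) = coord sV d e' (p d) (act y' (e' (p d))))"
    (is "?iso \<longleftrightarrow> ?match")
proof
  assume ?iso
  then obtain \<sigma> where \<sigma>: "k_algebra_iso sA sA \<sigma>" "\<sigma> x = x'" "\<sigma> y = y'"
    unfolding leonard_pair_isomorphic_def by auto
  obtain p where p: "p \<in> {\<lambda>i. i, \<lambda>i. d - i}" "\<And>i. i \<le> d \<Longrightarrow> \<theta> i = \<theta>' (p i)"
    "\<And>i. i \<le> d \<Longrightarrow> coord sV d e i (act y (e i)) = coord sV d e' (p i) (act y' (e' (p i)))"
    by (rule isomorphic_match[OF fr fr' \<sigma>]) blast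
  obtain r where r: "r \<in> {\<lambda>i. i, \<lambda>i. d - i}" "\<And>i. i \<le> d \<Longrightarrow> \<theta>s i = \<theta>s' (r i)"
    by (rule isomorphic_match[OF leonard_frame.swap[OF fr] leonard_frame.swap[OF fr'] \<sigma>(1,3,2)]) blast
  show ?match using p r by (intro bexI[of _ p] bexI[of _ r]) auto
next
  assume ?match
  then obtain p r where pr: "p \<in> {\<lambda>i. i, \<lambda>i. d - i}" "r \<in> {\<lambda>i. i, \<lambda>i. d - i}"
    and m: "\<And>i. i \<le> d \<Longrightarrow> \<theta> i = \<theta>' (p i)" "\<And>i. i \<le> d \<Longrightarrow> \<theta>s i = \<theta>s' (r i)"
    and b: "coord sV d e d (act y (e d)) = coord sV d e' (p d) (act y' (e' (p d)))"
    by blast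
  interpret F: leonard_frame sV d "act x" "act y" e f \<theta> \<theta>s by (rule fr)
  have N: "leonard_frame sV d (act x') (act y') (\<lambda>i. e' (p i)) (\<lambda>i. f' (r i)) \<theta> \<theta>s"
    by (rule leonard_frame_cong[OF frame_relative[OF fr' pr]]) (use m in auto)
  have "coord sV d (\<lambda>i. e' (p i)) d (act y' (e' (p d))) = F.B d d"
    using pr(1) b by (auto simp: vs.coord_rev)
  then obtain G where "Vector_Spaces.linear sV sV G" "bij G"
    "\<And>v. G (act x v) = act x' (G v)" "\<And>v. G (act y v) = act y' (G v)"
    by (rule F.intertwiner[OF N]) blast
  thus ?iso by (rule isomorphic_of_intertwiner)
qed

end

section \<open>Affine images of a Leonard pair\<close>

context leonard_scalars
begin

text \<open>The criterion for \<open>(A, As)\<close> and an affine image of it. Each pair of reversals \<open>p\<close>, \<open>r\<close> contributes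
  one quadruple. The conditional selects the diagonal entry at \<open>p d\<close>, which is \<open>d\<close> or \<open>0\<close>.\<close>

lemma affine_self_match:
  "(\<exists>p\<in>{\<lambda>i. i, \<lambda>i. d - i}. \<exists>r\<in>{\<lambda>i. i, \<lambda>i. d - i}.
      (\<forall>i\<le>d. \<theta> i = \<xi> * \<theta> (p i) + \<zeta>) \<and> (\<forall>i\<le>d. \<theta>s i = \<xi>s * \<theta>s (r i) + \<zeta>s) \<and>
      sd = \<xi>s * (if p d = d then sd else s0) + \<zeta>s) \<longleftrightarrow>
   (\<xi>, \<zeta>, \<xi>s, \<zeta>s) = (1, 0, 1, 0) \<or>
   (\<xi>, \<zeta>, \<xi>s, \<zeta>s) = (1, 0, -1, \<theta>s 0 + \<theta>s d) \<and> varphi_1 = - phi_d \<and> varphi_d = - phi_1 \<or>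
   (\<xi>, \<zeta>, \<xi>s, \<zeta>s) = (-1, \<theta> 0 + \<theta> d, 1, 0) \<and> varphi_1 = - phi_1 \<and> varphi_d = - phi_d \<or>
   (\<xi>, \<zeta>, \<xi>s, \<zeta>s) = (-1, \<theta> 0 + \<theta> d, -1, \<theta>s 0 + \<theta>s d) \<and> varphi_1 = varphi_d \<and> phi_1 = phi_d"
  (is "?L \<longleftrightarrow> ?t1 \<or> ?t2 \<or> ?t3 \<or> ?t4")
proof -
  note self = affine_self_iff[OF neq(1)] affine_self_iff[OF neqs(1)]
    and rev = affine_rev_iff[OF neq(1)] affine_rev_iff[OF neqs(1)]
  have d0: "(d - d = d) = False" using d_pos by simp
  have "?L \<longleftrightarrow>
     ((\<forall>i\<le>d. \<theta> i = \<xi> * \<theta> i + \<zeta>) \<and> (\<forall>i\<le>d. \<theta>s i = \<xi>s * \<theta>s i + \<zeta>s) \<and> sd = \<xi>s * sd + \<zeta>s \<or>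
      (\<forall>i\<le>d. \<theta> i = \<xi> * \<theta> i + \<zeta>) \<and> (\<forall>i\<le>d. \<theta>s i = \<xi>s * \<theta>s (d - i) + \<zeta>s) \<and> sd = \<xi>s * sd + \<zeta>s) \<or>
     ((\<forall>i\<le>d. \<theta> i = \<xi> * \<theta> (d - i) + \<zeta>) \<and> (\<forall>i\<le>d. \<theta>s i = \<xi>s * \<theta>s i + \<zeta>s) \<and> sd = \<xi>s * s0 + \<zeta>s \<or>
      (\<forall>i\<le>d. \<theta> i = \<xi> * \<theta> (d - i) + \<zeta>) \<and> (\<forall>i\<le>d. \<theta>s i = \<xi>s * \<theta>s (d - i) + \<zeta>s) \<and> sd = \<xi>s * s0 + \<zeta>s)"
    by (simp only: bex_simps d0 if_True if_False simp_thms) blast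
  also have "\<dots> \<longleftrightarrow> (?t1 \<or> ?t2) \<or> (?t3 \<or> ?t4)"
  proof (intro arg_cong2[where f = "(\<or>)"])
    show "((\<forall>i\<le>d. \<theta> i = \<xi> * \<theta> i + \<zeta>) \<and> (\<forall>i\<le>d. \<theta>s i = \<xi>s * \<theta>s i + \<zeta>s) \<and> sd = \<xi>s * sd + \<zeta>s) = ?t1"
      unfolding self by auto
    show "((\<forall>i\<le>d. \<theta> i = \<xi> * \<theta> i + \<zeta>) \<and> (\<forall>i\<le>d. \<theta>s i = \<xi>s * \<theta>s (d - i) + \<zeta>s) \<and> sd = \<xi>s * sd + \<zeta>s) = ?t2"
      unfolding self rev reversal_snd_iff[symmetric] prod.inject by (simp cong: conj_cong)
    show "((\<forall>i\<le>d. \<theta> i = \<xi> * \<theta> (d - i) + \<zeta>) \<and> (\<forall>i\<le>d. \<theta>s i = \<xi>s * \<theta>s i + \<zeta>s) \<and> sd = \<xi>s * s0 + \<zeta>s) = ?t3"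
      unfolding self rev reversal_fst_iff[symmetric] prod.inject by (auto cong: conj_cong)
    show "((\<forall>i\<le>d. \<theta> i = \<xi> * \<theta> (d - i) + \<zeta>) \<and> (\<forall>i\<le>d. \<theta>s i = \<xi>s * \<theta>s (d - i) + \<zeta>s) \<and> sd = \<xi>s * s0 + \<zeta>s) = ?t4"
      unfolding self rev reversal_both_iff[symmetric] prod.inject by (auto cong: conj_cong)
  qed
  finally show ?thesis by (simp only: disj_assoc)
qed

text \<open>The same for \<open>(As, A)\<close> and an affine image of \<open>(A, As)\<close>.\<close>

lemma affine_swap_match:
  "(\<exists>p\<in>{\<lambda>i. i, \<lambda>i. d - i}. \<exists>r\<in>{\<lambda>i. i, \<lambda>i. d - i}.
      (\<forall>i\<le>d. \<theta>s i = \<xi> * \<theta> (p i) + \<zeta>) \<and> (\<forall>i\<le>d. \<theta> i = \<xi>s * \<theta>s (r i) + \<zeta>s) \<and>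
      ad = \<xi>s * (if p d = d then sd else s0) + \<zeta>s) \<longleftrightarrow>
   (\<xi>, \<zeta>, \<xi>s, \<zeta>s) = (\<alpha>, \<theta>s 0 - \<alpha> * \<theta> 0, inverse \<alpha>, \<theta> 0 - inverse \<alpha> * \<theta>s 0) \<and> phi_1 = phi_d \<or>
   (\<xi>, \<zeta>, \<xi>s, \<zeta>s) = (\<alpha>, \<theta>s 0 - \<alpha> * \<theta> 0, - inverse \<alpha>, \<theta> 0 + inverse \<alpha> * \<theta>s d)
     \<and> varphi_1 = varphi_d \<and> phi_1 = phi_d \<and> varphi_1 = - phi_1 \<or>
   (\<xi>, \<zeta>, \<xi>s, \<zeta>s) = (- \<alpha>, \<theta>s d + \<alpha> * \<theta> 0, inverse \<alpha>, \<theta> 0 - inverse \<alpha> * \<theta>s 0)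
     \<and> varphi_1 = varphi_d \<and> phi_1 = phi_d \<and> varphi_1 = - phi_1 \<or>
   (\<xi>, \<zeta>, \<xi>s, \<zeta>s) = (- \<alpha>, \<theta>s d + \<alpha> * \<theta> 0, - inverse \<alpha>, \<theta> 0 + inverse \<alpha> * \<theta>s d) \<and> varphi_1 = varphi_d"
  (is "?L \<longleftrightarrow> ?t1 \<or> ?t2 \<or> ?t3 \<or> ?t4")
proof -
  have aff_sym: "affinely_related d \<theta>s \<theta> \<longleftrightarrow> affinely_related d \<theta> \<theta>s"
    by (rule affinely_related_sym[OF neqs(1) neq(1)])
  have anti_sym: "affinely_related d (\<lambda>i. \<theta>s (d - i)) \<theta> \<longleftrightarrow> affinely_related d (\<lambda>i. \<theta> (d - i)) \<theta>s"
    using affinely_related_rev[of d \<theta> \<theta>s] affinely_related_rev[of d \<theta>s \<theta>]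
      affinely_related_sym[of "\<lambda>i. \<theta> (d - i)" d \<theta>s] affinely_related_sym[of "\<lambda>i. \<theta>s (d - i)" d \<theta>]
      neq(1) neqs(1) by auto
  \<comment> \<open>The offset obtained from \<open>affine_other_rev_iff\<close> refers to the other pair of ends.\<close>
  have shift: "\<theta> d + inverse \<alpha> * \<theta>s 0 = \<theta> 0 + inverse \<alpha> * \<theta>s d"
  proof -
    have "inverse \<alpha> * (\<theta>s d - \<theta>s 0) = \<theta> d - \<theta> 0"
      unfolding \<alpha>[symmetric] using \<alpha>_nonzero by simp
    thus ?thesis by (simp add: algebra_simps)
  qed
  note fwd = affine_other_iff[of \<theta> d \<theta>s, OF neq(1), folded \<alpha>_def]
    affine_other_iff[of \<theta>s d \<theta>, OF neqs(1), folded inverse_\<alpha>]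
    and rev = affine_other_rev_iff[of \<theta> d \<theta>s, OF neq(1), folded \<alpha>_def]
    affine_other_rev_iff[of \<theta>s d \<theta>, OF neqs(1), folded inverse_\<alpha>]
  have d0: "(d - d = d) = False" using d_pos by simp
  have "?L \<longleftrightarrow>
     ((\<forall>i\<le>d. \<theta>s i = \<xi> * \<theta> i + \<zeta>) \<and> (\<forall>i\<le>d. \<theta> i = \<xi>s * \<theta>s i + \<zeta>s) \<and> ad = \<xi>s * sd + \<zeta>s \<or>
      (\<forall>i\<le>d. \<theta>s i = \<xi> * \<theta> i + \<zeta>) \<and> (\<forall>i\<le>d. \<theta> i = \<xi>s * \<theta>s (d - i) + \<zeta>s) \<and> ad = \<xi>s * sd + \<zeta>s) \<or>
     ((\<forall>i\<le>d. \<theta>s i = \<xi> * \<theta> (d - i) + \<zeta>) \<and> (\<forall>i\<le>d. \<theta> i = \<xi>s * \<theta>s i + \<zeta>s) \<and> ad = \<xi>s * s0 + \<zeta>s \<or>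
      (\<forall>i\<le>d. \<theta>s i = \<xi> * \<theta> (d - i) + \<zeta>) \<and> (\<forall>i\<le>d. \<theta> i = \<xi>s * \<theta>s (d - i) + \<zeta>s) \<and> ad = \<xi>s * s0 + \<zeta>s)"
    by (simp only: bex_simps d0 if_True if_False simp_thms) blast
  also have "\<dots> \<longleftrightarrow> (?t1 \<or> ?t2) \<or> (?t3 \<or> ?t4)"
  proof (intro arg_cong2[where f = "(\<or>)"])
    show "((\<forall>i\<le>d. \<theta>s i = \<xi> * \<theta> i + \<zeta>) \<and> (\<forall>i\<le>d. \<theta> i = \<xi>s * \<theta>s i + \<zeta>s) \<and> ad = \<xi>s * sd + \<zeta>s) = ?t1"
      unfolding fwd aff_sym duality_iff[symmetric] prod.inject by blast
    show "((\<forall>i\<le>d. \<theta>s i = \<xi> * \<theta> i + \<zeta>) \<and> (\<forall>i\<le>d. \<theta> i = \<xi>s * \<theta>s (d - i) + \<zeta>s) \<and> ad = \<xi>s * sd + \<zeta>s) = ?t2"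
      unfolding fwd rev anti_sym shift duality_reversal_snd_iff[symmetric] prod.inject by blast
    show "((\<forall>i\<le>d. \<theta>s i = \<xi> * \<theta> (d - i) + \<zeta>) \<and> (\<forall>i\<le>d. \<theta> i = \<xi>s * \<theta>s i + \<zeta>s) \<and> ad = \<xi>s * s0 + \<zeta>s) = ?t3"
      unfolding fwd rev aff_sym duality_reversal_fst_iff[symmetric] prod.inject by blast
    show "((\<forall>i\<le>d. \<theta>s i = \<xi> * \<theta> (d - i) + \<zeta>) \<and> (\<forall>i\<le>d. \<theta> i = \<xi>s * \<theta>s (d - i) + \<zeta>s) \<and> ad = \<xi>s * s0 + \<zeta>s) = ?t4"
      unfolding rev anti_sym shift duality_reversal_both_iff[symmetric] prod.inject by blast
  qed
  finally show ?thesis by (simp only: disj_assoc)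
qed

end

context full_module
begin

lemma affine_frame:
  assumes "leonard_frame sV d (act A) (act As) e f \<theta> \<theta>s" "\<xi> \<noteq> 0" "\<xi>s \<noteq> 0"
  shows "leonard_frame sV d (act (sA \<xi> A + sA \<zeta> 1)) (act (sA \<xi>s As + sA \<zeta>s 1)) e f
    (\<lambda>i. \<xi> * \<theta> i + \<zeta>) (\<lambda>i. \<xi>s * \<theta>s i + \<zeta>s)"
  unfolding act_affine
  by (rule leonard_frame.affine_snd[OF leonard_frame.affine_fst[OF assms(1,2)] assms(3)])

lemma affine_coord:
  assumes "is_ordered_basis sV d e" "i \<le> d"
  shows "coord sV d e i (act (sA \<xi> x + sA \<zeta> 1) (e i)) = \<xi> * coord sV d e i (act x (e i)) + \<zeta>"
  by (simp add: act_affine vs.coord_add[OF assms(1)] vs.coord_scale[OF assms(1)]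
      vs.coord_basis[OF assms(1)] assms(2))

end

theorem theorem11p4:
  fixes sA :: "'k::field \<Rightarrow> 'a::ring_1 \<Rightarrow> 'a"
    and sV :: "'k \<Rightarrow> 'v::ab_group_add \<Rightarrow> 'v"
    and act :: "'a \<Rightarrow> 'v \<Rightarrow> 'v"
    and d :: nat
    and A As :: 'a
    and E Es :: "nat \<Rightarrow> 'a"
    and \<theta> \<theta>s varphi phi :: "nat \<Rightarrow> 'k"
    and \<alpha> :: 'k
  assumes "matrix_algebra d sA"
    and "irreducible_module sA sV act"
    and "leonard_pair sV act d (A, As)"
    and "leonard_system sA sV act d (A, E, As, Es)"
    and "parameter_array sA sV act d (A, E, As, Es) (\<theta>, \<theta>s, varphi, phi)"
    and "d \<ge> 1"
    and "\<alpha> = (\<theta>s d - \<theta>s 0) * inverse (\<theta> d - \<theta> 0)"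
  shows "
     (varphi 1 = varphi d \<and> varphi d = - phi 1 \<and> - phi 1 = - phi d \<longrightarrow>
       (\<forall>q\<in>affine_params. 
          leonard_pair_isomorphic sA (A, As) sA (affine_pair sA (A, As) q) \<longleftrightarrow>
          q \<in> {(1, 0, 1, 0),
               (1, 0, -1, \<theta>s 0 + \<theta>s d),
               (-1, \<theta> 0 + \<theta> d, 1, 0),
               (-1, \<theta> 0 + \<theta> d, -1, \<theta>s 0 + \<theta>s d)}) \<and>
       (\<forall>q\<in>affine_params. 
          leonard_pair_isomorphic sA (As, A) sA (affine_pair sA (A, As) q) \<longleftrightarrow>
          q \<in> {(\<alpha>, \<theta>s 0 - \<alpha> * \<theta> 0, inverse \<alpha>, \<theta> 0 - inverse \<alpha> * \<theta>s 0),
               (- \<alpha>, \<theta>s d + \<alpha> * \<theta> 0, inverse \<alpha>, \<theta> 0 - inverse \<alpha> * \<theta>s 0),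
               (\<alpha>, \<theta>s 0 - \<alpha> * \<theta> 0, - inverse \<alpha>, \<theta> 0 + inverse \<alpha> * \<theta>s d),
               (- \<alpha>, \<theta>s d + \<alpha> * \<theta> 0, - inverse \<alpha>, \<theta> 0 + inverse \<alpha> * \<theta>s d)})) \<and>
     (varphi 1 = varphi d \<and> phi 1 = phi d \<and> varphi 1 \<noteq> - phi 1 \<longrightarrow>
       (\<forall>q\<in>affine_params. 
          leonard_pair_isomorphic sA (A, As) sA (affine_pair sA (A, As) q) \<longleftrightarrow>
          q \<in> {(1, 0, 1, 0),
               (-1, \<theta> 0 + \<theta> d, -1, \<theta>s 0 + \<theta>s d)}) \<and>
       (\<forall>q\<in>affine_params. 
          leonard_pair_isomorphic sA (As, A) sA (affine_pair sA (A, As) q) \<longleftrightarrow>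
          q \<in> {(\<alpha>, \<theta>s 0 - \<alpha> * \<theta> 0, inverse \<alpha>, \<theta> 0 - inverse \<alpha> * \<theta>s 0),
               (- \<alpha>, \<theta>s d + \<alpha> * \<theta> 0, - inverse \<alpha>, \<theta> 0 + inverse \<alpha> * \<theta>s d)})) \<and>
     (varphi 1 = varphi d \<and> phi 1 \<noteq> phi d \<longrightarrow>
       (\<forall>q\<in>affine_params. 
          leonard_pair_isomorphic sA (A, As) sA (affine_pair sA (A, As) q) \<longleftrightarrow>
          q = (1, 0, 1, 0)) \<and>
       (\<forall>q\<in>affine_params. 
          leonard_pair_isomorphic sA (As, A) sA (affine_pair sA (A, As) q) \<longleftrightarrow>
          q = (- \<alpha>, \<theta>s d + \<alpha> * \<theta> 0, - inverse \<alpha>, \<theta> 0 + inverse \<alpha> * \<theta>s d))) \<and>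
     (phi 1 = phi d \<and> varphi 1 \<noteq> varphi d \<longrightarrow>
       (\<forall>q\<in>affine_params. 
          leonard_pair_isomorphic sA (A, As) sA (affine_pair sA (A, As) q) \<longleftrightarrow>
          q = (1, 0, 1, 0)) \<and>
       (\<forall>q\<in>affine_params. 
          leonard_pair_isomorphic sA (As, A) sA (affine_pair sA (A, As) q) \<longleftrightarrow>
          q = (\<alpha>, \<theta>s 0 - \<alpha> * \<theta> 0, inverse \<alpha>, \<theta> 0 - inverse \<alpha> * \<theta>s 0))) \<and>
     (varphi 1 = - phi 1 \<and> varphi d = - phi d \<and> varphi 1 \<noteq> varphi d \<longrightarrow>
       (\<forall>q\<in>affine_params. 
          leonard_pair_isomorphic sA (A, As) sA (affine_pair sA (A, As) q) \<longleftrightarrow>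
          q \<in> {(1, 0, 1, 0),
               (-1, \<theta> 0 + \<theta> d, 1, 0)}) \<and>
       (\<forall>q\<in>affine_params. \<not> leonard_pair_isomorphic sA (As, A) sA (affine_pair sA (A, As) q))) \<and>
     (varphi 1 = - phi d \<and> varphi d = - phi 1 \<and> varphi 1 \<noteq> varphi d \<longrightarrow>
       (\<forall>q\<in>affine_params. 
          leonard_pair_isomorphic sA (A, As) sA (affine_pair sA (A, As) q) \<longleftrightarrow>
          q \<in> {(1, 0, 1, 0),
               (1, 0, -1, \<theta>s 0 + \<theta>s d)}) \<and>
       (\<forall>q\<in>affine_params. \<not> leonard_pair_isomorphic sA (As, A) sA (affine_pair sA (A, As) q))) \<and>
     (\<not> (varphi 1 = varphi d \<and> varphi d = - phi 1 \<and> - phi 1 = - phi d) \<and>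
      \<not> (varphi 1 = varphi d \<and> phi 1 = phi d \<and> varphi 1 \<noteq> - phi 1) \<and>
      \<not> (varphi 1 = varphi d \<and> phi 1 \<noteq> phi d) \<and>
      \<not> (phi 1 = phi d \<and> varphi 1 \<noteq> varphi d) \<and>
      \<not> (varphi 1 = - phi 1 \<and> varphi d = - phi d \<and> varphi 1 \<noteq> varphi d) \<and>
      \<not> (varphi 1 = - phi d \<and> varphi d = - phi 1 \<and> varphi 1 \<noteq> varphi d) \<longrightarrow>
       (\<forall>q\<in>affine_params. 
          leonard_pair_isomorphic sA (A, As) sA (affine_pair sA (A, As) q) \<longleftrightarrow>
          q = (1, 0, 1, 0)) \<and>
       (\<forall>q\<in>affine_params. \<not> leonard_pair_isomorphic sA (As, A) sA (affine_pair sA (A, As) q)))"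
proof -
  obtain b where "full_module sA sV act d b" by (rule full_module[OF assms(1,2)])
  then interpret full_module sA sV act d b .
  have idem: "idempotents_for sA sV act d A E \<theta>" "idempotents_for sA sV act d As Es \<theta>s"
    using assms(5) unfolding parameter_array_def by auto
  obtain e f where fr: "leonard_frame sV d (act A) (act As) e f \<theta> \<theta>s"
    and Es: "\<And>v. act (Es 0) v = sV (coord sV d f 0 v) (f 0)"
    by (rule leonard_system_frame[OF assms(4,6) idem]) blast
  interpret F: leonard_frame sV d "act A" "act As" e f \<theta> \<theta>s by (rule fr)
  obtain c where L: "leonard_scalars d \<theta> \<theta>s (F.B 0 0) (F.B d d) (F.C 0 0) (F.C d d) c"
    and v: "varphi 1 = (\<theta> 0 - \<theta> 1) * (F.B 0 0 - \<theta>s 0)"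
      "varphi d = (\<theta> d - \<theta> (d - 1)) * (F.B d d - \<theta>s d)"
      "phi 1 = (\<theta> d - \<theta> (d - 1)) * (F.B d d - \<theta>s 0)"
      "phi d = (\<theta> 0 - \<theta> 1) * (F.B 0 0 - \<theta>s d)"
    by (rule parameter_array_scalars[OF fr Es assms(5)]) blast
  interpret L: leonard_scalars d \<theta> \<theta>s "F.B 0 0" "F.B d d" "F.C 0 0" "F.C d d" c by (rule L)
  have \<alpha>: "L.\<alpha> = \<alpha>" unfolding L.\<alpha>_def assms(7) ..
  have params: "L.varphi_1 = varphi 1" "L.varphi_d = varphi d" "L.phi_1 = phi 1" "L.phi_d = phi d"
    unfolding L.varphi_1_def L.varphi_d_def L.phi_1_def L.phi_d_def v by (rule refl)+
  have diag: "coord sV d e (p d) (act (sA \<xi>s As + sA \<zeta>s 1) (e (p d))) =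
      \<xi>s * (if p d = d then F.B d d else F.B 0 0) + \<zeta>s"
    if "p \<in> {\<lambda>i. i, \<lambda>i. d - i}" for p \<xi>s \<zeta>s
    using that affine_coord[OF F.be] by auto
  have self: "leonard_pair_isomorphic sA (A, As) sA (affine_pair sA (A, As) q) \<longleftrightarrow>
     q = (1, 0, 1, 0) \<or>
     q = (1, 0, -1, \<theta>s 0 + \<theta>s d) \<and> varphi 1 = - phi d \<and> varphi d = - phi 1 \<or>
     q = (-1, \<theta> 0 + \<theta> d, 1, 0) \<and> varphi 1 = - phi 1 \<and> varphi d = - phi d \<or>
     q = (-1, \<theta> 0 + \<theta> d, -1, \<theta>s 0 + \<theta>s d) \<and> varphi 1 = varphi d \<and> phi 1 = phi d"
    if q: "q \<in> affine_params" for q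
  proof -
    obtain \<xi> \<zeta> \<xi>s \<zeta>s where q_eq: "q = (\<xi>, \<zeta>, \<xi>s, \<zeta>s)" and nz: "\<xi> \<noteq> 0" "\<xi>s \<noteq> 0"
      using q unfolding affine_params_def by auto
    show ?thesis
      unfolding q_eq affine_pair_def prod.case
        isomorphic_iff[OF fr affine_frame[OF fr nz]] L.affine_self_match[unfolded params, symmetric]
      by (intro bex_cong refl) (simp only: diag)
  qed
  have swap: "leonard_pair_isomorphic sA (As, A) sA (affine_pair sA (A, As) q) \<longleftrightarrow>
     q = (\<alpha>, \<theta>s 0 - \<alpha> * \<theta> 0, inverse \<alpha>, \<theta> 0 - inverse \<alpha> * \<theta>s 0) \<and> phi 1 = phi d \<or>
     q = (\<alpha>, \<theta>s 0 - \<alpha> * \<theta> 0, - inverse \<alpha>, \<theta> 0 + inverse \<alpha> * \<theta>s d)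
       \<and> varphi 1 = varphi d \<and> phi 1 = phi d \<and> varphi 1 = - phi 1 \<or>
     q = (- \<alpha>, \<theta>s d + \<alpha> * \<theta> 0, inverse \<alpha>, \<theta> 0 - inverse \<alpha> * \<theta>s 0)
       \<and> varphi 1 = varphi d \<and> phi 1 = phi d \<and> varphi 1 = - phi 1 \<or>
     q = (- \<alpha>, \<theta>s d + \<alpha> * \<theta> 0, - inverse \<alpha>, \<theta> 0 + inverse \<alpha> * \<theta>s d) \<and> varphi 1 = varphi d"
    if q: "q \<in> affine_params" for q
  proof -
    obtain \<xi> \<zeta> \<xi>s \<zeta>s where q_eq: "q = (\<xi>, \<zeta>, \<xi>s, \<zeta>s)" and nz: "\<xi> \<noteq> 0" "\<xi>s \<noteq> 0"
      using q unfolding affine_params_def by auto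
    show ?thesis
      unfolding q_eq affine_pair_def prod.case
        isomorphic_iff[OF F.swap affine_frame[OF fr nz]] L.affine_swap_match[unfolded params \<alpha>, symmetric]
      by (intro bex_cong refl) (simp only: diag)
  qed
  \<comment> \<open>The seven cases are now propositional in the equalities between the four end entries; \<open>rel\<close> lists
    the dependencies among these equalities that the case distinction uses.\<close>
  define a b m11 m1d md1 mdd where "a \<longleftrightarrow> varphi 1 = varphi d" and "b \<longleftrightarrow> phi 1 = phi d"
    and "m11 \<longleftrightarrow> varphi 1 = - phi 1" and "m1d \<longleftrightarrow> varphi 1 = - phi d"
    and "md1 \<longleftrightarrow> varphi d = - phi 1" and "mdd \<longleftrightarrow> varphi d = - phi d"
  note atoms = this[symmetric]
  have rel: "(a \<longrightarrow> m11 = md1) \<and> (a \<longrightarrow> m1d = mdd) \<and> (b \<longrightarrow> m11 = m1d) \<and> (b \<longrightarrow> md1 = mdd) \<and>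
    (m11 \<and> m1d \<longrightarrow> b) \<and> (m11 \<and> md1 \<longrightarrow> a)"
    unfolding atoms[symmetric] by (intro conjI impI) auto
  show ?thesis
    by (intro conjI impI ballI; (subst self, assumption | subst swap, assumption);
        unfold insert_iff empty_iff neg_equal_iff_equal atoms; cut_tac rel) sat+
qed

end
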